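(* The equation $$1^k+2^k+\cdots+(m-1)^k=a\,m^k$$ has no solutions in integers $(a,m,k)$ with $a\ge 1$, $m\ge 2$, $k\ge 2$ and $$m<\max\left(10^{9\cdot 10^6},\ a\cdot 10^{28}\right).$$
   Context: The sum $1^k+2^k+\cdots+(m-1)^k$ denotes $\sum_{j=1}^{m-1}j^k$. *)

theory Defs
  imports Complex_Main
begin

end

theory Submission
  imports Defs "HOL-Analysis.Analysis" "HOL-Number_Theory.Number_Theory"
begin

text \<open>
  Suppose that 1^k + ... + (m-1)^k = a m^k. Comparison with a telescoping sum gives (k+1) a < m, and
  pairing j with m-1-j excludes odd k. For even k, von Staudt's congruence evaluates power sums of
  exponent k modulo n in terms of the primes q dividing n with q - 1 dividing k. Following Moser, it is
  applied to n = m-1, m+1, 2m-1 and 2m+1 (\<open>four_sums\<close>). In each case the sum of 1/q plus a small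
  positive term is a positive integer. Only 2 and 3 can divide two of the moduli. Hence the set U
  of all these primes satisfies

    sum of 1/q over U \<ge> 4 - 1/2 - 1/3 - 6/(k+1),

  while q - 1 divides k for every q in U and the product of U divides (m^2-1)(4m^2-1) < 4 m^4.

  Primes are too sparse for this unless m and k are large. To measure this, let
  F(x) be the sum of 1/p - (ln p)/(x ln x) over the primes p \<le> x. Since the summands are nonnegative and
  would be negative beyond x, any finite set of primes satisfies
  sum 1/q \<le> F(x) + (sum ln q)/(x ln x). For x = exp(18.2) the bound F(x) \<le> 3.10967
  (\<open>prime_recip_sum_bound\<close>) forces the sum of ln q over U to exceed 36 * 10^6 * ln 10 + ln 4, so that
  m > 10^(9 * 10^6) (\<open>ln_m_gt\<close>). In the same way sum 1/q \<le> F(x) + x^(-1/2) sum q^(-1/2). As the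
  numbers q - 1 are distinct divisors of k, the last sum is at most the sum of d^(-1/2) over the divisors
  d of k, which Rankin's method bounds by 350 if k < 10^28. This contradicts the lower bound for
  U; hence k \<ge> 10^28 and m > (k+1) a > a * 10^28 (\<open>k_ge\<close>).

  The margin for F(x) is only about 2/10^4, but primes up to 8 * 10^7 cannot be listed. The estimate
  rests on a smoothed form of Chebyshev's method. Let T(t) be the sum of Lambda(n) (1/n - 1/t) over n \<le> t.
  Averaging ln (floor u)! against du/u^2 gives explicit means whose combinations bound T; the role of the
  floor function is taken by a continuous piecewise linear function, which differs from a smooth
  function by O(1/z) only. A combination of seven terms that majorises the desired function is found by
  linear programming, and yields T(t) \<le> ln t - 1 - gamma + 0.006 + o(1) up to a factor 1.00001
  (\<open>mangoldt_mean_le\<close>). Since 1/(u ln u) is a convex function of 1/u, it lies below its chords,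
  and summation by parts expresses F(x) through T at the knots of the chords with total weight below 0.2
  (\<open>weighted_psi_bound\<close>). So the error 0.006 contributes little more than 0.001. The part of the sum
  below exp(6) = 403.4... is computed from the primes themselves.
\<close>

section \<open>Weighted sums of logarithms\<close>

text \<open>
  The first two terms of the area hyperbolic tangent series at 1/(2N+1). The usual bounds 1/(N+1)
  and 1/N are too weak for the telescoping arguments below, which need errors of order 1/N^3.
\<close>

lemma ln_Suc_quotient_bounds:
  assumes "N \<ge> (1::nat)"
  shows "2 / (2 * real N + 1) \<le> ln (1 + 1 / real N)"
    and "ln (1 + 1 / real N) \<le> 2 / (2 * real N + 1) + 1 / (6 * real N * (real N + 1) * (2 * real N + 1))"
proof -
  define y :: real where "y = 1 / (2 * real N + 1)"
  have N: "real N > 0" using assms by simp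
  have y: "(1 + 1 / real N - 1) / (1 + 1 / real N + 1) = y"
    using N by (simp add: y_def field_simps)
  have b: "ln (1 + 1 / real N) \<in> {2 * y .. 2 * y + 2 * (y ^ 3 / (1 - y\<^sup>2) / 3)}"
    using ln_approx_bounds[of "1 + 1 / real N" 1] N unfolding y by (simp add: numeral_3_eq_3)
  define M where "M = 2 * real N + 1"
  have M: "M > 0" "y = 1 / M" by (simp_all add: M_def y_def)
  have "1 - y\<^sup>2 = (M\<^sup>2 - 1) / M\<^sup>2"
    using M by (simp add: power_divide diff_divide_distrib)
  also have "M\<^sup>2 - 1 = 4 * real N * (real N + 1)"
    by (simp add: M_def power2_eq_square algebra_simps)
  finally have "2 * (y ^ 3 / (1 - y\<^sup>2) / 3) = 2 * ((1 / M) ^ 3 / (4 * real N * (real N + 1) / M\<^sup>2) / 3)"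
    using M(2) by simp
  also have "\<dots> = 1 / (6 * real N * (real N + 1) * M)"
    using M(1) N by (simp add: power_divide power2_eq_square power3_eq_cube)
  finally have "2 * (y ^ 3 / (1 - y\<^sup>2) / 3) = 1 / (6 * real N * (real N + 1) * (2 * real N + 1))"
    by (simp add: M_def)
  moreover have "2 * y = 2 / (2 * real N + 1)" by (simp add: y_def)
  ultimately show "2 / (2 * real N + 1) \<le> ln (1 + 1 / real N)"
    and "ln (1 + 1 / real N) \<le> 2 / (2 * real N + 1) + 1 / (6 * real N * (real N + 1) * (2 * real N + 1))"
    using b by auto
qed

lemma ln_Suc_eq:
  assumes "N \<ge> (1::nat)"
  shows "ln (real (Suc N)) = ln (real N) + ln (1 + 1 / real N)"
proof -
  have "real (Suc N) = real N * (1 + 1 / real N)" using assms by (simp add: field_simps)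
  also have "ln \<dots> = ln (real N) + ln (1 + 1 / real N)"
  proof (subst ln_mult_pos)
    show "1 + 1 / real N > 0" by (intro add_pos_nonneg) auto
  qed (use assms in auto)
  finally show ?thesis .
qed

text \<open>
  The remainder in Stirling's formula. It tends to (ln (2 pi))/2 = 0.9189....
\<close>

definition stirling_defect :: "nat \<Rightarrow> real" where
  "stirling_defect N = ln (fact N) - (real N + 1 / 2) * ln N + N"

lemma stirling_defect_Suc:
  assumes "N \<ge> 1"
  shows "stirling_defect (Suc N) = stirling_defect N + 1 - (real N + 1 / 2) * ln (1 + 1 / real N)"
proof -
  have "ln (fact (Suc N) :: real) = ln (real (Suc N)) + ln (fact N)"
    by (subst fact_Suc) (simp add: ln_mult)
  thus ?thesis
    unfolding stirling_defect_def ln_Suc_eq[OF assms] by (simp add: algebra_simps)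
qed

text \<open>
  The defect decreases from 1, while the defect minus 1/(12 N) increases from 11/12.
\<close>

lemma stirling_defect_bounds:
  assumes "N \<ge> 1"
  shows "stirling_defect N \<le> 1" "stirling_defect N \<ge> 9 / 10"
proof -
  have "stirling_defect N \<le> 1 \<and> stirling_defect N \<ge> 11 / 12 + 1 / (12 * real N)"
    using assms
  proof (induction N rule: nat_induct_at_least)
    case base
    show ?case by (simp add: stirling_defect_def)
  next
    case (Suc N)
    have N: "real N > 0" using Suc by simp
    have 1: "1 \<le> (real N + 1 / 2) * ln (1 + 1 / real N)"
      using mult_left_mono[OF ln_Suc_quotient_bounds(1)[OF Suc(1)], of "real N + 1 / 2"] N
      by (simp add: field_simps)
    have "(real N + 1 / 2) * ln (1 + 1 / real N) \<le>
          (real N + 1 / 2) * (2 / (2 * real N + 1) + 1 / (6 * real N * (real N + 1) * (2 * real N + 1)))"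
      using mult_left_mono[OF ln_Suc_quotient_bounds(2)[OF Suc(1)], of "real N + 1 / 2"] by simp
    also have "\<dots> = 1 + (1 / (12 * real N) - 1 / (12 * real (Suc N)))"
      using N by (simp add: divide_simps) (simp add: algebra_simps)
    finally have 2: "(real N + 1 / 2) * ln (1 + 1 / real N) \<le> 1 + (1 / (12 * real N) - 1 / (12 * real (Suc N)))" .
    show ?case using Suc.IH 1 2 unfolding stirling_defect_Suc[OF Suc(1)] by simp
  qed
  moreover have "1 / (12 * real N) \<ge> 0" by simp
  ultimately show "stirling_defect N \<le> 1" "stirling_defect N \<ge> 9 / 10" by linarith+
qed

lemma ln_le_tenth:
  assumes "N \<ge> (40::real)" shows "ln N \<le> N / 10"
proof -
  have "ln N = ln 40 + ln (N / 40)" using assms by (simp add: ln_div)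
  also have "ln (N / 40) \<le> N / 40 - 1" using assms by (intro ln_le_minus_one) auto
  also have "ln (40::real) = ln 5 + 3 * ln 2"
    using ln_mult[of 5 "2^3"] ln_realpow[of 2 3] by simp
  also have "ln (5::real) \<le> 5/3" 
    using ln_le_minus_one[of "5 / 4"] ln_div[of 5 4] ln_realpow[of 2 2] ln2_le_25_over_36 by simp
  finally show ?thesis using assms ln2_le_25_over_36 by simp
qed

definition log_harm :: "nat \<Rightarrow> real" where
  "log_harm N = (\<Sum>m=1..N. ln (real m) / real m)"

text \<open>
  This is the integral of ln (floor u)! / u^2 over u from 1 to z. The averaging against du/u^2
  removes the jumps of the factorial and is what makes the later error terms small.
\<close>

definition log_mean :: "real \<Rightarrow> real" where
  "log_mean z = (\<Sum>m=1..nat \<lfloor>z\<rfloor>. ln (real m) * (1 / real m - 1 / z))"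

lemma ln_fact_eq: "ln (fact N) = (\<Sum>m=1..N. ln (real m))"
  by (induction N) (simp_all add: ln_mult)

lemma log_mean_eq:
  "log_mean z = log_harm (nat \<lfloor>z\<rfloor>) - ln (fact (nat \<lfloor>z\<rfloor>)) / z"
  unfolding log_mean_def log_harm_def ln_fact_eq
  by (simp add: sum_subtractf[symmetric] sum_divide_distrib algebra_simps)

text \<open>
  The main term of the logarithmic mean is (ln z)^2/2 - ln z, up to a constant. The constant cancels
  in the combination that is formed later, and the error that remains is about -0.92/z.
\<close>

definition log_mean_defect :: "real \<Rightarrow> real" where
  "log_mean_defect z = log_mean z - (ln z)\<^sup>2 / 2 + ln z"

lemma log_mean_defect_nat:
  "log_mean_defect (real N) = log_harm N - ln (fact N) / N - (ln N)\<^sup>2 / 2 + ln N"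
  by (simp add: log_mean_defect_def log_mean_eq)

text \<open>
  By Stirling the increment is close to 0.92/(N(N+1)), and so the defect differs from a limit by a
  telescoping series.
\<close>

lemma log_mean_defect_Suc_bounds:
  assumes N: "N \<ge> (40::nat)"
  defines "D \<equiv> log_mean_defect (real (Suc N)) - log_mean_defect (real N)"
  shows "D * (real N * (real N + 1)) \<le> 1025 / 1000" and "D * (real N * (real N + 1)) \<ge> 89 / 100"
proof -
  define l d \<beta> where "l = ln (real N)" and "d = ln (1 + 1 / real N)" and "\<beta> = stirling_defect N"
  have N1: "N \<ge> 1" and Np: "real N \<ge> 40" using N by auto
  have l: "0 \<le> l" "l \<le> N / 10" unfolding l_def using ln_le_tenth[OF Np] Np by auto
  have \<beta>: "\<beta> \<le> 1" "\<beta> \<ge> 9 / 10" unfolding \<beta>_def using stirling_defect_bounds[OF N1] by auto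
  have d: "2 / (2 * real N + 1) \<le> d" "d \<le> 2 / (2 * real N + 1) + 1 / (6 * real N * (real N + 1) * (2 * real N + 1))"
    unfolding d_def using ln_Suc_quotient_bounds[OF N1] by auto
  have B: "ln (fact N) = (real N + 1 / 2) * l - N + \<beta>"
    by (simp add: \<beta>_def stirling_defect_def l_def)
  have B': "ln (fact (Suc N) :: real) = l + d + ln (fact N)"
    using ln_Suc_eq[OF N1] by (subst fact_Suc) (simp add: ln_mult l_def d_def)
  have H: "log_harm (Suc N) = log_harm N + (l + d) / Suc N"
    using ln_Suc_eq[OF N1] by (simp add: log_harm_def l_def d_def)
  have lS: "ln (real (Suc N)) = l + d" using ln_Suc_eq[OF N1] by (simp add: l_def d_def)
  have lN: "ln (real N) = l" by (simp add: l_def)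
  have "D = ((real N + 1 / 2) * l - N + \<beta>) / (real N * (real N + 1)) - d * (l - 1 + d / 2)"
    unfolding D_def log_mean_defect_nat H B' lS lN B using Np
    by (simp add: divide_simps) (simp add: algebra_simps power2_eq_square)
  hence D: "D * (real N * (real N + 1)) = l * (real N + 1 / 2 - real N * (real N + 1) * d) + \<beta> - N + real N * (real N + 1) * (d - d\<^sup>2 / 2)"
    using Np by (simp add: divide_simps) (simp add: algebra_simps power2_eq_square)
  define y :: real where "y = 1 / (2 * real N + 1)"
  have y: "0 < y" "y \<le> 1 / 81" unfolding y_def using Np by (auto simp: field_simps)
  have "d \<ge> 2 * y" using d(1) by (simp add: y_def)
  have NN: "real N * (real N + 1) * (2 * y) = real N + 1 / 2 - y / 2"
    unfolding y_def using Np by (simp add: field_simps)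
  have NN': "real N * (real N + 1) * (1 / (6 * real N * (real N + 1) * (2 * real N + 1))) = y / 6"
    unfolding y_def using Np by (simp add: divide_simps)
  have lo: "real N * (real N + 1) * d \<ge> real N + 1 / 2 - y / 2"
    using mult_left_mono[OF \<open>d \<ge> 2 * y\<close>, of "real N * (real N + 1)"] NN by simp
  have "d \<le> 2 * y + 1 / (6 * real N * (real N + 1) * (2 * real N + 1))" using d(2) by (simp add: y_def)
  hence "real N * (real N + 1) * d \<le>
      real N * (real N + 1) * (2 * y + 1 / (6 * real N * (real N + 1) * (2 * real N + 1)))"
    by (intro mult_left_mono) auto
  also have "\<dots> = real N + 1 / 2 - y / 2 + y / 6"
    unfolding distrib_left[of "real N * (real N + 1)" "2 * y"] NN NN' ..
  finally have hi: "real N * (real N + 1) * d \<le> real N + 1 / 2 - y / 3" by simp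
  have "real N * (real N + 1) = (1 / y\<^sup>2 - 1) / 4"
    by (simp add: y_def power2_eq_square algebra_simps)
  hence sq: "real N * (real N + 1) * (2 * y)\<^sup>2 / 2 = 1 / 2 - y\<^sup>2 / 2"
    using y by (simp add: field_simps power2_eq_square)
  have "(2 * y)\<^sup>2 \<le> d\<^sup>2" using \<open>d \<ge> 2 * y\<close> y by (intro power_mono) auto
  from mult_left_mono[OF this, of "real N * (real N + 1)"] sq
  have sqlo: "real N * (real N + 1) * d\<^sup>2 / 2 \<ge> 1 / 2 - y\<^sup>2 / 2" by simp
  have ly: "l * y \<le> 1 / 20"
  proof -
    have "l * y \<le> (real N / 10) * y" using l y by (intro mult_right_mono) auto
    also have "\<dots> \<le> 1 / 20" unfolding y_def using Np by (simp add: field_simps)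
    finally show ?thesis .
  qed
  have yy: "y\<^sup>2 \<le> y / 81" using y mult_left_mono[of y "1/81" y] by (simp add: power2_eq_square)
  have "l * (real N + 1 / 2 - real N * (real N + 1) * d) \<le> l * (y / 2)"
    using l lo by (intro mult_left_mono) auto
  hence "l * (real N + 1 / 2 - real N * (real N + 1) * d) \<le> 1 / 40" using ly by simp
  moreover have "real N * (real N + 1) * (d - d\<^sup>2 / 2) = real N * (real N + 1) * d - real N * (real N + 1) * d\<^sup>2 / 2"
    by (simp add: algebra_simps)
  hence "real N * (real N + 1) * (d - d\<^sup>2 / 2) \<le> N" using hi sqlo yy y by linarith
  ultimately show "D * (real N * (real N + 1)) \<le> 1025 / 1000" unfolding D using \<beta> by linarith
  have "l * (real N + 1 / 2 - real N * (real N + 1) * d) \<ge> 0" using l hi y by (intro mult_nonneg_nonneg) auto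
  moreover have "real N * (real N + 1) * (d - d\<^sup>2 / 2) \<ge> real N * (real N + 1) * (2 * y - (2 * y)\<^sup>2 / 2)"
  proof (intro mult_left_mono)
    have "(d - 2 * y) * (1 - (d + 2 * y) / 2) \<ge> 0"
    proof (intro mult_nonneg_nonneg)
      have "d \<le> 1 / real N" unfolding d_def using Np by (intro ln_add_one_self_le_self) auto
      also have "\<dots> \<le> 1 / 40" using Np by (simp add: field_simps)
      finally show "0 \<le> 1 - (d + 2 * y) / 2" using y by simp
    qed (use \<open>d \<ge> 2 * y\<close> in auto)
    moreover have "(d - 2 * y) * (1 - (d + 2 * y) / 2) = (d - d\<^sup>2 / 2) - (2 * y - (2 * y)\<^sup>2 / 2)"
      by (simp add: power2_eq_square field_simps)
    ultimately show "2 * y - (2 * y)\<^sup>2 / 2 \<le> d - d\<^sup>2 / 2" by linarith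
  qed auto
  moreover have "real N * (real N + 1) * (2 * y - (2 * y)\<^sup>2 / 2) = N - y / 2 + y\<^sup>2 / 2"
    using NN sq by (simp add: right_diff_distrib)
  moreover have "y\<^sup>2 \<ge> 0" by simp
  ultimately show "D * (real N * (real N + 1)) \<ge> 89 / 100" unfolding D using \<beta> y by linarith
qed

lemma log_mean_defect_limit:
  obtains \<kappa> where "\<And>N::nat. N \<ge> 40 \<Longrightarrow> log_mean_defect N \<le> \<kappa> - 89 / 100 / N"
    and "\<And>N::nat. N \<ge> 40 \<Longrightarrow> log_mean_defect N \<ge> \<kappa> - 1025 / 1000 / N"
proof -
  define lo hi where "lo = (\<lambda>N::nat. log_mean_defect N + 89 / 100 / N)"
    and "hi = (\<lambda>N::nat. log_mean_defect N + 1025 / 1000 / N)"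
  have step: "lo N \<le> lo (Suc N)" "hi (Suc N) \<le> hi N" if "N \<ge> 40" for N
  proof -
    have p: "real N * (real N + 1) > 0" using that by simp
    have eq: "c / N - c / Suc N = c / (real N * (real N + 1))" for c :: real
      using that by (simp add: field_simps)
    have "log_mean_defect (real (Suc N)) - log_mean_defect (real N) \<ge> 89 / 100 / (real N * (real N + 1))"
      using log_mean_defect_Suc_bounds(2)[OF that] p by (subst pos_divide_le_eq) (auto simp: algebra_simps)
    thus "lo N \<le> lo (Suc N)" unfolding lo_def using eq[of "89 / 100"] by linarith
    have "log_mean_defect (real (Suc N)) - log_mean_defect (real N) \<le> 1025 / 1000 / (real N * (real N + 1))"
      using log_mean_defect_Suc_bounds(1)[OF that] p by (subst pos_le_divide_eq) (auto simp: algebra_simps)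
    thus "hi (Suc N) \<le> hi N" unfolding hi_def using eq[of "1025 / 1000"] by linarith
  qed
  have mono: "lo M \<le> lo N \<and> hi N \<le> hi M" if "M \<ge> 40" "M \<le> N" for M N
    using that(2)
  proof (induction N rule: dec_induct)
    case (step n)
    thus ?case using \<open>\<And>N. N \<ge> 40 \<Longrightarrow> lo N \<le> lo (Suc N)\<close>[of n] \<open>\<And>N. N \<ge> 40 \<Longrightarrow> hi (Suc N) \<le> hi N\<close>[of n] that(1)
      by linarith
  qed auto
  have le: "lo N \<le> hi N" for N
    unfolding lo_def hi_def by (intro add_left_mono divide_right_mono) auto
  have cross: "lo N \<le> hi M" if "N \<ge> 40" "M \<ge> 40" for M N
    using mono[of N "max M N"] mono[of M "max M N"] le[of "max M N"] that by linarith
  \<comment> \<open>the increasing sequence lo stays below the decreasing sequence hi\<close>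
  define \<kappa> where "\<kappa> = Sup (lo ` {40..})"
  have "lo N \<le> \<kappa>" if "N \<ge> 40" for N
    unfolding \<kappa>_def using that cross[of _ 40] by (intro cSup_upper bdd_aboveI[of _ "hi 40"]) auto
  moreover have "\<kappa> \<le> hi N" if "N \<ge> 40" for N
    unfolding \<kappa>_def using that cross[of _ N] by (intro cSup_least) auto
  ultimately show ?thesis
    by (intro that[of \<kappa>]) (auto simp: lo_def hi_def algebra_simps)
qed

text \<open>
  Between N and N+1 the defect moves by at most (ln N)/(2 N z) + 1/(N z), because the tangent
  inequality for the logarithm controls the main term. This extends the estimate from integers to
  real arguments at the price of slightly worse constants.
\<close>

lemma log_mean_defect_bounds:
  obtains \<kappa> where "\<And>z. z \<ge> 40 \<Longrightarrow> log_mean_defect z \<le> \<kappa> - 81 / 100 / z"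
    and "\<And>z. z \<ge> 40 \<Longrightarrow> log_mean_defect z \<ge> \<kappa> - 111 / 100 / z"
proof -
  obtain \<kappa> where \<kappa>: "\<And>N::nat. N \<ge> 40 \<Longrightarrow> log_mean_defect N \<le> \<kappa> - 89 / 100 / N"
     "\<And>N::nat. N \<ge> 40 \<Longrightarrow> log_mean_defect N \<ge> \<kappa> - 1025 / 1000 / N"
    using log_mean_defect_limit by blast
  have "log_mean_defect z \<le> \<kappa> - 81 / 100 / z \<and> log_mean_defect z \<ge> \<kappa> - 111 / 100 / z" if z: "z \<ge> 40" for z
  proof -
    define N where "N = nat \<lfloor>z\<rfloor>"
    have N: "real N \<le> z" "z < real N + 1" "N \<ge> 40" using z unfolding N_def by linarith+
    have Np: "real N \<ge> 40" using N by simp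
    define l L f B where "l = ln (real N)" and "L = ln z" and "f = z - N" and "B = ln (fact N :: real)"
    have f: "0 \<le> f" "f \<le> 1" using N by (auto simp: f_def)
    have l: "0 \<le> l" "l \<le> N / 10" unfolding l_def using ln_le_tenth[OF Np] Np by auto
    have \<beta>: "B \<le> (real N + 1 / 2) * l - N + 1" "B \<ge> (real N + 1 / 2) * l - N + 9 / 10"
      using stirling_defect_bounds[of N] N by (auto simp: stirling_defect_def l_def B_def)
    have L1: "L \<le> l + f / N"
      using ln_le_minus_one[of "z / N"] z Np by (simp add: ln_div L_def l_def f_def diff_divide_distrib)
    have L2: "L \<ge> l + f / z"
      using ln_le_minus_one[of "N / z"] z Np by (simp add: ln_div L_def l_def f_def diff_divide_distrib)
    have diff: "log_mean_defect z - log_mean_defect N = B * (f / (real N * z)) - (L - l) * ((L + l) / 2 - 1)"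
      unfolding log_mean_defect_nat unfolding log_mean_defect_def log_mean_eq
      using N z Np by (simp add: N_def[symmetric] L_def[symmetric] l_def[symmetric] B_def[symmetric] f_def
          power2_eq_square field_simps)
    have Ll: "f / z \<le> L - l" "L - l \<le> f / N" using L1 L2 by auto
    have "0 \<le> f / z" using f z by simp
    hence Ll0: "0 \<le> L - l" using Ll(1) by (rule order_trans)
    have l1: "l \<ge> 1" unfolding l_def using Np exp_le by (subst ln_ge_iff) auto
    have fz: "f / (real N * z) \<ge> 0" "f / (real N * z) \<le> 1 / (real N * z)"
      using f Np z by (auto intro!: divide_right_mono)
    have lN: "l / N \<le> 1 / 10" using l Np by (simp add: field_simps)
    have "(L - l) * ((L + l) / 2 - 1) \<ge> (f / z) * (l - 1)"
    proof (intro mult_mono)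
      show "l - 1 \<le> (L + l) / 2 - 1" using Ll0 by simp
    qed (use Ll Ll0 l1 f z in auto)
    hence "log_mean_defect z - log_mean_defect N \<le> B * (f / (real N * z)) - (f / z) * (l - 1)"
      using diff by linarith
    also have "\<dots> = f / (real N * z) * (B - real N * (l - 1))" using Np z by (simp add: field_simps)
    also have "\<dots> \<le> f / (real N * z) * (l / 2 + 1)"
      using \<beta> fz by (intro mult_left_mono) (auto simp: algebra_simps)
    also have "\<dots> \<le> 1 / (real N * z) * (l / 2 + 1)"
      using fz l by (intro mult_right_mono) auto
    also have "\<dots> = (1 / 2 * (l / N) + 1 / N) / z" using Np z by (simp add: field_simps)
    also have "\<dots> \<le> (75 / 1000) / z"
    proof (intro divide_right_mono)
      have "1 / real N \<le> 1 / 40" using Np by (simp add: field_simps)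
      thus "1 / 2 * (l / N) + 1 / N \<le> 75 / 1000" using lN by linarith
    qed (use z in auto)
    finally have up: "log_mean_defect z - log_mean_defect N \<le> (75 / 1000) / z" .
    have "(L + l) / 2 - 1 \<le> l + f / (2 * real N) - 1"
      using Ll by (simp add: diff_le_eq)
    moreover have "0 \<le> f / z" "0 \<le> f / N" using f z Np by auto
    ultimately have "(L - l) * ((L + l) / 2 - 1) \<le> (f / N) * (l + f / (2 * real N) - 1)"
      using Ll Ll0 l1 by (intro mult_mono) auto
    hence "log_mean_defect z - log_mean_defect N \<ge> B * (f / (real N * z)) - (f / N) * (l + f / (2 * real N) - 1)"
      using diff by linarith
    moreover have "B * (f / (real N * z)) - (f / N) * (l + f / (2 * real N) - 1) =
        f / (real N * z) * (B - z * (l + f / (2 * real N) - 1))" using Np z by (simp add: field_simps)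
    moreover have "f / (real N * z) * (B - z * (l + f / (2 * real N) - 1)) \<ge> f / (real N * z) * (- l / 2)"
    proof (intro mult_left_mono)
      have "z * (l + f / (2 * real N) - 1) = real N * (l - 1) + f * (l - 1) + z / N * f / 2"
        using Np by (simp add: f_def field_simps)
      moreover have "f * (l - 1) \<le> 1 * (l - 1)" using f l1 by (intro mult_right_mono) auto
      moreover have "z \<le> 41 / 40 * real N" using N(2) Np by linarith
      hence "z / N * f \<le> (41 / 40) * 1"
        using f Np by (intro mult_mono) (auto simp: pos_divide_le_eq)
      moreover have "(real N + 1 / 2) * l - real N + 9 / 10 = real N * (l - 1) + l / 2 + 9 / 10"
        by (simp add: algebra_simps)
      moreover have "- l / 2 \<le> B - X" if "X = M + Y + W / 2" "Y \<le> 1 * (l - 1)" "W \<le> 41 / 40 * 1"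
          "S = M + l / 2 + 9 / 10" "S \<le> B" for X M Y W S :: real
        using that by simp
      ultimately show "- l / 2 \<le> B - z * (l + f / (2 * real N) - 1)" using \<beta>(2) by blast
    qed (use fz in auto)
    moreover have "f / (real N * z) * (l / 2) \<le> 1 / (real N * z) * (l / 2)"
      using fz l by (intro mult_right_mono) auto
    moreover have "1 / (real N * z) * (l / 2) = (1 / 2 * (l / N)) / z" by simp
    moreover have "1 / 2 * (l / N) \<le> 1 / 20" using lN by linarith
    hence "(1 / 2 * (l / N)) / z \<le> (1 / 20) / z"
      using z by (intro divide_right_mono) auto
    ultimately have dn: "log_mean_defect z - log_mean_defect N \<ge> - ((1 / 20) / z)" by simp
    have "1 / N \<ge> 1 / z" using N z Np by (simp add: field_simps)
    moreover have "z \<le> 41 / 40 * real N" using N(2) Np by linarith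
    hence "1 / N \<le> (41 / 40) / z" using z Np by (simp add: field_simps)
    moreover have "c / x = c * (1 / x)" for c x :: real by simp
    note this[of "89 / 100" N] this[of "1025 / 1000" N] this[of "81 / 100" z] this[of "111 / 100" z]
      this[of "75 / 1000" z] this[of "1 / 20" z] this[of "41 / 40" z]
    moreover have "1 / z \<ge> 0" using z by simp
    ultimately show ?thesis using \<kappa>[OF Np] up dn by linarith
  qed
  thus ?thesis using that by blast
qed

section \<open>From logarithms to the von Mangoldt function\<close>

text \<open>
  The integral of psi(u)/u^2 over u from 1 to t. It is a smoothed form of the sum of Lambda(n)/n,
  and by partial summation it controls all weights on primes that are convex functions of 1/n.
\<close>

definition mangoldt_mean :: "real \<Rightarrow> real" where
  "mangoldt_mean t = (\<Sum>n=1..nat \<lfloor>t\<rfloor>. mangoldt n * (1 / real n - 1 / t))"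

text \<open>
  The sum of z/j - 1 over j up to z: the function that takes the place of the floor function in
  Chebyshev's method when factorials are averaged against du/u^2.
\<close>

definition harm_excess :: "real \<Rightarrow> real" where
  "harm_excess z = z * harm (nat \<lfloor>z\<rfloor>) - real (nat \<lfloor>z\<rfloor>)"

lemma harm_excess_eq_sum:
  "harm_excess z = (\<Sum>j=1..nat \<lfloor>z\<rfloor>. z / real j - 1)"
  unfolding harm_excess_def harm_def
  by (simp add: sum_subtractf sum_distrib_left divide_inverse)

lemma harm_excess_eq_0: "z < 1 \<Longrightarrow> harm_excess z = 0"
proof -
  assume "z < 1"
  hence "nat \<lfloor>z\<rfloor> = 0" by linarith
  thus ?thesis by (simp add: harm_excess_def harm_def)
qed

lemma nat_floor_div:
  assumes "z \<ge> 0"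
  shows "nat \<lfloor>z / real n\<rfloor> = nat \<lfloor>z\<rfloor> div n"
proof -
  have "\<lfloor>z / real n\<rfloor> = \<lfloor>z\<rfloor> div int n"
    using floor_divide_real_eq_div[of "int n" z] by simp
  thus ?thesis using assms by (simp add: nat_div_distrib)
qed

text \<open>
  Expand ln m as the sum of Lambda(d) over the divisors d of m and exchange the sums.
\<close>

lemma sum_mangoldt_harm_excess:
  assumes z: "z > 0"
  shows "(\<Sum>n=1..nat \<lfloor>z\<rfloor>. mangoldt n * harm_excess (z / real n)) = z * log_mean z"
proof -
  define N where "N = nat \<lfloor>z\<rfloor>"
  have "(\<Sum>n=1..N. mangoldt n * harm_excess (z / real n)) =
        (\<Sum>n=1..N. \<Sum>j=1..N div n. mangoldt n * (z / real (n * j) - 1))"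
    unfolding harm_excess_eq_sum sum_distrib_left using z
    by (intro sum.cong) (auto simp: nat_floor_div N_def)
  also have "\<dots> = (\<Sum>(n,j)\<in>(SIGMA n:{1..N}. {1..N div n}). mangoldt n * (z / real (n * j) - 1))"
    by (rule sum.Sigma) auto
  also have "\<dots> = (\<Sum>(m,d)\<in>(SIGMA m:{1..N}. {d. d dvd m}). mangoldt d * (z / real m - 1))"
  proof (rule sum.reindex_bij_witness[of _ "\<lambda>(m,d). (d, m div d)" "\<lambda>(n,j). (n * j, n)"])
    fix a assume "a \<in> (SIGMA n:{1..N}. {1..N div n})"
    then obtain n j where a: "a = (n, j)" "n \<ge> 1" "n \<le> N" "j \<ge> 1" "j \<le> N div n" by auto
    have "n * j \<le> n * (N div n)" using a by simp
    also have "\<dots> \<le> N" by simp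
    finally show "(case a of (n, j) \<Rightarrow> (n * j, n)) \<in> (SIGMA m:{1..N}. {d. d dvd m})"
      using a by simp
    show "(case case a of (n, j) \<Rightarrow> (n * j, n) of (m, d) \<Rightarrow> (d, m div d)) = a" using a by simp
    show "(case case a of (n, j) \<Rightarrow> (n * j, n) of (m, d) \<Rightarrow> mangoldt d * (z / real m - 1)) =
         (case a of (n, j) \<Rightarrow> mangoldt n * (z / real (n * j) - 1))" using a by simp
  next
    fix b assume "b \<in> (SIGMA m:{1..N}. {d. d dvd m})"
    then obtain m d where b: "b = (m, d)" "m \<ge> 1" "m \<le> N" "d dvd m" by auto
    then obtain e where e: "m = d * e" by (elim dvdE)
    have "d \<ge> 1" "e \<ge> 1" using b e by (auto simp: Suc_le_eq)
    have "e = d * e div d" using \<open>d \<ge> 1\<close> by simp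
    also have "\<dots> \<le> N div d" using b e by (intro div_le_mono) auto
    finally have "e \<le> N div d" .
    moreover have "d \<le> N" using b dvd_imp_le[of d m] by simp
    ultimately show "(case b of (m, d) \<Rightarrow> (d, m div d)) \<in> (SIGMA n:{1..N}. {1..N div n})"
      using b e \<open>d \<ge> 1\<close> \<open>e \<ge> 1\<close> by simp
    show "(case case b of (m, d) \<Rightarrow> (d, m div d) of (n, j) \<Rightarrow> (n * j, n)) = b" using b by simp
  qed
  also have "\<dots> = (\<Sum>m=1..N. \<Sum>d | d dvd m. mangoldt d * (z / real m - 1))"
    by (rule sum.Sigma [symmetric]) auto
  also have "\<dots> = (\<Sum>m=1..N. ln (real m) * (z / real m - 1))"
  proof (intro sum.cong refl)
    fix m assume "m \<in> {1..N}"
    thus "(\<Sum>d | d dvd m. mangoldt d * (z / real m - 1)) = ln (real m) * (z / real m - 1)"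
      using mangoldt_sum[of m, where ?'a = real] by (simp add: sum_distrib_right[symmetric])
  qed
  also have "\<dots> = z * log_mean z"
    unfolding log_mean_def N_def[symmetric] sum_distrib_left
    using z by (intro sum.cong refl) (simp add: field_simps)
  finally show ?thesis by (simp add: N_def)
qed

text \<open>
  Chebyshev's method for the averaged functions: a combination of harm_excess at y/d that majorises
  y - 1 turns the known logarithmic means into an upper bound for the mean of Lambda. The
  majorisation carries over to the sums because Lambda is nonnegative.
\<close>

lemma mangoldt_mean_le_sum:
  assumes "finite D" "\<And>d. d \<in> D \<Longrightarrow> d \<ge> (1::nat)" and t: "t > 0"
    and maj: "\<And>y. y \<ge> 1 \<Longrightarrow> y - 1 \<le> (\<Sum>d\<in>D. c d * harm_excess (y / real d))"
  shows "mangoldt_mean t \<le> (\<Sum>d\<in>D. c d / real d * log_mean (t / real d))"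
proof -
  define N where "N = nat \<lfloor>t\<rfloor>"
  have "mangoldt_mean t = (\<Sum>n=1..N. mangoldt n * ((t / real n - 1) / t))"
    unfolding mangoldt_mean_def N_def[symmetric]
    using t by (intro sum.cong refl) (simp add: field_simps)
  also have "\<dots> \<le> (\<Sum>n=1..N. mangoldt n * ((\<Sum>d\<in>D. c d * harm_excess (t / real n / real d)) / t))"
  proof (intro sum_mono mult_left_mono divide_right_mono maj mangoldt_nonneg)
    fix n assume "n \<in> {1..N}"
    hence "real n \<le> t" "n \<ge> 1" using t unfolding N_def by (auto simp: le_nat_iff le_floor_iff)
    thus "1 \<le> t / real n" by (simp add: field_simps)
  qed (use t in auto)
  also have "\<dots> = (\<Sum>d\<in>D. c d / t * (\<Sum>n=1..N. mangoldt n * harm_excess (t / real d / real n)))"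
    by (simp add: sum_distrib_left sum_divide_distrib sum.swap[of _ D] mult_ac divide_divide_eq_left)
  also have "\<dots> = (\<Sum>d\<in>D. c d / t * (t / real d * log_mean (t / real d)))"
  proof (intro sum.cong refl arg_cong2[where f = "(*)"])
    fix d assume d: "d \<in> D"
    have d1: "d \<ge> 1" using assms d by auto
    have "(\<Sum>n=1..N. mangoldt n * harm_excess (t / real d / real n)) =
          (\<Sum>n=1..nat \<lfloor>t / real d\<rfloor>. mangoldt n * harm_excess (t / real d / real n))"
    proof (rule sum.mono_neutral_right)
      have "t / real d \<le> t" using d1 t by (simp add: field_simps)
      hence "nat \<lfloor>t / real d\<rfloor> \<le> N" unfolding N_def by (intro nat_mono floor_mono)
      thus "{1..nat \<lfloor>t / real d\<rfloor>} \<subseteq> {1..N}" by auto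
      show "\<forall>i\<in>{1..N} - {1..nat \<lfloor>t / real d\<rfloor>}. mangoldt i * harm_excess (t / real d / real i) = 0"
      proof
        fix i assume i: "i \<in> {1..N} - {1..nat \<lfloor>t / real d\<rfloor>}"
        hence "real i > t / real d" by (auto simp: not_le) linarith
        hence "t / real d / real i < 1" using i by (subst pos_divide_less_eq) auto
        thus "mangoldt i * harm_excess (t / real d / real i) = 0" by (simp add: harm_excess_eq_0)
      qed
    qed auto
    also have "\<dots> = t / real d * log_mean (t / real d)"
      using d1 t by (intro sum_mangoldt_harm_excess) auto
    finally show "(\<Sum>n=1..N. mangoldt n * harm_excess (t / real d / real n)) = t / real d * log_mean (t / real d)" .
  qed
  also have "\<dots> = (\<Sum>d\<in>D. c d / real d * log_mean (t / real d))"
    using t by (intro sum.cong refl) simp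
  finally show ?thesis .
qed

lemma harm_defect_bounds:
  assumes "M \<ge> (2::nat)"
  shows "harm M - ln (real M) - euler_mascheroni \<le> 1 / (2 * real M)"
    and "harm M - ln (real M) - euler_mascheroni \<ge> 1 / real M - 1 / (2 * (real M - 1))"
proof -
  obtain n where n: "M = Suc (Suc n)" using assms by (metis Suc_le_D numeral_2_eq_2 Suc_le_mono)
  have h: "harm M = harm (Suc n) + 1 / real M"
    unfolding n by (subst harm_Suc) (simp add: divide_inverse)
  have "(euler_mascheroni :: real) \<ge> harm (Suc n) - ln (real M) + 1 / (2 * real M)"
    using euler_mascheroni_lower[of n] by (simp add: n)
  thus "harm M - ln (real M) - euler_mascheroni \<le> 1 / (2 * real M)"
    using h by (simp add: field_simps)
  have "(euler_mascheroni :: real) \<le> harm (Suc n) - ln (real M) + 1 / (2 * (real M - 1))"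
    using euler_mascheroni_upper[of n] by (simp add: n)
  thus "harm M - ln (real M) - euler_mascheroni \<ge> 1 / real M - 1 / (2 * (real M - 1))"
    using h by linarith
qed

text \<open>
  The smooth part of harm_excess. In contrast to the floor function, whose deviation from a linear
  function does not decay, harm_excess differs from its smooth part only by O(1/z).
\<close>

definition harm_excess_main :: "real \<Rightarrow> real" where
  "harm_excess_main z = z * ln z + (euler_mascheroni - 1) * z + 1 / 2"

lemma ln_one_plus_ge: "x \<ge> (0::real) \<Longrightarrow> ln (1 + x) \<ge> 2 * x / (2 + x)"
proof (cases "x = 0")
  case False
  assume "x \<ge> 0"
  with False have "1 + x > 1" by simp
  from ln_approx_bounds[OF this, of 1] show ?thesis by simp
qed simp

text \<open>
  With N the integer part of z, the difference splits into the Euler-Mascheroni error of the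
  harmonic number and the effect of the fractional part.
\<close>

lemma harm_excess_diff:
  fixes z :: real
  defines "N \<equiv> nat \<lfloor>z\<rfloor>"
  assumes z: "z \<ge> 2"
  shows "harm_excess z - harm_excess_main z =
           z * (harm N - ln (real N) - euler_mascheroni) - z * ln (1 + (z - N) / N) + (z - N) - 1 / 2"
proof -
  have N: "real N > 0" using z unfolding N_def by linarith
  have "1 + (z - N) / N = z / N" using N by (simp add: field_simps)
  thus ?thesis using z N
    by (simp add: harm_excess_def harm_excess_main_def N_def[symmetric] ln_div algebra_simps)
qed

text \<open>
  The fractional part f contributes f/2 - f^2/3 at most, divided by N, and this quadratic has its
  maximum 3/16 at f = 3/4.
\<close>

lemma harm_excess_upper:
  assumes z: "z \<ge> 2"
  shows "harm_excess z \<le> harm_excess_main z + 3 / (16 * (z - 1))"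
proof -
  define N f where "N = nat \<lfloor>z\<rfloor>" and "f = z - real N"
  have N: "real N \<le> z" "z < real N + 1" "N \<ge> 2" "real N \<ge> 2"
    using z le_floor_iff[of 2 z] unfolding N_def by linarith+
  have f: "0 \<le> f" "f \<le> 1" and zf: "z = real N + f" using N by (auto simp: f_def)
  define x where "x = f / N"
  have x: "0 \<le> x" "x \<le> 1" using f N by (auto simp: x_def field_simps)
  have fx: "f = N * x" using N by (simp add: x_def)
  have "x + x\<^sup>2 / 3 \<le> x + x\<^sup>2 / (2 + x)"
    using x by (intro add_left_mono divide_left_mono) auto
  also have "\<dots> = (1 + x) * (2 * x / (2 + x))"
    using x by (simp add: field_simps power2_eq_square)
  also have "\<dots> \<le> (1 + x) * ln (1 + x)" using x by (intro mult_left_mono ln_one_plus_ge) auto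
  finally have "real N * (x + x\<^sup>2 / 3) \<le> real N * ((1 + x) * ln (1 + x))"
    by (intro mult_left_mono) auto
  hence A: "z * ln (1 + x) \<ge> f + f * x / 3"
    by (simp add: zf fx algebra_simps power2_eq_square)
  have "z * (harm N - ln (real N) - euler_mascheroni) \<le> z * (1 / (2 * real N))"
    using harm_defect_bounds(1)[OF N(3)] z by (intro mult_left_mono) auto
  also have "\<dots> = 1 / 2 + x / 2" using N by (simp add: zf x_def field_simps)
  finally have B: "z * (harm N - ln (real N) - euler_mascheroni) \<le> 1 / 2 + x / 2" .
  have "x / 2 - f * x / 3 = (f / 2 - f\<^sup>2 / 3) / N" 
    using N by (simp add: x_def field_simps power2_eq_square)
  also have "\<dots> \<le> (3 / 16) / N"
  proof (intro divide_right_mono)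
    have "0 \<le> (f - 3 / 4)\<^sup>2" by simp
    thus "f / 2 - f\<^sup>2 / 3 \<le> 3 / 16" by (simp add: power2_eq_square algebra_simps)
  qed auto
  also have "\<dots> \<le> (3 / 16) / (z - 1)" using N z by (intro divide_left_mono) auto
  finally have "x / 2 - f * x / 3 \<le> 3 / (16 * (z - 1))" by simp
  thus ?thesis using A B harm_excess_diff[OF z] unfolding N_def[symmetric] f_def[symmetric] x_def[symmetric]
    by linarith
qed

lemma harm_excess_lower:
  assumes z: "z \<ge> 3"
  shows "harm_excess z \<ge> harm_excess_main z - 3 / (2 * (z - 2))"
proof -
  define N f where "N = nat \<lfloor>z\<rfloor>" and "f = z - real N"
  have N: "real N \<le> z" "z < real N + 1" "N \<ge> 2" "real N \<ge> 3"
    using z le_floor_iff[of 3 z] unfolding N_def by linarith+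
  have f: "0 \<le> f" "f \<le> 1" and zf: "z = real N + f" using N by (auto simp: f_def)
  define x where "x = f / N"
  have x: "0 \<le> x" using f N by (auto simp: x_def field_simps)
  have "z * ln (1 + x) \<le> z * x" using x z by (intro mult_left_mono ln_add_one_self_le_self) auto
  also have "z * x = f + f * f / N" using N by (simp add: zf x_def field_simps)
  also have "f * f / N \<le> 1 / N" using f N mult_mono[of f 1 f 1] by (intro divide_right_mono) auto
  finally have A: "z * ln (1 + x) \<le> f + 1 / N" by simp
  have nn: "1 / real N - 1 / (2 * (real N - 1)) \<ge> 0" using N by (simp add: field_simps)
  have "1 / 2 - 1 / (2 * (real N - 1)) = real N * (1 / real N - 1 / (2 * (real N - 1)))"
    using N by (simp add: field_simps)
  also have "\<dots> \<le> z * (1 / real N - 1 / (2 * (real N - 1)))"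
    using N nn by (intro mult_right_mono) auto
  also have "\<dots> \<le> z * (harm N - ln (real N) - euler_mascheroni)"
    using harm_defect_bounds(2)[OF N(3)] z by (intro mult_left_mono) auto
  finally have B: "z * (harm N - ln (real N) - euler_mascheroni) \<ge> 1 / 2 - 1 / (2 * (real N - 1))" .
  have 1: "1 / real N \<le> 1 / (z - 2)" and 2: "1 / (2 * (real N - 1)) \<le> 1 / (2 * (z - 2))"
    using N z by (auto intro!: divide_left_mono)
  have half: "3 / (2 * w) = 1 / w + 1 / (2 * w)" if "w > 0" for w :: real using that by (simp add: field_simps)
  have 3: "3 / (2 * (z - 2)) = 1 / (z - 2) + 1 / (2 * (z - 2))" by (rule half) (use z in simp)
  have comb: "h \<ge> m - r" if "p \<le> q" "u \<le> v" "r = q + v" "a \<le> f + p" "b \<ge> 1 / 2 - u" "h - m = b - a + f - 1 / 2"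
    for h m r p q u v a b :: real using that by linarith
  have "z \<ge> 2" using z by simp
  from comb[OF 1 2 3 A B harm_excess_diff[OF this, folded N_def, folded f_def, folded x_def]]
  show ?thesis .
qed

section \<open>A nonnegative Chebyshev combination\<close>

lemma ln_small_primes_bounds:
  "ln (2::real) \<ge> 6931471/10000000" "ln (2::real) \<le> 6931473/10000000"
  "ln (3::real) \<ge> 10986121/10000000" "ln (3::real) \<le> 10986125/10000000"
  "ln (5::real) \<ge> 16094377/10000000" "ln (5::real) \<le> 16094382/10000000"
  "ln (7::real) \<ge> 19459099/10000000" "ln (7::real) \<le> 19459106/10000000"
proof -
  have e: "(\<Sum>k<8. f k) = f 0 + f 1 + f 2 + f 3 + f 4 + f 5 + f 6 + f (7::nat)" for f :: "nat \<Rightarrow> real"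
    by (simp add: eval_nat_numeral)
  show l2: "ln (2::real) \<ge> 6931471/10000000" "ln (2::real) \<le> 6931473/10000000"
    using ln_approx_bounds[of 2 8] unfolding e by (simp_all add: eval_nat_numeral)
  have "ln (3::real) = ln 2 + ln (3/2)" by (simp add: ln_div)
  moreover have "ln (3/2::real) \<ge> 40546510/100000000 \<and> ln (3/2::real) \<le> 40546511/100000000"
    using ln_approx_bounds[of "3/2" 8] unfolding e by (simp add: eval_nat_numeral)
  ultimately show "ln (3::real) \<ge> 10986121/10000000" "ln (3::real) \<le> 10986125/10000000"
    using l2 by linarith+
  have "ln (5::real) = 2 * ln 2 + ln (5/4)" using ln_realpow[of 2 2] by (simp add: ln_div)
  moreover have "ln (5/4::real) \<ge> 22314355/100000000 \<and> ln (5/4::real) \<le> 22314356/100000000"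
    using ln_approx_bounds[of "5/4" 8] unfolding e by (simp add: eval_nat_numeral)
  ultimately show "ln (5::real) \<ge> 16094377/10000000" "ln (5::real) \<le> 16094382/10000000"
    using l2 by linarith+
  have "ln (7::real) = 3 * ln 2 - ln (8/7)" using ln_realpow[of 2 3] by (simp add: ln_div)
  moreover have "ln (8/7::real) \<ge> 13353139/100000000 \<and> ln (8/7::real) \<le> 13353140/100000000"
    using ln_approx_bounds[of "8/7" 8] unfolding e by (simp add: eval_nat_numeral)
  ultimately show "ln (7::real) \<ge> 19459099/10000000" "ln (7::real) \<le> 19459106/10000000"
    using l2 by linarith+
qed

text \<open>
  The support of the combination. The coefficients cheb d imitate the Moebius function: their sum
  weighted by 1/d vanishes, the sum weighted by -(ln d)/d is 1 plus about 6/10^6, and the plain sum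
  is -1.949, close to 1/zeta(0) = -2. They come from a linear program that minimises the constant of
  the resulting bound under the condition that the excess be nonnegative; the numerators are over
  the common denominator 1000.
\<close>

definition cheb_supp :: "nat set" where "cheb_supp = {1, 2, 3, 5, 6, 7, 10}"

definition cheb_num :: "nat \<Rightarrow> int" where
  "cheb_num d = (if d = 1 then 1000 else if d = 2 \<or> d = 3 then -1000 else if d = 5 then -532
     else if d = 6 then -121 else if d = 7 then -245 else if d = 10 then -51 else 0)"

definition cheb :: "nat \<Rightarrow> real" where "cheb d = real_of_int (cheb_num d) / 1000"

lemma sum_cheb:
  "(\<Sum>d\<in>cheb_supp. cheb d * f d) = f 1 - f 2 - f 3 - 532 / 1000 * f 5 - 121 / 1000 * f 6
     - 245 / 1000 * f 7 - 51 / 1000 * f 10"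
  by (simp add: cheb_supp_def cheb_def cheb_num_def)

text \<open>
  The quantity that has to be nonnegative for all y >= 1. It is linear between consecutive integers,
  and for large y it approaches 1 - 1.949/2, up to O(1/y) and a tiny nonnegative multiple of y.
\<close>

definition excess :: "real \<Rightarrow> real" where
  "excess y = (\<Sum>d\<in>cheb_supp. cheb d * harm_excess (y / real d)) - (y - 1)"

text \<open>
  The slope of the excess between n and n + 1; it changes at m by the jump of m divided by m.
\<close>

definition excess_slope :: "nat \<Rightarrow> real" where
  "excess_slope n = (\<Sum>d\<in>cheb_supp. cheb d * (harm (n div d) / real d)) - 1"

definition excess_jump :: "nat \<Rightarrow> int" where
  "excess_jump m = (\<Sum>d\<in>cheb_supp. if d dvd m then cheb_num d else 0)"

lemma cheb_supp_pos: "d \<in> cheb_supp \<Longrightarrow> d \<ge> 1" and finite_cheb_supp [simp]: "finite cheb_supp"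
  by (auto simp: cheb_supp_def)

text \<open>
  On an interval between consecutive integers every floor of y/d is constant.
\<close>

lemma excess_linear:
  assumes "y \<ge> 0"
  defines "n \<equiv> nat \<lfloor>y\<rfloor>"
  shows "excess y = excess (real n) + (y - real n) * excess_slope n"
proof -
  have "harm_excess (y / real d) = harm_excess (real n / real d) + (y - real n) * (harm (n div d) / real d)" for d
    unfolding harm_excess_def using nat_floor_div[of y d] nat_floor_div[of "real n" d] assms
    by (simp add: field_simps diff_divide_distrib)
  hence "(\<Sum>d\<in>cheb_supp. cheb d * harm_excess (y / real d)) =
         (\<Sum>d\<in>cheb_supp. cheb d * harm_excess (real n / real d)) +
         (y - real n) * (\<Sum>d\<in>cheb_supp. cheb d * (harm (n div d) / real d))"
    unfolding sum_distrib_left sum.distrib[symmetric]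
    by (intro sum.cong refl) (simp add: algebra_simps)
  thus ?thesis by (simp add: excess_def excess_slope_def algebra_simps)
qed

lemma excess_Suc: "excess (real (Suc n)) = excess (real n) + excess_slope n"
proof -
  have "harm_excess (real (Suc n) / real d) = harm_excess (real n / real d) + harm (n div d) / real d"
    if "d \<ge> 1" for d
  proof (cases "d dvd Suc n")
    case True
    define q where "q = n div d"
    have q: "Suc n div d = Suc q" using True by (simp add: div_Suc dvd_eq_mod_eq_0 q_def)
    from True have "real (Suc n div d) = real (Suc n) / real d" by (metis real_of_nat_div)
    hence eq: "real (Suc n) / real d = real (Suc q)" unfolding q by simp
    moreover have "real (Suc n) / real d = real n / real d + 1 / real d" by (simp add: add_divide_distrib)
    ultimately have eq': "real n / real d = real (Suc q) - 1 / real d" by linarith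
    have h: "harm (Suc q) = harm q + 1 / real (Suc q)" by (subst harm_Suc) (simp add: divide_inverse)
    have "harm_excess (real (Suc n) / real d) = real (Suc q) * harm q - real q"
      unfolding eq harm_excess_def floor_of_nat nat_int by (simp add: h distrib_left)
    moreover have "harm_excess (real n / real d) = (real (Suc q) - 1 / real d) * harm q - real q"
      using nat_floor_div[of "real n" d] unfolding harm_excess_def eq'[symmetric] by (simp add: q_def)
    ultimately show ?thesis unfolding q_def[symmetric] by (simp add: algebra_simps)
  next
    case False
    hence eq: "Suc n div d = n div d" by (simp add: div_Suc dvd_eq_mod_eq_0)
    show ?thesis
      unfolding harm_excess_def nat_floor_div[OF of_nat_0_le_iff] floor_of_nat nat_int eq using that
      by (simp add: field_simps)
  qed
  hence "(\<Sum>d\<in>cheb_supp. cheb d * harm_excess (real (Suc n) / real d)) =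
         (\<Sum>d\<in>cheb_supp. cheb d * harm_excess (real n / real d)) +
         (\<Sum>d\<in>cheb_supp. cheb d * (harm (n div d) / real d))"
    unfolding sum.distrib[symmetric]
    by (intro sum.cong refl) (use cheb_supp_pos in \<open>simp add: distrib_left\<close>)
  thus ?thesis by (simp add: excess_def excess_slope_def)
qed

lemma excess_slope_Suc: "excess_slope (Suc n) = excess_slope n + real_of_int (excess_jump (Suc n)) / (1000 * real (Suc n))"
proof -
  have "cheb d * (harm (Suc n div d) / real d) =
        cheb d * (harm (n div d) / real d) + real_of_int (if d dvd Suc n then cheb_num d else 0) / (1000 * real (Suc n))"
    if "d \<ge> 1" for d
  proof (cases "d dvd Suc n")
    case True
    hence eq: "Suc n div d = Suc (n div d)" by (simp add: div_Suc dvd_eq_mod_eq_0)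
    from True have "real (Suc n div d) = real (Suc n) / real d" by (metis real_of_nat_div)
    hence "real (Suc (n div d)) = real (Suc n) / real d" using eq by simp
    hence "harm (Suc n div d) = harm (n div d) + real d / real (Suc n)"
      unfolding eq by (subst harm_Suc) (simp add: divide_inverse)
    moreover have "x / 1000 * ((h + D / S) / D) = x / 1000 * (h / D) + x / (1000 * S)" if "D > 0" for x h D S :: real
      using that by (simp add: field_simps)
    ultimately show ?thesis using True that by (simp add: cheb_def)
  next
    case False
    hence "Suc n div d = n div d" by (simp add: div_Suc dvd_eq_mod_eq_0)
    thus ?thesis using False by simp
  qed
  hence "(\<Sum>d\<in>cheb_supp. cheb d * (harm (Suc n div d) / real d)) =
         (\<Sum>d\<in>cheb_supp. cheb d * (harm (n div d) / real d)) + 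
         (\<Sum>d\<in>cheb_supp. real_of_int (if d dvd Suc n then cheb_num d else 0) / (1000 * real (Suc n)))"
    unfolding sum.distrib[symmetric] using cheb_supp_pos by (intro sum.cong refl) blast
  also have "(\<Sum>d\<in>cheb_supp. real_of_int (if d dvd Suc n then cheb_num d else 0) / (1000 * real (Suc n))) =
      real_of_int (excess_jump (Suc n)) / (1000 * real (Suc n))"
    by (simp add: excess_jump_def sum_divide_distrib)
  finally show ?thesis by (simp add: excess_slope_def)
qed

definition excess_jump_int :: "int \<Rightarrow> int" where
  "excess_jump_int m = 1000 + (if m mod 2 = 0 then -1000 else 0) + (if m mod 3 = 0 then -1000 else 0)
     + (if m mod 5 = 0 then -532 else 0) + (if m mod 6 = 0 then -121 else 0)
     + (if m mod 7 = 0 then -245 else 0) + (if m mod 10 = 0 then -51 else 0)"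

lemma excess_jump_eq_int: "excess_jump m = excess_jump_int (int m)"
proof -
  have "int m mod int d = 0 \<longleftrightarrow> d dvd m" for d by presburger
  from this[of 2] this[of 3] this[of 5] this[of 6] this[of 7] this[of 10] show ?thesis
    by (simp add: excess_jump_int_def excess_jump_def cheb_supp_def cheb_num_def)
qed

text \<open>
  Starting from a lower bound k for the excess and a lower bound a for its slope at n, both scaled
  by 10^12, this follows f integers and rounds every jump downwards, so that only integer arithmetic
  is involved.
\<close>

primrec excess_check :: "nat \<Rightarrow> int \<Rightarrow> int \<Rightarrow> int \<Rightarrow> bool" where
  "excess_check 0 n a k = True"
| "excess_check (Suc f) n a k =
     (k \<ge> 0 \<and> excess_check f (n + 1) (a + excess_jump_int (n + 1) * 10 ^ 9 div (n + 1)) (k + a))"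

lemma excess_check_sound:
  assumes "excess_check f (int n) a k" "real_of_int a \<le> 10 ^ 12 * excess_slope n"
    "real_of_int k \<le> 10 ^ 12 * excess (real n)" "i < f"
  shows "excess (real (n + i)) \<ge> 0"
  using assms
proof (induction f arbitrary: n a k i)
  case (Suc f)
  show ?case
  proof (cases i)
    case 0
    have "0 \<le> real_of_int k" using Suc.prems by simp
    thus ?thesis using Suc.prems(3) 0 by simp
  next
    case (Suc j)
    define a' where "a' = a + excess_jump_int (int (Suc n)) * 10 ^ 9 div int (Suc n)"
    have "real_of_int (excess_jump_int (int (Suc n)) * 10 ^ 9 div int (Suc n)) \<le>
          real_of_int (excess_jump (Suc n) * 10 ^ 9) / real_of_int (int (Suc n))"
      unfolding excess_jump_eq_int by (simp only: real_of_int_div4)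
    also have "\<dots> = 10 ^ 12 * (real_of_int (excess_jump (Suc n)) / (1000 * real (Suc n)))"
    proof -
      have "x * 10 ^ 9 / m = 10 ^ 12 * (x / (1000 * m))" for x m :: real by simp
      from this[of "real_of_int (excess_jump (Suc n))" "real (Suc n)"] show ?thesis by simp
    qed
    finally have "real_of_int a' \<le> 10 ^ 12 * excess_slope (Suc n)"
      using Suc.prems(2) unfolding a'_def excess_slope_Suc distrib_left of_int_add by (rule add_mono[rotated])
    moreover have "real_of_int (k + a) \<le> 10 ^ 12 * excess (real (Suc n))"
      using add_mono[OF Suc.prems(3,2)] unfolding excess_Suc distrib_left of_int_add .
    moreover have "excess_check f (int (Suc n)) a' (k + a)"
      using Suc.prems(1) by (simp add: a'_def add.commute)
    ultimately have "excess (real (Suc n + j)) \<ge> 0"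
      using Suc.prems(4) \<open>i = Suc j\<close> by (intro Suc.IH) auto
    thus ?thesis using \<open>i = Suc j\<close> by simp
  qed
qed simp

lemma excess_nonneg_small:
  assumes "1 \<le> n" "n \<le> 150"
  shows "excess (real n) \<ge> 0"
proof -
  have "excess_check 150 1 0 0" by code_simp
  hence "excess_check 150 (int 1) 0 0" by simp
  moreover have "excess_slope 1 = 0"
    unfolding excess_slope_def sum_cheb by (simp add: harm_def)
  moreover have "excess 1 = 0"
    unfolding excess_def sum_cheb by (simp add: harm_excess_eq_0) (simp add: harm_excess_def harm_def)
  ultimately have "excess (real (1 + (n - 1))) \<ge> 0"
    using assms by (intro excess_check_sound[of 150 1 0 0]) auto
  thus ?thesis using assms by simp
qed

text \<open>
  In the sum of the smooth parts the terms y ln y and the Euler-Mascheroni constant cancel, because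
  the coefficients weighted by 1/d sum to 0. What remains is 0.0255 plus a nonnegative multiple of
  y; the errors of the individual terms add up to less than 0.024 from y = 150 on.
\<close>

lemma excess_nonneg_large:
  assumes y: "y \<ge> 150"
  shows "excess y \<ge> 0"
proof -
  define g where "g = (euler_mascheroni - 1 :: real)"
  have main: "harm_excess_main (y / d) = y * (ln y / d) - y * (ln d / d) + g * (y / d) + 1 / 2" if "d > 0" for d
    using y that by (simp add: harm_excess_main_def ln_div g_def algebra_simps diff_divide_distrib)
  have up: "harm_excess (y / d) \<le> y * (ln y / d) - y * (ln d / d) + g * (y / d) + 1 / 2 + 3 / (16 * (150 / d - 1))"
    if d: "d \<ge> 1" "d \<le> 10" for d :: real
  proof -
    have "150 / d \<ge> 15" using d by (simp add: field_simps)
    moreover have "150 / d \<le> y / d" using d y by (intro divide_right_mono) auto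
    ultimately have "3 / (16 * (y / d - 1)) \<le> 3 / (16 * (150 / d - 1))"
      by (intro divide_left_mono mult_pos_pos) auto
    thus ?thesis using harm_excess_upper[of "y / d"] main[of d] d \<open>150 / d \<le> y / d\<close> \<open>150 / d \<ge> 15\<close> by simp
  qed
  have lo: "harm_excess y \<ge> y * ln y + g * y + 1 / 2 - 3 / 296"
  proof -
    have "3 / (2 * (y - 2)) \<le> 3 / 296" using y by (intro divide_left_mono) auto
    thus ?thesis using harm_excess_lower[of y] main[of 1] y by simp
  qed
  have l6: "ln (6::real) = ln 2 + ln 3" and l10: "ln (10::real) = ln 2 + ln 5"
    using ln_mult[of 2 "3::real"] ln_mult[of 2 "5::real"] by simp_all
  define S where "S = ln 2 / 2 + ln 3 / 3 + 532 / 1000 * (ln 5 / 5) + 121 / 1000 * (ln 6 / 6)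
      + 245 / 1000 * (ln 7 / 7) + 51 / 1000 * (ln 10 / 10 :: real)"
  have "S \<ge> 1" unfolding S_def l6 l10 using ln_small_primes_bounds by argo
  hence yS: "y * S \<ge> y" using y by simp
  have yS': "y * S = y * (ln 2 / 2) + y * (ln 3 / 3) + 532 / 1000 * (y * (ln 5 / 5)) + 121 / 1000 * (y * (ln 6 / 6))
      + 245 / 1000 * (y * (ln 7 / 7)) + 51 / 1000 * (y * (ln 10 / 10))"
    unfolding S_def by (simp add: algebra_simps)
  show ?thesis unfolding excess_def sum_cheb
    using lo up[of 2] up[of 3] up[of 5] up[of 6] up[of 7] up[of 10] yS yS' by simp
qed

lemma excess_nonneg:
  assumes y: "y \<ge> 1"
  shows "excess y \<ge> 0"
proof (cases "y \<ge> 150")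
  case False
  define n where "n = nat \<lfloor>y\<rfloor>"
  have n: "real n \<le> y" "y < real n + 1" "n \<ge> 1"
    using y le_floor_iff[of 1 y] unfolding n_def by linarith+
  hence "n < 150" using False by linarith
  hence 0: "excess (real n) \<ge> 0" and 1: "excess (real n) + excess_slope n \<ge> 0"
    using n excess_nonneg_small[of n] excess_nonneg_small[of "Suc n"] excess_Suc[of n] by auto
  define x where "x = y - real n"
  have x: "0 \<le> x" "x \<le> 1" using n by (auto simp: x_def)
  have "excess y = (1 - x) * excess (real n) + x * (excess (real n) + excess_slope n)"
    using excess_linear[of y] y unfolding n_def[symmetric] x_def by (simp add: algebra_simps)
  moreover have "(1 - x) * excess (real n) \<ge> 0" using x 0 by (intro mult_nonneg_nonneg) auto
  moreover have "x * (excess (real n) + excess_slope n) \<ge> 0" using x(1) 1 by (rule mult_nonneg_nonneg)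
  ultimately show ?thesis by simp
qed (rule excess_nonneg_large)

text \<open>
  The true mean is ln t - 1 - gamma + o(1) with gamma = 0.57721..., so that the bound is off by
  about 0.006.
\<close>

definition mean_bound :: "real \<Rightarrow> real" where
  "mean_bound t = 100001 / 100000 * (ln t - 1) - 57123 / 100000 + 2464 / 1000 / t"

text \<open>
  In the combination of the means the term (ln t)^2 and the unknown constant cancel. The coefficient
  of ln t - 1 lies between 1 and 1.00001, and the remaining constant is half the sum of cheb d (ln
  d)^2/d.
\<close>

lemma mangoldt_mean_le:
  assumes t: "t \<ge> 400"
  shows "mangoldt_mean t \<le> mean_bound t"
proof -
  obtain \<kappa> where \<kappa>: "\<And>z. z \<ge> 40 \<Longrightarrow> log_mean_defect z \<le> \<kappa> - 81 / 100 / z"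
      "\<And>z. z \<ge> 40 \<Longrightarrow> log_mean_defect z \<ge> \<kappa> - 111 / 100 / z"
    using log_mean_defect_bounds by blast
  define l where "l = ln t"
  have l1: "l \<ge> 1" unfolding l_def using t exp_le by (subst ln_ge_iff) auto
  have l6: "ln (6::real) = ln 2 + ln 3" and l10: "ln (10::real) = ln 2 + ln 5"
    using ln_mult[of 2 "3::real"] ln_mult[of 2 "5::real"] by simp_all
  define M where "M = (\<lambda>x. l\<^sup>2 / 2 - l - l * x + x + x\<^sup>2 / 2 + \<kappa>)"
  have lm: "log_mean (t / d) = M (ln d) - \<kappa> + log_mean_defect (t / d)" if "d > 0" for d
    using t that by (simp add: log_mean_defect_def ln_div l_def M_def power2_eq_square field_simps)
  have lo: "log_mean (t / d) / d \<ge> M (ln d) / d - 111 / 100 / t" if d: "d \<ge> 1" "d \<le> 10" for d :: real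
  proof -
    have "t / d \<ge> 40" using t d by (simp add: field_simps)
    hence "log_mean (t / d) \<ge> M (ln d) - 111 / 100 / (t / d)" using \<kappa>(2) lm[of d] d by fastforce
    hence "log_mean (t / d) / d \<ge> (M (ln d) - 111 / 100 / (t / d)) / d" using d by (intro divide_right_mono) auto
    also have "(M (ln d) - 111 / 100 / (t / d)) / d = M (ln d) / d - 111 / 100 / t"
      using d t by (simp add: field_simps)
    finally show ?thesis .
  qed
  have up: "log_mean t \<le> M 0 - 81 / 100 / t"
    using \<kappa>(1)[of t] lm[of 1] t by simp
  have "mangoldt_mean t \<le> (\<Sum>d\<in>cheb_supp. cheb d / real d * log_mean (t / real d))"
    using t excess_nonneg cheb_supp_pos by (intro mangoldt_mean_le_sum) (auto simp: excess_def)
  also have "\<dots> = (\<Sum>d\<in>cheb_supp. cheb d * (log_mean (t / real d) / real d))" by simp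
  also have "\<dots> \<le> M 0 - M (ln 2) / 2 - M (ln 3) / 3 - 532 / 1000 * (M (ln 5) / 5) - 121 / 1000 * (M (ln 6) / 6)
      - 245 / 1000 * (M (ln 7) / 7) - 51 / 1000 * (M (ln 10) / 10) + 2464 / 1000 / t"
  proof -
    define r where "r = 1 / t"
    have r: "c / t = c * r" for c by (simp add: r_def)
    have "r \<ge> 0" using t by (simp add: r_def)
    moreover have "log_mean (t / real 1) / real 1 \<le> M 0 - 81 / 100 * r" using up by (simp add: r)
    ultimately show ?thesis unfolding sum_cheb
      using lo[of 2, unfolded r] lo[of 3, unfolded r] lo[of 5, unfolded r] lo[of 6, unfolded r]
        lo[of 7, unfolded r] lo[of 10, unfolded r] unfolding r of_nat_numeral
      by (simp del: of_nat_1)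
  qed
  also have "M 0 - M (ln 2) / 2 - M (ln 3) / 3 - 532 / 1000 * (M (ln 5) / 5) - 121 / 1000 * (M (ln 6) / 6)
      - 245 / 1000 * (M (ln 7) / 7) - 51 / 1000 * (M (ln 10) / 10) =
      (l - 1) * (ln 2 / 2 + ln 3 / 3 + 532 / 1000 * (ln 5 / 5) + 121 / 1000 * (ln 6 / 6)
      + 245 / 1000 * (ln 7 / 7) + 51 / 1000 * (ln 10 / 10)) -
      ((ln 2)\<^sup>2 / 2 + (ln 3)\<^sup>2 / 3 + 532 / 1000 * ((ln 5)\<^sup>2 / 5) + 121 / 1000 * ((ln 6)\<^sup>2 / 6)
      + 245 / 1000 * ((ln 7)\<^sup>2 / 7) + 51 / 1000 * ((ln 10)\<^sup>2 / 10)) / 2"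
    by (simp add: M_def field_simps)
  also have "\<dots> \<le> (l - 1) * (100001 / 100000) - 57123 / 100000"
  proof (intro diff_mono mult_left_mono)
    show "ln 2 / 2 + ln 3 / 3 + 532 / 1000 * (ln 5 / 5) + 121 / 1000 * (ln 6 / 6)
      + 245 / 1000 * (ln 7 / 7) + 51 / 1000 * (ln 10 / 10) \<le> (100001 / 100000 :: real)"
      unfolding l6 l10 using ln_small_primes_bounds by argo
    have sq: "a\<^sup>2 \<le> x\<^sup>2" if "a \<le> x" "0 \<le> a" for a x :: real using that by (intro power_mono)
    have "(ln 6)\<^sup>2 \<ge> (17917592 / 10000000 :: real)\<^sup>2" "(ln 10)\<^sup>2 \<ge> (23025848 / 10000000 :: real)\<^sup>2"
      unfolding l6 l10 using ln_small_primes_bounds by (intro sq; simp)+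
    with sq[OF ln_small_primes_bounds(1)] sq[OF ln_small_primes_bounds(3)] sq[OF ln_small_primes_bounds(5)]
      sq[OF ln_small_primes_bounds(7)]
    show "57123 / 100000 \<le> ((ln 2)\<^sup>2 / 2 + (ln 3)\<^sup>2 / 3 + 532 / 1000 * ((ln 5)\<^sup>2 / 5) + 121 / 1000 * ((ln 6)\<^sup>2 / 6)
      + 245 / 1000 * ((ln 7)\<^sup>2 / 7) + 51 / 1000 * ((ln 10)\<^sup>2 / 10)) / (2::real)"
      by (simp add: power2_eq_square)
  qed (use l1 in auto)
  finally show ?thesis unfolding mean_bound_def l_def by (simp only: mult.commute)
qed

section \<open>Prime sums through convex chords\<close>

text \<open>
  The knots are spaced geometrically, so that logarithms and ratios of knots are explicit.
\<close>

definition knot_ln :: "nat \<Rightarrow> real" where "knot_ln i = 6 + real i / 10"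
definition knot :: "nat \<Rightarrow> real" where "knot i = exp (knot_ln i)"
definition inv_mul_ln :: "real \<Rightarrow> real" where "inv_mul_ln u = 1 / (u * ln u)"
text \<open>
  With q the ratio of consecutive values 1/knot, the slope of a chord involves (1/10)/(1 - q) only.
\<close>

definition lam :: real where "lam = (1 / 10) / (1 - exp (- (1 / 10)))"
text \<open>
  The slope of 1/(u ln u), as a function of 1/u, between two neighbouring knots.
\<close>

definition chord_slope :: "nat \<Rightarrow> real" where
  "chord_slope i = 1 / knot_ln (Suc i) + lam / (knot_ln i * knot_ln (Suc i))"

lemma knot_ln_ge: "knot_ln i \<ge> 6" by (simp add: knot_ln_def)
lemma knot_ln_Suc: "knot_ln (Suc i) = knot_ln i + 1 / 10" by (simp add: knot_ln_def add_divide_distrib)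
lemma knot_pos: "knot i > 0" by (simp add: knot_def)
lemma ln_knot [simp]: "ln (knot i) = knot_ln i" by (simp add: knot_def)
lemma knot_mono: "i \<le> j \<Longrightarrow> knot i \<le> knot j" by (simp add: knot_def knot_ln_def)

lemma lam_pos: "lam > 0" by (simp add: lam_def)

lemma chord_slope_pos: "chord_slope i > 0"
  using knot_ln_ge[of i] knot_ln_ge[of "Suc i"] lam_pos
  by (auto simp: chord_slope_def intro!: add_pos_pos divide_pos_pos mult_pos_pos)

lemma chord_slope_Suc: "chord_slope (Suc i) \<le> chord_slope i"
proof -
  have l: "knot_ln i > 0" "knot_ln (Suc i) \<ge> knot_ln i" "knot_ln (Suc (Suc i)) \<ge> knot_ln (Suc i)"
    using knot_ln_ge[of i] by (auto simp: knot_ln_def)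
  thus ?thesis unfolding chord_slope_def using lam_pos
    by (intro add_mono divide_left_mono mult_mono mult_pos_pos) auto
qed

lemma chord_slope_eq:
  "inv_mul_ln (knot i) - inv_mul_ln (knot (Suc i)) = chord_slope i * (1 / knot i - 1 / knot (Suc i))"
proof -
  define q where "q = exp (- (1 / 10) :: real)"
  have q: "q < 1" by (simp add: q_def)
  have L: "knot_ln i > 0" using knot_ln_ge[of i] by linarith
  have "knot (Suc i) = knot i * exp (1 / 10)" by (simp add: knot_def knot_ln_Suc exp_add)
  hence "1 / knot (Suc i) = q * (1 / knot i)" by (simp add: q_def exp_minus field_simps)
  moreover define v where "v = 1 / knot i"
  ultimately have v: "1 / knot (Suc i) = q * v" "1 / knot i = v" by auto
  have m: "inv_mul_ln (knot j) = (1 / knot j) / knot_ln j" for j by (simp add: inv_mul_ln_def)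
  have "inv_mul_ln (knot i) = v / knot_ln i" "inv_mul_ln (knot (Suc i)) = q * v / knot_ln (Suc i)"
    using m[of i] m[of "Suc i"] by (simp_all only: v)
  moreover have "v / a - q * v / (a + 1 / 10) =
      (1 / (a + 1 / 10) + (1 / 10) / (1 - q) / (a * (a + 1 / 10))) * (v - q * v)" if "a > 0" for a
  proof -
    have "(1 / c + (1 / 10) / w / d) * (v * w) = v * (w / c + (1 / 10) / d)" if "w \<noteq> 0" "c \<noteq> 0" "d \<noteq> 0"
      for c d w :: real using that by (simp add: field_simps)
    from this[of "1 - q" "a + 1 / 10" "a * (a + 1 / 10)"]
    have "(1 / (a + 1 / 10) + (1 / 10) / (1 - q) / (a * (a + 1 / 10))) * (v - q * v) =
        v * ((1 - q) / (a + 1 / 10) + (1 / 10) / (a * (a + 1 / 10)))"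
      using q that by (simp add: right_diff_distrib mult.commute)
    also have "(1 / 10) / (a * (a + 1 / 10)) = 1 / a - 1 / (a + 1 / 10)"
      using that by (subst diff_frac_eq) auto
    also have "v * ((1 - q) / (a + 1 / 10) + (1 / a - 1 / (a + 1 / 10))) = v / a - q * v / (a + 1 / 10)"
      by (simp add: algebra_simps diff_divide_distrib)
    finally show ?thesis ..
  qed
  ultimately show ?thesis using L
    unfolding chord_slope_def lam_def q_def[symmetric] v knot_ln_Suc by simp
qed

text \<open>
  In terms of v = 1/u the function 1/(u ln u) is -v/ln v, and its second derivative is (1/L^2 +
  2/L^3)/v with L = -ln v.
\<close>

lemma convex_inv_mul_ln: "convex_on {0<..<1} (\<lambda>v::real. - (v / ln v))"
proof (rule f''_ge0_imp_convex)
  fix v :: real assume v: "v \<in> {0<..<1}"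
  hence l: "ln v < 0" by simp
  show "((\<lambda>v. - (v / ln v)) has_real_derivative (1 / (ln v)\<^sup>2 - 1 / ln v)) (at v)"
    using v l by (auto intro!: derivative_eq_intros simp: field_simps power2_eq_square)
  show "((\<lambda>v. 1 / (ln v)\<^sup>2 - 1 / ln v) has_real_derivative (1 / (ln v)\<^sup>2 - 2 / (ln v) ^ 3) / v) (at v)"
    using v l by (auto intro!: derivative_eq_intros simp: field_simps power2_eq_square power3_eq_cube)
  have "(ln v) ^ 3 \<le> 0" using l by (simp add: power_le_zero_eq)
  hence "2 / (ln v) ^ 3 \<le> 0" by (intro divide_nonneg_nonpos) auto
  moreover have "1 / (ln v)\<^sup>2 \<ge> 0" by simp
  ultimately have "1 / (ln v)\<^sup>2 - 2 / (ln v) ^ 3 \<ge> 0" by linarith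
  thus "(1 / (ln v)\<^sup>2 - 2 / (ln v) ^ 3) / v \<ge> 0" using v by (intro divide_nonneg_pos) auto
qed auto

lemma inv_mul_ln_le_chord:
  assumes u: "knot i \<le> u" "u \<le> knot (Suc i)"
  shows "inv_mul_ln u \<le> inv_mul_ln (knot (Suc i)) + chord_slope i * (1 / u - 1 / knot (Suc i))"
proof -
  define f where "f = (\<lambda>v::real. - (v / ln v))"
  have f: "inv_mul_ln w = f (1 / w)" if "w > 0" for w
    using that by (simp add: inv_mul_ln_def f_def ln_div)
  define x y where "x = 1 / knot (Suc i)" and "y = 1 / knot i"
  have u0: "u > 0" using u knot_pos[of i] by linarith
  have k1: "knot i > 1" using knot_ln_ge[of i] by (simp add: knot_def)
  have xy: "x < y" unfolding x_def y_def using knot_pos[of i] by (simp add: divide_simps knot_def knot_ln_def)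
  have in01: "x > 0" "y < 1" using k1 knot_pos[of "Suc i"] by (auto simp: x_def y_def)
  hence "convex_on {x..y} f"
    unfolding f_def by (intro convex_on_subset[OF convex_inv_mul_ln]) auto
  moreover have "1 / u \<in> {x..y}" unfolding x_def y_def using u u0 knot_pos[of i] by (auto intro!: divide_left_mono)
  ultimately have "f (1 / u) \<le> (f y - f x) / (y - x) * (1 / u - x) + f x"
    by (rule convex_onD_Icc')
  moreover have "f y - f x = chord_slope i * (y - x)"
    using chord_slope_eq[of i] f[OF knot_pos] by (simp add: x_def y_def)
  ultimately have "f (1 / u) \<le> chord_slope i * (1 / u - x) + f x" using xy by simp
  thus ?thesis using f[OF u0] f[OF knot_pos[of "Suc i"]] by (simp add: x_def)
qed

definition cheb_psi :: "nat \<Rightarrow> real" where "cheb_psi N = (\<Sum>n=1..N. mangoldt n)"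

lemma sum_split_at: "a \<le> b \<Longrightarrow> (\<Sum>n=1..b. f n) = (\<Sum>n=1..a. f n) + (\<Sum>n=Suc a..b. f (n::nat))" for f :: "nat \<Rightarrow> real"
  using sum.ub_add_nat[of 1 a f "b - a"] by simp

lemma mangoldt_mean_diff:
  assumes "s \<le> t" "0 < s"
  shows "mangoldt_mean t - mangoldt_mean s = cheb_psi (nat \<lfloor>s\<rfloor>) * (1 / s - 1 / t) +
     (\<Sum>n=Suc (nat \<lfloor>s\<rfloor>)..nat \<lfloor>t\<rfloor>. mangoldt n * (1 / real n - 1 / t))"
proof -
  have le: "nat \<lfloor>s\<rfloor> \<le> nat \<lfloor>t\<rfloor>" using assms by (intro nat_mono floor_mono)
  have "(\<Sum>n=1..nat \<lfloor>s\<rfloor>. mangoldt n * (1 / real n - 1 / t)) =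
     mangoldt_mean s + cheb_psi (nat \<lfloor>s\<rfloor>) * (1 / s - 1 / t)"
    unfolding mangoldt_mean_def cheb_psi_def sum_distrib_right sum.distrib[symmetric]
    by (intro sum.cong refl) (simp add: algebra_simps)
  thus ?thesis unfolding mangoldt_mean_def[of t] sum_split_at[OF le] by simp
qed

definition knot_floor :: "nat \<Rightarrow> nat" where "knot_floor i = nat \<lfloor>knot i\<rfloor>"

text \<open>
  Partial sums of Lambda(n)/(n ln n), made to vanish at the upper end. On primes the summand is 1/p
  - (ln p)/(x ln x) with x the upper knot.
\<close>

definition weighted_psi :: "nat \<Rightarrow> real" where
  "weighted_psi i = (\<Sum>n=Suc (knot_floor 0)..knot_floor i. mangoldt n * (inv_mul_ln (real n) - inv_mul_ln (knot i)))"

text \<open>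
  Below the old knot the weight grows by a constant, and above it the chord bounds the weight. Since
  the constant is the chord slope times the change of 1/knot, the two parts add up to the slope
  times the increment of the mean of Lambda.
\<close>

lemma weighted_psi_Suc:
  "weighted_psi (Suc i) \<le> weighted_psi i + chord_slope i * (mangoldt_mean (knot (Suc i)) - mangoldt_mean (knot i))
     - cheb_psi (knot_floor 0) * (inv_mul_ln (knot i) - inv_mul_ln (knot (Suc i)))"
proof -
  define a b where "a = knot_floor i" and "b = knot_floor (Suc i)"
  have mono: "knot_floor j \<le> knot_floor k" if "j \<le> k" for j k
    unfolding knot_floor_def using knot_mono[OF that] by (intro nat_mono floor_mono)
  have le: "knot_floor 0 \<le> a" "a \<le> b" unfolding a_def b_def by (auto intro: mono)
  define g where "g = inv_mul_ln (knot i) - inv_mul_ln (knot (Suc i))"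
  have split: "(\<Sum>n=Suc (knot_floor 0)..b. f n) = (\<Sum>n=Suc (knot_floor 0)..a. f n) + (\<Sum>n=Suc a..b. f n)"
    for f :: "nat \<Rightarrow> real"
    using sum_split_at[of a b f] sum_split_at[of "knot_floor 0" a f] sum_split_at[of "knot_floor 0" b f] le by simp
  have "(\<Sum>n=Suc (knot_floor 0)..a. mangoldt n * (inv_mul_ln (real n) - inv_mul_ln (knot (Suc i)))) =
      weighted_psi i + (\<Sum>n=Suc (knot_floor 0)..a. mangoldt n) * g"
    unfolding weighted_psi_def a_def[symmetric] sum_distrib_right sum.distrib[symmetric] g_def
    by (intro sum.cong refl) (simp add: algebra_simps)
  moreover have "(\<Sum>n=Suc (knot_floor 0)..a. mangoldt n) = cheb_psi a - cheb_psi (knot_floor 0)"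
    unfolding cheb_psi_def sum_split_at[OF le(1)] by simp
  moreover have "(\<Sum>n=Suc a..b. mangoldt n * (inv_mul_ln (real n) - inv_mul_ln (knot (Suc i)))) \<le>
      (\<Sum>n=Suc a..b. mangoldt n * (chord_slope i * (1 / real n - 1 / knot (Suc i))))"
  proof (intro sum_mono mult_left_mono mangoldt_nonneg)
    fix n assume "n \<in> {Suc a..b}"
    hence "knot i \<le> real n" "real n \<le> knot (Suc i)"
      using knot_pos[of i] knot_pos[of "Suc i"] unfolding a_def b_def knot_floor_def
      by (auto simp: Suc_le_eq nat_less_iff le_nat_iff le_floor_iff floor_less_iff)
    from inv_mul_ln_le_chord[OF this]
    show "inv_mul_ln (real n) - inv_mul_ln (knot (Suc i)) \<le> chord_slope i * (1 / real n - 1 / knot (Suc i))"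
      by simp
  qed
  ultimately have 1: "weighted_psi (Suc i) \<le> weighted_psi i + (cheb_psi a - cheb_psi (knot_floor 0)) * g +
      (\<Sum>n=Suc a..b. mangoldt n * (chord_slope i * (1 / real n - 1 / knot (Suc i))))"
    unfolding weighted_psi_def[of "Suc i"] b_def[symmetric] split by simp
  have "(\<Sum>n=Suc a..b. mangoldt n * (chord_slope i * (1 / real n - 1 / knot (Suc i)))) =
      chord_slope i * (mangoldt_mean (knot (Suc i)) - mangoldt_mean (knot i) - cheb_psi a * (1 / knot i - 1 / knot (Suc i)))"
    using mangoldt_mean_diff[OF knot_mono knot_pos, of i "Suc i"]
    by (simp add: a_def b_def knot_floor_def sum_distrib_left mult_ac)
  also have "\<dots> = chord_slope i * (mangoldt_mean (knot (Suc i)) - mangoldt_mean (knot i)) - cheb_psi a * g"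
    unfolding g_def chord_slope_eq by (simp add: algebra_simps)
  finally show ?thesis using 1 unfolding g_def[symmetric] by (simp add: algebra_simps)
qed

lemma weighted_psi_le:
  "weighted_psi n \<le> (\<Sum>i<n. chord_slope i * (mangoldt_mean (knot (Suc i)) - mangoldt_mean (knot i)))
     - cheb_psi (knot_floor 0) * (inv_mul_ln (knot 0) - inv_mul_ln (knot n))"
proof (induction n)
  case 0
  show ?case by (simp add: weighted_psi_def)
next
  case (Suc n)
  thus ?case using weighted_psi_Suc[of n] by (simp add: algebra_simps)
qed

text \<open>
  Summation by parts: nonnegative e and decreasing s lose at most the initial term.
\<close>

lemma abel_antitone:
  fixes s e :: "nat \<Rightarrow> real"
  assumes "\<And>i. s i \<ge> 0" "\<And>i. s (Suc i) \<le> s i" "\<And>i. e i \<ge> 0"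
  shows "(\<Sum>i<n. s i * (e (Suc i) - e i)) \<ge> s n * e n - s 0 * e 0"
proof (induction n)
  case (Suc n)
  have "s (Suc n) * e (Suc n) \<le> s n * e (Suc n)" using assms by (intro mult_right_mono)
  thus ?case using Suc by (simp add: algebra_simps)
qed simp

lemma sum_chord_slope:
  "(\<Sum>i<n. chord_slope i / 10) = (\<Sum>i<n. 1 / (10 * knot_ln (Suc i))) + lam * (1 / 6 - 1 / knot_ln n)"
proof (induction n)
  case (Suc n)
  define a where "a = knot_ln n"
  have a: "a > 0" using knot_ln_ge[of n] by (simp add: a_def)
  have "lam / (a * (a + 1 / 10)) / 10 = lam * ((1 / 10) / (a * (a + 1 / 10)))" by simp
  also have "(1 / 10) / (a * (a + 1 / 10)) = 1 / a - 1 / (a + 1 / 10)"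
    using a by (subst diff_frac_eq) auto
  finally have "chord_slope n / 10 = 1 / (10 * knot_ln (Suc n)) + lam * (1 / a - 1 / (a + 1 / 10))"
    by (simp add: chord_slope_def knot_ln_Suc a_def add_divide_distrib)
  hence c: "chord_slope n / 10 = 1 / (10 * knot_ln (Suc n)) + lam * (1 / knot_ln n - 1 / knot_ln (Suc n))"
    by (simp only: a_def knot_ln_Suc)
  show ?case unfolding sum.lessThan_Suc Suc c unfolding right_diff_distrib by linarith
qed (simp add: knot_ln_def)

lemma exp_1_bounds: "exp 1 \<ge> (27182 / 10000 :: real)" "exp 1 \<le> (27183 / 10000 :: real)"
proof -
  have "inverse (2 ^ 32) = (1 / 4294967296 :: real)" by simp
  note e = e_approx_32[unfolded this]
  show "exp 1 \<ge> (27182 / 10000 :: real)" using abs_le_D2[OF e] by linarith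
  show "exp 1 \<le> (27183 / 10000 :: real)" using abs_le_D1[OF e] by linarith
qed

lemma knot_0_bounds: "knot 0 \<ge> 40335 / 100" "knot 0 \<le> 40346 / 100"
proof -
  have k: "knot 0 = exp 1 ^ 6" using exp_of_nat_mult[of 6 "1::real"] by (simp add: knot_def knot_ln_def)
  have "(27182 / 10000 :: real) ^ 6 \<le> exp 1 ^ 6" using exp_1_bounds by (intro power_mono) auto
  thus "knot 0 \<ge> 40335 / 100" unfolding k by (rule order_trans[rotated]) (simp add: power_divide)
  have "exp 1 ^ 6 \<le> (27183 / 10000 :: real) ^ 6" using exp_1_bounds by (intro power_mono) auto
  thus "knot 0 \<le> 40346 / 100" unfolding k by (rule order_trans) (simp add: power_divide)
qed

text \<open>
  The means may be replaced by their upper bounds at all knots, because the slopes decrease. Only at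
  the lowest knot the true mean remains, with a negative sign; there it is computed from the primes
  up to 403.
\<close>

lemma weighted_psi_bound:
  "weighted_psi n \<le> 100001 / 100000 * ((\<Sum>i<n. 1 / (10 * knot_ln (Suc i))) + lam * (1 / 6 - 1 / knot_ln n))
     + chord_slope 0 * (mean_bound (knot 0) - mangoldt_mean (knot 0))
     - (2464 / 1000 + cheb_psi (knot_floor 0)) * (inv_mul_ln (knot 0) - inv_mul_ln (knot n))"
proof -
  have k400: "knot i \<ge> 400" for i using knot_mono[of 0 i] knot_0_bounds(1) by simp
  define e where "e = (\<lambda>i. mean_bound (knot i) - mangoldt_mean (knot i))"
  have e: "e i \<ge> 0" for i unfolding e_def using mangoldt_mean_le[OF k400] by simp
  have "(\<Sum>i<n. chord_slope i * (e (Suc i) - e i)) \<ge> chord_slope n * e n - chord_slope 0 * e 0"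
    using chord_slope_pos chord_slope_Suc e by (intro abel_antitone) (auto intro: less_imp_le)
  moreover have "chord_slope n * e n \<ge> 0" using chord_slope_pos[of n] e[of n] by simp
  ultimately have 1: "(\<Sum>i<n. chord_slope i * (mangoldt_mean (knot (Suc i)) - mangoldt_mean (knot i))) \<le>
      (\<Sum>i<n. chord_slope i * (mean_bound (knot (Suc i)) - mean_bound (knot i))) + chord_slope 0 * e 0"
    unfolding e_def by (simp add: right_diff_distrib sum_subtractf)
  have step: "chord_slope i * (mean_bound (knot (Suc i)) - mean_bound (knot i)) =
      100001 / 100000 * (chord_slope i / 10) - 2464 / 1000 * (inv_mul_ln (knot i) - inv_mul_ln (knot (Suc i)))" for i
  proof -
    have "s * ((al * (L + 1 / 10 - 1) - be + ro / y) - (al * (L - 1) - be + ro / x)) =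
        al * (s / 10) - ro * (s * (1 / x - 1 / y))" for s al L be ro x y :: real
      by (simp add: algebra_simps)
    thus ?thesis unfolding chord_slope_eq mean_bound_def ln_knot knot_ln_Suc .
  qed
  have "(\<Sum>i<n. chord_slope i * (mean_bound (knot (Suc i)) - mean_bound (knot i))) =
      100001 / 100000 * (\<Sum>i<n. chord_slope i / 10) - 2464 / 1000 * (\<Sum>i<n. inv_mul_ln (knot i) - inv_mul_ln (knot (Suc i)))"
    unfolding step unfolding sum_subtractf[of "\<lambda>i. 100001 / 100000 * (chord_slope i / 10)"] sum_distrib_left ..
  also have "(\<Sum>i<n. inv_mul_ln (knot i) - inv_mul_ln (knot (Suc i))) = inv_mul_ln (knot 0) - inv_mul_ln (knot n)"
    by (rule sum_lessThan_telescope'[where f = "\<lambda>i. inv_mul_ln (knot i)"])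
  finally have 2: "(\<Sum>i<n. chord_slope i * (mean_bound (knot (Suc i)) - mean_bound (knot i))) =
      100001 / 100000 * (\<Sum>i<n. chord_slope i / 10) - 2464 / 1000 * (inv_mul_ln (knot 0) - inv_mul_ln (knot n))" .
  show ?thesis
    using weighted_psi_le[of n] 1 unfolding 2 sum_chord_slope e_def distrib_right by linarith
qed

section \<open>The primes up to 403\<close>

text \<open>
  An entry (p, b, i, j, k, l) records that 2^i 3^j 5^k 7^l is at most p^b and close to it. With
  bounds for the logarithms of 2, 3, 5 and 7 this gives a lower bound for ln p that is accurate to
  about 0.001, and much better for the small primes, which carry most of the weight.
\<close>

definition log_table :: "(int \<times> int \<times> int \<times> int \<times> int \<times> int) list" where
  "log_table = [(2, 1, 1, 0, 0, 0), (3, 1, 0, 1, 0, 0), (5, 1, 0, 0, 1, 0), (7, 1, 0, 0, 0, 1), (11, 6, 1, 11, 1, 0),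
   (13, 7, 11, 0, 4, 2), (17, 7, 1, 1, 10, 1), (19, 6, 9, 1, 4, 2), (23, 7, 2, 4, 4, 5), (29, 5, 0, 8, 5, 0),
   (31, 5, 0, 5, 0, 6), (37, 7, 3, 5, 11, 0), (41, 6, 1, 5, 10, 0), (43, 5, 6, 1, 6, 2), (47, 7, 2, 3, 9, 4),
   (53, 4, 3, 2, 6, 1), (59, 4, 4, 2, 1, 5), (61, 3, 4, 4, 2, 1), (67, 3, 0, 0, 3, 4), (71, 2, 4, 2, 1, 1),
   (73, 3, 1, 4, 0, 4), (79, 4, 3, 4, 2, 4), (83, 3, 4, 6, 0, 2), (89, 4, 11, 0, 4, 2), (97, 2, 6, 1, 0, 2),
   (101, 3, 3, 1, 3, 3), (103, 4, 0, 1, 6, 4), (107, 3, 3, 0, 5, 2), (109, 4, 9, 2, 4, 2), (113, 3, 3, 1, 2, 4),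
   (127, 2, 8, 2, 0, 1), (131, 2, 1, 0, 2, 3), (137, 2, 1, 1, 5, 0), (139, 4, 12, 6, 3, 0), (149, 3, 2, 3, 4, 2),
   (151, 3, 15, 1, 1, 1), (157, 4, 5, 5, 7, 0), (163, 4, 4, 1, 3, 6), (167, 4, 10, 5, 5, 0), (173, 4, 3, 6, 5, 2),
   (179, 3, 15, 0, 2, 1), (181, 3, 7, 3, 1, 3), (191, 3, 12, 5, 0, 1), (193, 4, 20, 3, 0, 2), (197, 4, 9, 0, 2, 6),
   (199, 4, 11, 0, 6, 2), (211, 4, 21, 3, 1, 1), (223, 4, 3, 1, 3, 7), (227, 4, 18, 4, 3, 0), (229, 3, 3, 0, 4, 4),
   (233, 3, 12, 2, 0, 3), (239, 4, 0, 12, 3, 2), (241, 4, 12, 0, 0, 7), (251, 2, 3, 2, 3, 1), (257, 4, 2, 3, 0, 9),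
   (263, 4, 2, 7, 7, 1), (269, 3, 2, 4, 2, 4), (271, 4, 0, 16, 3, 0), (277, 4, 4, 0, 5, 6), (281, 4, 3, 3, 1, 8),
   (283, 4, 5, 5, 0, 7), (293, 2, 1, 0, 3, 3), (307, 3, 1, 10, 1, 2), (311, 4, 2, 4, 1, 8), (313, 3, 3, 0, 7, 2),
   (317, 3, 17, 5, 0, 0), (331, 4, 7, 7, 3, 3), (337, 3, 2, 7, 4, 1), (347, 4, 29, 3, 0, 0), (349, 4, 4, 2, 3, 7),
   (353, 4, 1, 4, 9, 2), (359, 4, 1, 12, 6, 0), (367, 4, 12, 11, 2, 0), (373, 4, 15, 3, 5, 1), (379, 3, 8, 5, 3, 1),
   (383, 4, 11, 0, 4, 5), (389, 2, 0, 2, 0, 5), (397, 4, 0, 10, 2, 5), (401, 4, 1, 3, 10, 2)]"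

lemma log_table_pow:
  "list_all (\<lambda>(p, b, i, j, k, l). 2 ^ nat i * 3 ^ nat j * 5 ^ nat k * 7 ^ nat l \<le> p ^ nat b \<and> 0 < b
     \<and> 0 \<le> i \<and> 0 \<le> j \<and> 0 \<le> k \<and> 0 \<le> l) log_table"
  by code_simp

text \<open>
  The largest exponent e with p^e at most 403, for primes p up to 403.
\<close>

definition low_exp :: "int \<Rightarrow> nat" where
  "low_exp p = (if p \<le> 2 then 8 else if p \<le> 3 then 5 else if p \<le> 7 then 3 else if p \<le> 19 then 2 else 1)"

text \<open>
  An exponent e with p^e at most 10^7; powers of p between 403 and this bound are discounted from
  the sum over Lambda.
\<close>

definition high_exp :: "int \<Rightarrow> nat" where
  "high_exp p = (if p \<le> 2 then 23 else if p \<le> 3 then 14 else if p \<le> 5 then 10 else if p \<le> 7 then 8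
     else if p \<le> 14 then 6 else if p \<le> 25 then 5 else if p \<le> 56 then 4 else if p \<le> 215 then 3 else 2)"

lemma exps_pow:
  "list_all (\<lambda>(p, _). p ^ low_exp p \<le> 403 \<and> 404 \<le> p ^ Suc (low_exp p) \<and> p ^ high_exp p \<le> 10 ^ 7) log_table"
  by code_simp

lemma sieve_check:
  "distinct (map fst log_table)"
  "list_all (\<lambda>n. n \<in> set (map fst log_table) \<or> list_ex (\<lambda>q. n mod q = 0 \<and> q < n) [2, 3, 5, 7, 11, 13, 17, 19]) [2..403]"
  "list_all (\<lambda>n. 2 \<le> n \<and> n \<le> 403 \<and> list_all (\<lambda>q. n mod q \<noteq> 0 \<or> n = q) [2, 3, 5, 7, 11, 13, 17, 19]) (map fst log_table)"
  by code_simp+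

lemma prime_le_20:
  assumes "prime (q::nat)" "q \<le> 20"
  shows "q \<in> {2, 3, 5, 7, 11, 13, 17, 19}"
proof -
  have "q = 0 \<or> q = 1 \<or> q = 2 \<or> q = 3 \<or> q = 4 \<or> q = 5 \<or> q = 6 \<or> q = 7 \<or> q = 8 \<or> q = 9 \<or> q = 10
      \<or> q = 11 \<or> q = 12 \<or> q = 13 \<or> q = 14 \<or> q = 15 \<or> q = 16 \<or> q = 17 \<or> q = 18 \<or> q = 19 \<or> q = 20"
    using assms(2) by presburger
  thus ?thesis using assms(1) by (elim disjE) simp_all
qed

text \<open>
  A number up to 403 is prime if and only if it has no proper divisor among the primes up to 19,
  since 21^2 exceeds 403.
\<close>

lemma fst_log_table_iff: "int p \<in> set (map fst log_table) \<longleftrightarrow> prime p \<and> p \<le> 403"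
proof
  assume "int p \<in> set (map fst log_table)"
  with sieve_check(3) have chk: "2 \<le> int p \<and> int p \<le> 403 \<and>
      list_all (\<lambda>q. int p mod q \<noteq> 0 \<or> int p = q) [2, 3, 5, 7, 11, 13, 17, 19]"
    unfolding list_all_iff[of _ "map fst log_table"] by (rule bspec)
  hence p: "p \<ge> 2" "p \<le> 403" by linarith+
  from chk have nd: "\<forall>q\<in>set [2, 3, 5, 7, 11, 13, 17, 19]. int p mod q \<noteq> 0 \<or> int p = q"
    unfolding list_all_iff[of _ "[2, 3, 5, 7, 11, 13, 17, 19]"] by (elim conjE)
  have "prime p"
  proof (rule ccontr)
    assume "\<not> prime p"
    then obtain q where q: "prime q" "q dvd p" "q\<^sup>2 \<le> p"
      using p prime_prime_factor_sqrt[of p] by auto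
    have "q \<le> 20"
    proof (rule ccontr)
      assume "\<not> q \<le> 20"
      hence "21\<^sup>2 \<le> q\<^sup>2" by (intro power_mono) auto
      thus False using q p by simp
    qed
    from prime_le_20[OF q(1) this] have "int q \<in> set [2, 3, 5, 7, 11, 13, 17, 19]" by auto
    from bspec[OF nd this] have "int p = int q" using q(2) by (simp add: mod_eq_0_iff_dvd)
    hence "p = q" by simp
    thus False using \<open>\<not> prime p\<close> q(1) by simp
  qed
  thus "prime p \<and> p \<le> 403" using p by simp
next
  assume "prime p \<and> p \<le> 403"
  hence p: "prime p" "p \<le> 403" "p \<ge> 2" by (auto simp: prime_ge_2_nat)
  hence "int p \<in> set [2..403]" unfolding set_upto atLeastAtMost_iff by simp
  with sieve_check(2) have sieve: "int p \<in> set (map fst log_table) \<or>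
      list_ex (\<lambda>q. int p mod q = 0 \<and> q < int p) [2, 3, 5, 7, 11, 13, 17, 19]"
    unfolding list_all_iff by (rule bspec)
  have no_divisor: False if q: "q \<in> set [2, 3, 5, 7, 11, 13, 17, 19]" "int p mod q = 0" "q < int p" for q
  proof -
    have "1 < q" using q(1) by auto
    define r where "r = nat q"
    have qr: "q = int r" and "1 < r" using \<open>1 < q\<close> by (auto simp: r_def)
    have "int r dvd int p" using q(2) unfolding qr by (simp only: mod_eq_0_iff_dvd)
    hence "r dvd p" by (simp only: of_nat_dvd_iff)
    moreover have "r < p" using q(3) unfolding qr by simp
    ultimately show False using p(1) \<open>1 < r\<close> by (auto simp: prime_nat_iff)
  qed
  have "int p \<in> set (map fst log_table)" if "list_ex (\<lambda>q. int p mod q = 0 \<and> q < int p) [2, 3, 5, 7, 11, 13, 17, 19]"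
  proof -
    from that obtain q where "q \<in> set [2, 3, 5, 7, 11, 13, 17, 19]" "int p mod q = 0 \<and> q < int p"
      unfolding list_ex_iff by (rule bexE)
    with no_divisor[of q] show ?thesis by simp
  qed
  with sieve show "int p \<in> set (map fst log_table)" by (elim disjE)
qed

lemma fst_log_table_ge: "x \<in> set (map fst log_table) \<Longrightarrow> x \<ge> 2"
proof -
  assume "x \<in> set (map fst log_table)"
  with sieve_check(3) have "2 \<le> x \<and> x \<le> 403 \<and> list_all (\<lambda>q. x mod q \<noteq> 0 \<or> x = q) [2, 3, 5, 7, 11, 13, 17, 19]"
    unfolding list_all_iff[of _ "map fst log_table"] by (rule bspec)
  thus ?thesis by (elim conjE)
qed

lemma sum_small_primes: "(\<Sum>p | prime p \<and> p \<le> 403. f (int p)) = (\<Sum>t\<leftarrow>log_table. f (fst t))"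
proof -
  have "int ` {p. prime p \<and> p \<le> 403} = set (map fst log_table)"
  proof (intro equalityI subsetI)
    fix x assume x: "x \<in> set (map fst log_table)"
    hence "x = int (nat x)" using fst_log_table_ge[OF x] by simp
    moreover from this x have "nat x \<in> {p. prime p \<and> p \<le> 403}" using fst_log_table_iff[of "nat x"] by simp
    ultimately show "x \<in> int ` {p. prime p \<and> p \<le> 403}" by (rule image_eqI)
  next
    fix x assume "x \<in> int ` {p. prime p \<and> p \<le> 403}"
    thus "x \<in> set (map fst log_table)" using fst_log_table_iff by (elim imageE) (simp only: mem_Collect_eq)
  qed
  hence "(\<Sum>x\<in>set (map fst log_table). f x) = (\<Sum>p | prime p \<and> p \<le> 403. f (int p))"
    by (metis (no_types, lifting) inj_on_of_nat sum.reindex_cong)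
  moreover have "(\<Sum>x\<in>set (map fst log_table). f x) = (\<Sum>x\<leftarrow>map fst log_table. f x)"
    by (rule sum_list_distinct_conv_sum_set[OF sieve_check(1), symmetric])
  ultimately show ?thesis by (simp only: map_map comp_def)
qed

definition ln_low_num :: "int \<Rightarrow> int \<Rightarrow> int \<Rightarrow> int \<Rightarrow> int" where
  "ln_low_num i j k l = 6931471 * i + 10986121 * j + 16094377 * k + 19459099 * l"

definition ln_low :: "int \<times> int \<times> int \<times> int \<times> int \<times> int \<Rightarrow> real" where
  "ln_low = (\<lambda>(p, b, i, j, k, l). real_of_int (ln_low_num i j k l) / (10 ^ 7 * real_of_int b))"

lemma ln_low_le:
  assumes "t \<in> set log_table"
  shows "ln_low t \<le> ln (real_of_int (fst t))"
proof -
  obtain p b i j k l where t: "t = (p, b, i, j, k, l)" by (cases t) auto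
  have "fst t \<in> set (map fst log_table)" using assms by simp
  from fst_log_table_ge[OF this] have p: "p > 0" by (simp add: t)
  have "case t of (p, b, i, j, k, l) \<Rightarrow> 2 ^ nat i * 3 ^ nat j * 5 ^ nat k * 7 ^ nat l \<le> p ^ nat b \<and> 0 < b
     \<and> 0 \<le> i \<and> 0 \<le> j \<and> 0 \<le> k \<and> 0 \<le> l"
    using log_table_pow assms unfolding list_all_iff by (rule bspec)
  hence *: "2 ^ nat i * 3 ^ nat j * 5 ^ nat k * 7 ^ nat l \<le> p ^ nat b"
      and nn: "0 < b" "0 \<le> i" "0 \<le> j" "0 \<le> k" "0 \<le> l"
    unfolding t prod.case by (simp_all only: simp_thms)
  have "real_of_int (2 ^ nat i * 3 ^ nat j * 5 ^ nat k * 7 ^ nat l) \<le> real_of_int (p ^ nat b)"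
    using * by (simp only: of_int_le_iff)
  hence "ln (2 ^ nat i * 3 ^ nat j * 5 ^ nat k * 7 ^ nat l :: real) \<le> ln (real_of_int p ^ nat b)"
    by (subst ln_le_cancel_iff) (use p in auto)
  hence "i * ln 2 + j * ln 3 + k * ln 5 + l * ln 7 \<le> b * ln (real_of_int p)"
    using p nn by (simp add: ln_mult ln_realpow)
  moreover have "real_of_int i * (6931471 / 10000000) \<le> i * ln 2" "real_of_int j * (10986121 / 10000000) \<le> j * ln 3"
     "real_of_int k * (16094377 / 10000000) \<le> k * ln 5" "real_of_int l * (19459099 / 10000000) \<le> l * ln 7"
    using ln_small_primes_bounds nn by (intro mult_left_mono; simp)+
  ultimately have "real_of_int (ln_low_num i j k l) / 10 ^ 7 \<le> b * ln (real_of_int p)"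
    by (simp add: add_divide_distrib ln_low_num_def)
  thus ?thesis using nn(1) by (simp add: ln_low_def t field_simps)
qed

lemma sum_list_of_int_le:
  assumes "\<And>t. t \<in> set L \<Longrightarrow> real_of_int (f t) \<le> c * g t"
  shows "real_of_int (\<Sum>t\<leftarrow>L. f t) \<le> c * (\<Sum>t\<leftarrow>L. g t)"
  using assms by (induction L) (auto simp: distrib_left intro: add_mono)

lemma sum_list_of_int_ge:
  assumes "\<And>t. t \<in> set L \<Longrightarrow> c * g t \<le> real_of_int (f t)"
  shows "c * (\<Sum>t\<leftarrow>L. g t) \<le> real_of_int (\<Sum>t\<leftarrow>L. f t)"
  using assms by (induction L) (auto simp: distrib_left intro: add_mono)

text \<open>
  The numerical sums are evaluated in integers after scaling by 10^9, each term being rounded in the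
  safe direction.
\<close>

lemma scaled_lower: "int_bound \<le> (s::int) \<Longrightarrow> real_of_int s \<le> 10 ^ 9 * x \<Longrightarrow> real_of_int int_bound / 10 ^ 9 \<le> x"
  by (simp add: field_simps)

lemma scaled_upper: "(s::int) \<le> int_bound \<Longrightarrow> 10 ^ 9 * x \<le> real_of_int s \<Longrightarrow> x \<le> real_of_int int_bound / 10 ^ 9"
  by (simp add: field_simps)

lemma small_prime_recip_sum: "(\<Sum>t\<leftarrow>log_table. 1 / real_of_int (fst t)) \<le> real_of_int 2061280000 / 10 ^ 9"
proof (rule scaled_upper)
  show "(\<Sum>t\<leftarrow>log_table. 10 ^ 9 div fst t + 1) \<le> 2061280000" by code_simp
  show "10 ^ 9 * (\<Sum>t\<leftarrow>log_table. 1 / real_of_int (fst t)) \<le> real_of_int (\<Sum>t\<leftarrow>log_table. 10 ^ 9 div fst t + 1)"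
  proof (rule sum_list_of_int_ge)
    fix t :: "int \<times> int \<times> int \<times> int \<times> int \<times> int"
    show "10 ^ 9 * (1 / real_of_int (fst t)) \<le> real_of_int (10 ^ 9 div fst t + 1)"
      using real_of_int_div3[of "10 ^ 9" "fst t"] by simp
  qed
qed

lemma high_power_recip_sum:
  "real_of_int 6930000 / 10 ^ 9 \<le> (\<Sum>t\<leftarrow>log_table. \<Sum>j\<leftarrow>[int (Suc (low_exp (fst t)))..int (high_exp (fst t))].
      1 / (real_of_int j * real_of_int (fst t) ^ nat j) - 1 / 10 ^ 8)"
proof (rule scaled_lower)
  show "6930000 \<le> (\<Sum>t\<leftarrow>log_table. \<Sum>j\<leftarrow>[int (Suc (low_exp (fst t)))..int (high_exp (fst t))].
      10 ^ 9 div (j * fst t ^ nat j) - 10)" by code_simp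
  have le: "real_of_int (10 ^ 9 div (j * p ^ nat j) - 10) \<le> 10 ^ 9 * (1 / (real_of_int j * real_of_int p ^ nat j) - 1 / 10 ^ 8)"
    for p j using real_of_int_div4[of "10 ^ 9" "j * p ^ nat j"] by simp
  show "real_of_int (\<Sum>t\<leftarrow>log_table. \<Sum>j\<leftarrow>[int (Suc (low_exp (fst t)))..int (high_exp (fst t))].
      10 ^ 9 div (j * fst t ^ nat j) - 10) \<le> 10 ^ 9 * (\<Sum>t\<leftarrow>log_table. \<Sum>j\<leftarrow>[int (Suc (low_exp (fst t)))..int (high_exp (fst t))].
      1 / (real_of_int j * real_of_int (fst t) ^ nat j) - 1 / 10 ^ 8)"
    by (intro sum_list_of_int_le le)
qed

lemma low_power_log_sum:
  "real_of_int 5428100000 / 10 ^ 9 \<le>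
     (\<Sum>t\<leftarrow>log_table. ln_low t * ((1 - 1 / real_of_int (fst t) ^ low_exp (fst t)) / (real_of_int (fst t) - 1)))"
proof (rule scaled_lower)
  show "5428100000 \<le> (\<Sum>(p, b, i, j, k, l)\<leftarrow>log_table.
      ln_low_num i j k l * (p ^ low_exp p - 1) * 100 div (b * p ^ low_exp p * (p - 1)))" by code_simp
  show "real_of_int (\<Sum>(p, b, i, j, k, l)\<leftarrow>log_table.
      ln_low_num i j k l * (p ^ low_exp p - 1) * 100 div (b * p ^ low_exp p * (p - 1))) \<le> 
      10 ^ 9 * (\<Sum>t\<leftarrow>log_table. ln_low t * ((1 - 1 / real_of_int (fst t) ^ low_exp (fst t)) / (real_of_int (fst t) - 1)))"
  proof (rule sum_list_of_int_le)
    fix t assume t: "t \<in> set log_table"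
    obtain p b i j k l where t_eq: "t = (p, b, i, j, k, l)" by (cases t) auto
    have "fst t \<in> set (map fst log_table)" using t by simp
    from fst_log_table_ge[OF this] have "p > 0" by (simp add: t_eq)
    have gen: "x * y * 100 / (b' * q * r) = 10 ^ 9 * (x / (10 ^ 7 * b') * ((y / q) / r))" for x y b' q r :: real by (simp add: mult_ac)
    have "real_of_int (ln_low_num i j k l * (p ^ low_exp p - 1) * 100 div (b * p ^ low_exp p * (p - 1))) \<le>
       real_of_int (ln_low_num i j k l) * (real_of_int p ^ low_exp p - 1) * 100 / (real_of_int b * real_of_int p ^ low_exp p * (real_of_int p - 1))"
      using real_of_int_div4[of "ln_low_num i j k l * (p ^ low_exp p - 1) * 100" "b * p ^ low_exp p * (p - 1)"]
      by (simp only: of_int_mult of_int_diff of_int_power of_int_1 of_int_numeral)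
    also have "\<dots> = 10 ^ 9 * (ln_low t * (((real_of_int p ^ low_exp p - 1) / real_of_int p ^ low_exp p) / (real_of_int p - 1)))"
      unfolding gen by (simp only: ln_low_def t_eq prod.case)
    also have "(real_of_int p ^ low_exp p - 1) / real_of_int p ^ low_exp p = 1 - 1 / real_of_int p ^ low_exp p"
      using \<open>p > 0\<close> by (simp add: field_simps)
    finally show "real_of_int (case t of (p, b, i, j, k, l) \<Rightarrow> ln_low_num i j k l * (p ^ low_exp p - 1) * 100 div (b * p ^ low_exp p * (p - 1)))
      \<le> 10 ^ 9 * (ln_low t * ((1 - 1 / real_of_int (fst t) ^ low_exp (fst t)) / (real_of_int (fst t) - 1)))"
      by (simp only: t_eq prod.case fst_conv)
  qed
qed

lemma low_power_log_count:
  "(\<Sum>t\<leftarrow>log_table. ln_low t * real (low_exp (fst t))) \<le> real_of_int 403812000000 / 10 ^ 9"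
proof (rule scaled_upper)
  show "(\<Sum>(p, b, i, j, k, l)\<leftarrow>log_table. ln_low_num i j k l * int (low_exp p) * 100 div b + 1) \<le> 403812000000"
    by code_simp
  show "10 ^ 9 * (\<Sum>t\<leftarrow>log_table. ln_low t * real (low_exp (fst t))) \<le>
      real_of_int (\<Sum>(p, b, i, j, k, l)\<leftarrow>log_table. ln_low_num i j k l * int (low_exp p) * 100 div b + 1)"
  proof (rule sum_list_of_int_ge)
    fix t :: "int \<times> int \<times> int \<times> int \<times> int \<times> int"
    obtain p b i j k l where t_eq: "t = (p, b, i, j, k, l)" by (cases t) auto
    have "real_of_int (ln_low_num i j k l * int (low_exp p) * 100) / real_of_int b \<le>
        real_of_int (ln_low_num i j k l * int (low_exp p) * 100 div b) + 1"
      using real_of_int_div3[of "ln_low_num i j k l * int (low_exp p) * 100" b] by linarith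
    thus "10 ^ 9 * (ln_low t * real (low_exp (fst t))) \<le> real_of_int (case t of (p, b, i, j, k, l) \<Rightarrow>
        ln_low_num i j k l * int (low_exp p) * 100 div b + 1)"
      unfolding ln_low_def t_eq by (simp add: mult_ac)
  qed
qed

lemma harmonic_piece: "(\<Sum>i<122. 1 / (10 * knot_ln (Suc i))) \<le> 110410 / 100000"
proof -
  have step: "1 / (10 * knot_ln (Suc n)) = inverse (real (Suc (60 + n)))" for n
  proof -
    have "10 * knot_ln (Suc n) = real (Suc (60 + n))" by (simp add: knot_ln_def)
    thus ?thesis by (simp only: inverse_eq_divide)
  qed
  have "(\<Sum>i<n. inverse (real (Suc (60 + i)))) = harm (60 + n) - harm 60" for n
  proof (induction n)
    case (Suc n)
    have "harm (60 + Suc n) = harm (60 + n) + inverse (real (Suc (60 + n)))" by (simp only: add_Suc_right harm_Suc)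
    thus ?case unfolding sum.lessThan_Suc Suc by linarith
  qed simp
  from this[of 122] show ?thesis unfolding step by (simp add: harm_expand)
qed

section \<open>Reciprocals of primes up to exp(18.2)\<close>

text \<open>
  Distinct pairs of a prime and a positive exponent give distinct prime powers, and the omitted
  terms are nonnegative.
\<close>

lemma sum_mangoldt_ge_prime_powers:
  fixes f :: "nat \<Rightarrow> real"
  assumes "finite S" "\<And>p. p \<in> S \<Longrightarrow> prime p" "\<And>p. p \<in> S \<Longrightarrow> finite (J p)"
    and J: "\<And>p j. p \<in> S \<Longrightarrow> j \<in> J p \<Longrightarrow> j > 0 \<and> p ^ j \<in> B"
    and B: "finite B" "\<And>n. n \<in> B \<Longrightarrow> f n \<ge> 0"
  shows "(\<Sum>p\<in>S. \<Sum>j\<in>J p. ln (real p) * f (p ^ j)) \<le> (\<Sum>n\<in>B. mangoldt n * f n)"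
proof -
  define P where "P = (SIGMA p:S. J p)"
  have inj: "inj_on (\<lambda>(p, j). p ^ j) P"
  proof (rule inj_onI)
    fix x y assume "x \<in> P" "y \<in> P" "(case x of (p, j) \<Rightarrow> p ^ j) = (case y of (p, j) \<Rightarrow> p ^ j)"
    then obtain p j q k where "x = (p, j)" "y = (q, k)" "p \<in> S" "q \<in> S" "j \<in> J p" "k \<in> J q" "p ^ j = q ^ k"
      unfolding P_def by auto
    thus "x = y" using prime_power_inj''[of p q j k] assms(2)[of p] assms(2)[of q] J[of p j] J[of q k] by auto
  qed
  have "(\<Sum>p\<in>S. \<Sum>j\<in>J p. ln (real p) * f (p ^ j)) = (\<Sum>(p, j)\<in>P. mangoldt (p ^ j) * f (p ^ j))"
    unfolding P_def using assms by (subst sum.Sigma) (auto intro!: sum.cong)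
  also have "\<dots> = (\<Sum>n\<in>(\<lambda>(p, j). p ^ j) ` P. mangoldt n * f n)"
    by (subst sum.reindex[OF inj]) (auto intro!: sum.cong)
  also have "\<dots> \<le> (\<Sum>n\<in>B. mangoldt n * f n)"
    using J B by (intro sum_mono2) (auto simp: P_def mangoldt_nonneg)
  finally show ?thesis .
qed

lemma small_prime_exps:
  assumes "prime p" "p \<le> 403"
  shows "p ^ low_exp (int p) \<le> 403" "404 \<le> p ^ Suc (low_exp (int p))" "p ^ high_exp (int p) \<le> 10 ^ 7"
proof -
  have "int p \<in> set (map fst log_table)" using assms fst_log_table_iff by blast
  then obtain t where t: "t \<in> set log_table" "fst t = int p" by auto
  have "case t of (p, _) \<Rightarrow> p ^ low_exp p \<le> 403 \<and> 404 \<le> p ^ Suc (low_exp p) \<and> p ^ high_exp p \<le> 10 ^ 7"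
    using exps_pow t(1) unfolding list_all_iff by (rule bspec)
  hence *: "int p ^ low_exp (int p) \<le> 403 \<and> 404 \<le> int p ^ Suc (low_exp (int p)) \<and> int p ^ high_exp (int p) \<le> 10 ^ 7"
    unfolding case_prod_unfold t(2) .
  from * have "int (p ^ low_exp (int p)) \<le> int 403" by (simp only: of_nat_power of_nat_numeral)
  thus "p ^ low_exp (int p) \<le> 403" by (simp only: of_nat_le_iff)
  from * have "int 404 \<le> int (p ^ Suc (low_exp (int p)))" by (simp only: of_nat_power of_nat_numeral)
  thus "404 \<le> p ^ Suc (low_exp (int p))" by (simp only: of_nat_le_iff)
  from * have "int (p ^ high_exp (int p)) \<le> int (10 ^ 7)" by (simp only: of_nat_power of_nat_numeral)
  thus "p ^ high_exp (int p) \<le> 10 ^ 7" by (simp only: of_nat_le_iff)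
qed

lemma exp_tenth_bounds: "exp (1 / 10) \<ge> (1105170 / 1000000 :: real)" "exp (1 / 10) \<le> (1105172 / 1000000 :: real)"
proof -
  have e: "exp (1 / 10) ^ 10 = (exp 1 :: real)" using exp_of_nat_mult[of 10 "1 / 10 :: real"] by simp
  have "inverse (2 ^ 32) = (1 / 4294967296 :: real)" by simp
  note d = e_approx_32[unfolded this]
  have e1: "exp 1 \<ge> (271828 / 100000 :: real)" using abs_le_D2[OF d] by linarith
  have e2: "exp 1 \<le> (271829 / 100000 :: real)" using abs_le_D1[OF d] by linarith
  show "exp (1 / 10) \<ge> (1105170 / 1000000 :: real)"
  proof (rule power_le_imp_le_base)
    have "(1105170 / 1000000 :: real) ^ Suc 9 \<le> 271828 / 100000" by (simp add: power_divide)
    thus "(1105170 / 1000000 :: real) ^ Suc 9 \<le> exp (1 / 10) ^ Suc 9" using e e1 by simp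
  qed simp
  show "exp (1 / 10) \<le> (1105172 / 1000000 :: real)"
  proof (rule power_le_imp_le_base)
    have "(1105172 / 1000000 :: real) ^ Suc 9 \<ge> 271829 / 100000" by (simp add: power_divide)
    thus "exp (1 / 10) ^ Suc 9 \<le> (1105172 / 1000000 :: real) ^ Suc 9" using e e2 by simp
  qed simp
qed

lemma lam_bounds: "lam \<ge> 105082 / 100000" "lam \<le> 105085 / 100000"
proof -
  define r where "r = exp (1 / 10 :: real)"
  have r: "1105170 / 1000000 \<le> r" "r \<le> 1105172 / 1000000" using exp_tenth_bounds by (auto simp: r_def)
  have "lam = 1 / 10 + 1 / (10 * (r - 1))"
    using r unfolding lam_def r_def exp_minus by (simp add: field_simps)
  moreover have "1 / (10 * (r - 1)) \<le> 1 / (10 * (1105170 / 1000000 - 1))"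
      "1 / (10 * (1105172 / 1000000 - 1)) \<le> 1 / (10 * (r - 1))"
    using r by (intro divide_left_mono mult_left_mono diff_right_mono mult_pos_pos; simp)+
  ultimately show "lam \<ge> 105082 / 100000" "lam \<le> 105085 / 100000" by simp_all
qed

text \<open>
  The cut-off exp(18.2), about 8.02 * 10^7. The final comparison is most favourable where the
  logarithms of all primes below the cut-off add up to about 36 * 10^6 * ln 10, which happens near
  this point.
\<close>

definition xtop :: real where "xtop = knot 122"

lemma ln_xtop: "ln xtop = 182 / 10" by (simp add: xtop_def knot_ln_def)

lemma xtop_ge: "xtop \<ge> 80190000"
proof -
  \<comment> \<open>18.2 = 18 + 2/10, so that bounds for exp 1 and exp (1/10) suffice\<close>
  have "xtop = exp (1 / 10) ^ 182"
    using exp_of_nat_mult[of 182 "1 / 10 :: real"] by (simp add: xtop_def knot_def knot_ln_def)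
  also have "\<dots> = (exp (1 / 10) ^ 10) ^ 18 * exp (1 / 10) ^ 2" by (simp flip: power_mult power_add)
  also have "exp (1 / 10) ^ 10 = (exp 1 :: real)" using exp_of_nat_mult[of 10 "1 / 10 :: real"] by simp
  finally have x: "xtop = exp 1 ^ 18 * exp (1 / 10) ^ 2" .
  have "inverse (2 ^ 32) = (1 / 4294967296 :: real)" by simp
  note d = e_approx_32[unfolded this]
  have e1: "exp 1 \<ge> (271828 / 100000 :: real)" using abs_le_D2[OF d] by linarith
  have "(271828 / 100000) ^ 18 * (1105170 / 1000000) ^ 2 \<le> exp 1 ^ 18 * exp (1 / 10 :: real) ^ 2"
    using e1 exp_tenth_bounds(1) by (intro mult_mono power_mono) auto
  moreover have "80190000 \<le> (271828 / 100000) ^ 18 * (1105170 / 1000000 :: real) ^ 2"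
    by (simp add: power_divide)
  ultimately show ?thesis unfolding x by linarith
qed

lemma knot_floor_0: "knot_floor 0 = 403"
proof -
  have "\<lfloor>knot 0\<rfloor> = 403" using knot_0_bounds by (intro floor_unique) auto
  thus ?thesis by (simp add: knot_floor_def)
qed

lemma inv_mul_ln_prime_power:
  assumes "prime p" "j > 0"
  shows "ln (real p) * inv_mul_ln (real (p ^ j)) = 1 / (real j * real p ^ j)"
proof -
  have "ln (real p) > 0" "real p > 0" using prime_gt_1_nat[OF assms(1)] by auto
  thus ?thesis using assms by (simp add: inv_mul_ln_def ln_realpow)
qed

lemma sum_recip_powers:
  fixes x :: real
  assumes x: "x > 1"
  shows "(\<Sum>j=1..n. 1 / x ^ j) = (1 - 1 / x ^ n) / (x - 1)"
proof (induction n)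
  case (Suc n)
  have "(1 - 1 / q) / (x - 1) + 1 / (x * q) = (1 - 1 / (x * q)) / (x - 1)" if "q > 0" for q :: real
    using that x by (simp add: field_simps)
  from this[of "x ^ n"] show ?case using x Suc by simp
qed simp

text \<open>
  Up to 403 the reciprocals are summed directly. Beyond that the sum over Lambda is bounded by the
  chord estimate, from which the proper prime powers are subtracted; the negative contribution of
  the lowest knot is bounded below by the tabulated logarithms. The constant must stay below 3.1098,
  so that all parts have to be accurate to a few units of 10^-5.
\<close>

lemma prime_recip_sum_bound:
  "(\<Sum>p | prime p \<and> real p \<le> xtop. 1 / real p - ln (real p) * inv_mul_ln xtop) \<le> 310967 / 100000"
proof -
  define X where "X = knot_floor 122"
  define g g0 where "g = inv_mul_ln xtop" and "g0 = inv_mul_ln (knot 0)"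
  define S1 S2 where "S1 = {p::nat. prime p \<and> p \<le> 403}" and "S2 = {p. prime p \<and> 403 < p \<and> p \<le> X}"
  have fin: "finite S1" "finite S2"
    unfolding S1_def S2_def by simp_all
  have x: "xtop \<ge> 80190000" by (rule xtop_ge)
  have X: "n \<le> X \<longleftrightarrow> real n \<le> xtop" for n
  proof -
    have "\<lfloor>xtop\<rfloor> \<ge> 0" using x by simp
    hence "n \<le> X \<longleftrightarrow> int n \<le> \<lfloor>xtop\<rfloor>" unfolding X_def knot_floor_def xtop_def[symmetric] by (rule le_nat_iff)
    thus ?thesis by (simp only: le_floor_iff of_int_of_nat_eq)
  qed
  have g: "0 < g" "g \<le> 7 / 10 ^ 10"
  proof -
    have "g = 1 / (xtop * (182 / 10))" by (simp only: g_def inv_mul_ln_def ln_xtop)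
    moreover have "1 / (xtop * (182 / 10)) \<le> 1 / (80190000 * (182 / 10))"
      using x by (intro divide_left_mono mult_right_mono mult_pos_pos) auto
    moreover have "1 / (xtop * (182 / 10)) > 0" using x by (intro divide_pos_pos mult_pos_pos) auto
    ultimately have "0 < g" "g \<le> 1 / (80190000 * (182 / 10))" by simp_all
    moreover have "1 / (80190000 * (182 / 10)) \<le> (7 / 10 ^ 10 :: real)" by simp
    ultimately show "0 < g" "g \<le> 7 / 10 ^ 10" by linarith+
  qed
  have "403 \<le> X" unfolding X using x by simp
  hence "{p. prime p \<and> real p \<le> xtop} = S1 \<union> S2"
    unfolding S1_def S2_def X[symmetric] by auto
  moreover have "S1 \<inter> S2 = {}" unfolding S1_def S2_def by auto
  ultimately have F: "(\<Sum>p | prime p \<and> real p \<le> xtop. 1 / real p - ln (real p) * g) =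
      (\<Sum>p\<in>S1. 1 / real p - ln (real p) * g) + (\<Sum>p\<in>S2. 1 / real p - ln (real p) * g)"
    using fin by (simp add: sum.union_disjoint)
  define f where "f = (\<lambda>n. inv_mul_ln (real n) - g)"
  have lnf: "ln (real p) * f (p ^ j) = 1 / (real j * real p ^ j) - ln (real p) * g" if "prime p" "j > 0" for p j
    using inv_mul_ln_prime_power[OF that] by (simp add: f_def right_diff_distrib)
  \<comment> \<open>all proper powers above 403 of the small primes, and the large primes themselves\<close>
  define J where "J = (\<lambda>p. if p \<le> 403 then {Suc (low_exp (int p))..high_exp (int p)} else {1})"
  have "(\<Sum>p\<in>S1 \<union> S2. \<Sum>j\<in>J p. ln (real p) * f (p ^ j)) \<le> (\<Sum>n\<in>{Suc 403..X}. mangoldt n * f n)"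
  proof (rule sum_mangoldt_ge_prime_powers)
    fix p j assume p: "p \<in> S1 \<union> S2" and j: "j \<in> J p"
    show "j > 0 \<and> p ^ j \<in> {Suc 403..X}"
    proof (cases "p \<le> 403")
      case True
      hence pp: "prime p" using p by (auto simp: S1_def S2_def)
      hence "p \<ge> 1" using prime_ge_1_nat[of p] by simp
      have j': "Suc (low_exp (int p)) \<le> j" "j \<le> high_exp (int p)" using j True by (auto simp: J_def)
      have "404 \<le> p ^ Suc (low_exp (int p))" using small_prime_exps(2)[OF pp True] .
      also have "\<dots> \<le> p ^ j" using j' \<open>p \<ge> 1\<close> by (intro power_increasing) auto
      finally have lo: "404 \<le> p ^ j" .
      have "p ^ j \<le> p ^ high_exp (int p)" using j' \<open>p \<ge> 1\<close> by (intro power_increasing) auto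
      also have "\<dots> \<le> 10 ^ 7" using small_prime_exps(3)[OF pp True] .
      also have "\<dots> \<le> X" unfolding X using x by simp
      finally show ?thesis using lo j' by simp
    next
      case False
      thus ?thesis using p j by (auto simp: J_def S1_def S2_def)
    qed
  next
    fix n assume n: "n \<in> {Suc 403..X}"
    have "real n \<le> xtop" using n X by simp
    hence "real n * ln (real n) \<le> xtop * ln xtop" using n x by (intro mult_mono) auto
    hence "inv_mul_ln (real n) \<ge> g" unfolding g_def inv_mul_ln_def using n x by (intro divide_left_mono mult_pos_pos) (auto simp: ln_xtop)
    thus "f n \<ge> 0" by (simp add: f_def)
  qed (use fin in \<open>auto simp: S1_def S2_def J_def\<close>)
  also have "(\<Sum>n\<in>{Suc 403..X}. mangoldt n * f n) = weighted_psi 122"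
    by (simp add: weighted_psi_def X_def f_def g_def xtop_def knot_floor_0)
  also have "(\<Sum>p\<in>S1 \<union> S2. \<Sum>j\<in>J p. ln (real p) * f (p ^ j)) =
      (\<Sum>p\<in>S1. \<Sum>j\<in>J p. ln (real p) * f (p ^ j)) + (\<Sum>p\<in>S2. \<Sum>j\<in>J p. ln (real p) * f (p ^ j))"
    using fin \<open>S1 \<inter> S2 = {}\<close> by (intro sum.union_disjoint) auto
  also have "(\<Sum>p\<in>S2. \<Sum>j\<in>J p. ln (real p) * f (p ^ j)) = (\<Sum>p\<in>S2. 1 / real p - ln (real p) * g)"
  proof (intro sum.cong refl)
    fix p assume "p \<in> S2"
    thus "(\<Sum>j\<in>J p. ln (real p) * f (p ^ j)) = 1 / real p - ln (real p) * g"
      using lnf[of p 1] by (simp add: J_def S2_def)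
  qed
  finally have S2: "(\<Sum>p\<in>S2. 1 / real p - ln (real p) * g) \<le>
      weighted_psi 122 - (\<Sum>p\<in>S1. \<Sum>j\<in>J p. ln (real p) * f (p ^ j))" by simp
  have high: "(\<Sum>p\<in>S1. \<Sum>j\<in>J p. ln (real p) * f (p ^ j)) \<ge> 693 / 100000"
  proof -
    have "693 / 100000 \<le> (\<Sum>t\<leftarrow>log_table. \<Sum>j\<leftarrow>[int (Suc (low_exp (fst t)))..int (high_exp (fst t))].
        1 / (real_of_int j * real_of_int (fst t) ^ nat j) - 1 / 10 ^ 8)"
      using high_power_recip_sum by simp
    also have "\<dots> = (\<Sum>p\<in>S1. \<Sum>j\<leftarrow>[int (Suc (low_exp (int p)))..int (high_exp (int p))].
        1 / (real_of_int j * real_of_int (int p) ^ nat j) - 1 / 10 ^ 8)"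
      unfolding S1_def by (rule sum_small_primes[symmetric])
    also have "\<dots> \<le> (\<Sum>p\<in>S1. \<Sum>j\<in>J p. ln (real p) * f (p ^ j))"
    proof (rule sum_mono)
      fix p assume p: "p \<in> S1"
      hence pp: "prime p" "p \<le> 403" by (auto simp: S1_def)
      have "(\<Sum>j\<leftarrow>[int (Suc (low_exp (int p)))..int (high_exp (int p))]. 1 / (real_of_int j * real_of_int (int p) ^ nat j) - 1 / 10 ^ 8)
          = (\<Sum>j\<in>{int (Suc (low_exp (int p)))..int (high_exp (int p))}. 1 / (real_of_int j * real_of_int (int p) ^ nat j) - 1 / 10 ^ 8)"
        unfolding set_upto[symmetric] by (rule sum_list_distinct_conv_sum_set) (rule distinct_upto)
      also have "\<dots> = (\<Sum>j\<in>J p. 1 / (real j * real p ^ j) - 1 / 10 ^ 8)"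
        using pp by (intro sum.reindex_bij_witness[of _ int nat]) (auto simp: J_def)
      also have "\<dots> \<le> (\<Sum>j\<in>J p. ln (real p) * f (p ^ j))"
      proof (rule sum_mono)
        fix j assume "j \<in> J p"
        hence j: "j > 0" using pp by (auto simp: J_def)
        have "ln (real p) * g \<le> 10 * (7 / 10 ^ 10)"
        proof (intro mult_mono)
          have "(2::real) ^ 10 \<le> exp 1 ^ 10" using exp_1_bounds(1) by (intro power_mono) auto
          also have "exp 1 ^ 10 = exp (10::real)" using exp_of_nat_mult[of 10 "1::real"] by simp
          finally have "real p \<le> exp 10" using pp by simp
          hence "ln (real p) \<le> ln (exp 10)" using prime_gt_0_nat[OF pp(1)] by (subst ln_le_cancel_iff) auto
          thus "ln (real p) \<le> 10" by simp
        qed (use g in auto)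
        thus "1 / (real j * real p ^ j) - 1 / 10 ^ 8 \<le> ln (real p) * f (p ^ j)"
          unfolding lnf[OF pp(1) j] by simp
      qed
      finally show "(\<Sum>j\<leftarrow>[int (Suc (low_exp (int p)))..int (high_exp (int p))]. 1 / (real_of_int j * real_of_int (int p) ^ nat j) - 1 / 10 ^ 8)
          \<le> (\<Sum>j\<in>J p. ln (real p) * f (p ^ j))" .
    qed
    finally show ?thesis .
  qed
  have low: "(\<Sum>p\<in>S1. 1 / real p - ln (real p) * g) \<le> 206128 / 100000"
  proof -
    have "(\<Sum>p\<in>S1. 1 / real p - ln (real p) * g) \<le> (\<Sum>p\<in>S1. 1 / real_of_int (int p))"
    proof (rule sum_mono)
      fix p assume "p \<in> S1"
      hence "p \<ge> 1" using prime_ge_1_nat[of p] by (simp add: S1_def)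
      hence "ln (real p) * g \<ge> 0" using g by simp
      thus "1 / real p - ln (real p) * g \<le> 1 / real_of_int (int p)" by simp
    qed
    also have "\<dots> = (\<Sum>t\<leftarrow>log_table. 1 / real_of_int (fst t))" unfolding S1_def by (rule sum_small_primes)
    also have "\<dots> \<le> 206128 / 100000" using small_prime_recip_sum by simp
    finally show ?thesis .
  qed
  define s0 t0 where "s0 = chord_slope 0" and "t0 = knot 0"
  have t0: "40335 / 100 \<le> t0" "t0 \<le> 40346 / 100" using knot_0_bounds by (auto simp: t0_def)
  have s0_eq: "s0 = 10 / 61 + lam * (10 / 366)" by (simp add: s0_def chord_slope_def knot_ln_def)
  have s0: "192644 / 1000000 \<le> s0" "s0 \<le> 192647 / 1000000"
    unfolding s0_eq using lam_bounds by (simp_all add: field_simps)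
  have g0: "g0 = (1 / 6) * (1 / t0)" by (simp add: g0_def inv_mul_ln_def t0_def knot_ln_def)
  define r where "r = 1 / t0"
  have r: "100 / 40346 \<le> r" "r \<le> 100 / 40335" unfolding r_def using t0 by (auto simp: field_simps)
  \<comment> \<open>the lowest knot contributes Lambda(n) (s0/n - B) for each n up to 403\<close>
  define B where "B = s0 * r - g0 + g"
  have "s0 * r \<le> 192647 / 1000000 * (100 / 40335)" using s0 r by (intro mult_mono) auto
  hence B: "B \<le> 6456 / 10 ^ 8" unfolding B_def g0 r_def[symmetric] using r g by simp
  define V where "V = (\<Sum>n=1..403. mangoldt n * (s0 * (1 / real n) - B))"
  have V_eq: "s0 * mangoldt_mean t0 + cheb_psi 403 * (g0 - g) = V"
  proof -
    have "nat \<lfloor>t0\<rfloor> = 403" using knot_floor_0 by (simp add: knot_floor_def t0_def)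
    thus ?thesis unfolding mangoldt_mean_def cheb_psi_def V_def B_def r_def
      by (simp add: sum_distrib_left sum_distrib_right flip: sum.distrib) (simp add: algebra_simps)
  qed
  have Bpos: "B \<ge> 0"
  proof -
    have "192644 / 1000000 * r \<le> s0 * r" using s0 r by (intro mult_right_mono) auto
    thus ?thesis unfolding B_def g0 r_def[symmetric] using r g by linarith
  qed
  have nonneg: "s0 * (1 / real n) - B \<ge> 0" if "n \<in> {1..403}" for n
  proof -
    have "1 / real n \<ge> 1 / 403" using that by (intro divide_left_mono) auto
    hence "s0 * (1 / real n) \<ge> 192644 / 1000000 * (1 / 403)" using s0 by (intro mult_mono) auto
    thus ?thesis using B by simp
  qed
  define G where "G = (\<lambda>x::int. (1 - 1 / real_of_int x ^ low_exp x) / (real_of_int x - 1))"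
  have "(\<Sum>p\<in>S1. \<Sum>j\<in>{1..low_exp (int p)}. ln (real p) * (s0 * (1 / real (p ^ j)) - B)) \<le> V"
    unfolding V_def
  proof (rule sum_mangoldt_ge_prime_powers[where f = "\<lambda>n. s0 * (1 / real n) - B"])
    fix p j assume p: "p \<in> S1" and j: "j \<in> {1..low_exp (int p)}"
    hence pp: "prime p" "p \<le> 403" by (auto simp: S1_def)
    hence "p \<ge> 1" using prime_ge_1_nat[of p] by simp
    have "p ^ j \<le> p ^ low_exp (int p)" using j \<open>p \<ge> 1\<close> by (intro power_increasing) auto
    also have "\<dots> \<le> 403" using small_prime_exps(1)[OF pp] .
    finally show "j > 0 \<and> p ^ j \<in> {1..403}" using j \<open>p \<ge> 1\<close> by simp
  qed (use fin nonneg in \<open>auto simp: S1_def\<close>)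
  also have "(\<Sum>p\<in>S1. \<Sum>j\<in>{1..low_exp (int p)}. ln (real p) * (s0 * (1 / real (p ^ j)) - B)) =
      (\<Sum>p\<in>S1. ln (real_of_int (int p)) * (s0 * G (int p) - B * real (low_exp (int p))))"
  proof (intro sum.cong refl)
    fix p assume "p \<in> S1"
    hence p: "real p > 1" using prime_gt_1_nat[of p] by (simp add: S1_def)
    note geo = sum_recip_powers[OF p]
    have "(\<Sum>j\<in>{1..low_exp (int p)}. ln (real p) * (s0 * (1 / real (p ^ j)) - B)) =
        ln (real p) * (s0 * (\<Sum>j=1..low_exp (int p). 1 / real p ^ j) - B * real (low_exp (int p)))"
      by (simp add: sum_distrib_left sum_subtractf right_diff_distrib mult_ac)
    thus "(\<Sum>j\<in>{1..low_exp (int p)}. ln (real p) * (s0 * (1 / real (p ^ j)) - B)) =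
        ln (real_of_int (int p)) * (s0 * G (int p) - B * real (low_exp (int p)))"
      unfolding geo G_def by simp
  qed
  also have "\<dots> = (\<Sum>t\<leftarrow>log_table. ln (real_of_int (fst t)) * (s0 * G (fst t) - B * real (low_exp (fst t))))"
    unfolding S1_def by (rule sum_small_primes)
  finally have V1: "(\<Sum>t\<leftarrow>log_table. ln (real_of_int (fst t)) * (s0 * G (fst t) - B * real (low_exp (fst t)))) \<le> V" .
  have "(\<Sum>t\<leftarrow>log_table. ln_low t * (s0 * G (fst t) - B * real (low_exp (fst t)))) \<le>
      (\<Sum>t\<leftarrow>log_table. ln (real_of_int (fst t)) * (s0 * G (fst t) - B * real (low_exp (fst t))))"
  proof (intro sum_list_mono mult_right_mono ln_low_le)
    fix t assume t: "t \<in> set log_table"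
    hence m: "fst t \<in> set (map fst log_table)" by simp
    have ft: "fst t = int (nat (fst t))" using fst_log_table_ge[OF m] by simp
    define p where "p = nat (fst t)"
    have fp: "fst t = int p" using ft by (simp add: p_def)
    have pp: "prime p" "p \<le> 403" using m fst_log_table_iff[of p] unfolding fp by auto
    have p: "real p > 1" using pp prime_gt_1_nat[of p] by simp
    have "s0 * (1 / real (p ^ j)) - B \<ge> 0" if "j \<in> {1..low_exp (int p)}" for j
    proof (rule nonneg)
      have "p ^ j \<le> p ^ low_exp (int p)" using that p by (intro power_increasing) auto
      also have "\<dots> \<le> 403" using small_prime_exps(1)[OF pp] .
      finally show "p ^ j \<in> {1..403}" using p by (simp add: Suc_le_eq)
    qed
    hence "0 \<le> (\<Sum>j\<in>{1..low_exp (int p)}. s0 * (1 / real (p ^ j)) - B)" by (rule sum_nonneg)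
    also have "\<dots> = s0 * (\<Sum>j=1..low_exp (int p). 1 / real p ^ j) - B * real (low_exp (int p))"
      by (simp add: sum_distrib_left sum_subtractf)
    also have "(\<Sum>j=1..low_exp (int p). 1 / real p ^ j) = G (int p)"
    proof -
      note sum_recip_powers[OF p]
      thus ?thesis by (simp add: G_def)
    qed
    finally show "0 \<le> s0 * G (fst t) - B * real (low_exp (fst t))" unfolding fp .
  qed
  also note V1
  also have "(\<Sum>t\<leftarrow>log_table. ln_low t * (s0 * G (fst t) - B * real (low_exp (fst t)))) =
      s0 * (\<Sum>t\<leftarrow>log_table. ln_low t * G (fst t)) - B * (\<Sum>t\<leftarrow>log_table. ln_low t * real (low_exp (fst t)))"
  proof -
    have "(\<Sum>t\<leftarrow>L. a t * (s0 * b t - B * c t)) = s0 * (\<Sum>t\<leftarrow>L. a t * b t) - B * (\<Sum>t\<leftarrow>L. a t * c t)"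
      for L :: "'a list" and a b c by (induction L) (simp_all add: algebra_simps)
    thus ?thesis .
  qed
  finally have V2: "s0 * (\<Sum>t\<leftarrow>log_table. ln_low t * G (fst t)) - B * (\<Sum>t\<leftarrow>log_table. ln_low t * real (low_exp (fst t))) \<le> V" .
  have "192644 / 1000000 * (54281 / 10000) \<le> s0 * (\<Sum>t\<leftarrow>log_table. ln_low t * G (fst t))"
    using s0 low_power_log_sum unfolding G_def by (intro mult_mono) auto
  moreover have "B * (\<Sum>t\<leftarrow>log_table. ln_low t * real (low_exp (fst t))) \<le> 6456 / 10 ^ 8 * (403812 / 1000)"
  proof -
    have "B * (\<Sum>t\<leftarrow>log_table. ln_low t * real (low_exp (fst t))) \<le> B * (403812 / 1000)"
      using Bpos low_power_log_count by (intro mult_left_mono) auto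
    also have "\<dots> \<le> 6456 / 10 ^ 8 * (403812 / 1000)" using B by (intro mult_right_mono) auto
    finally show ?thesis .
  qed
  ultimately have V: "V \<ge> 192644 / 1000000 * (54281 / 10000) - 6456 / 10 ^ 8 * (403812 / 1000)"
    using V2 by linarith
  define H where "H = (\<Sum>i<122. 1 / (10 * knot_ln (Suc i)))"
  have mb: "mean_bound t0 \<le> 443494 / 100000"
    using r unfolding mean_bound_def by (simp add: t0_def r_def knot_ln_def)
  have "weighted_psi 122 \<le> 100001 / 100000 * (H + lam * (1 / 6 - 1 / knot_ln 122))
     + s0 * (mean_bound t0 - mangoldt_mean t0) - (2464 / 1000 + cheb_psi 403) * (g0 - g)"
    using weighted_psi_bound[of 122] unfolding knot_floor_0 H_def s0_def t0_def g0_def g_def xtop_def .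
  also have "\<dots> = 100001 / 100000 * (H + lam * (1 / 6 - 1 / knot_ln 122)) + s0 * mean_bound t0 - 2464 / 1000 * (g0 - g) - V"
    unfolding V_eq[symmetric] by (simp add: algebra_simps)
  finally have W: "weighted_psi 122 \<le>
      100001 / 100000 * (H + lam * (1 / 6 - 1 / knot_ln 122)) + s0 * mean_bound t0 - 2464 / 1000 * (g0 - g) - V" .
  have "lam * (1 / 6 - 1 / knot_ln 122) \<le> 105085 / 100000 * (1 / 6 - 10 / 182)"
    using lam_bounds by (intro mult_mono) (auto simp: knot_ln_def)
  hence W1: "100001 / 100000 * (H + lam * (1 / 6 - 1 / knot_ln 122)) \<le>
      100001 / 100000 * (110410 / 100000 + 105085 / 100000 * (1 / 6 - 10 / 182))"
    using harmonic_piece unfolding H_def by (intro mult_left_mono add_mono) auto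
  have W2: "s0 * mean_bound t0 \<le> 192647 / 1000000 * (443494 / 100000)"
  proof -
    have "s0 * mean_bound t0 \<le> s0 * (443494 / 100000)" using s0 mb by (intro mult_left_mono) auto
    also have "\<dots> \<le> 192647 / 1000000 * (443494 / 100000)" using s0 by (intro mult_right_mono) auto
    finally show ?thesis .
  qed
  have W3: "2464 / 1000 * (g0 - g) \<ge> 2464 / 1000 * (1 / 6 * (100 / 40346) - 7 / 10 ^ 10)"
    unfolding g0 r_def[symmetric] using r g by (intro mult_left_mono diff_mono) auto
  have "(\<Sum>p | prime p \<and> real p \<le> xtop. 1 / real p - ln (real p) * g) \<le> 206128 / 100000 +
     (100001 / 100000 * (110410 / 100000 + 105085 / 100000 * (1 / 6 - 10 / 182)) + 192647 / 1000000 * (443494 / 100000)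
      - 2464 / 1000 * (1 / 6 * (100 / 40346) - 7 / 10 ^ 10)
      - (192644 / 1000000 * (54281 / 10000) - 6456 / 10 ^ 8 * (403812 / 1000)) - 693 / 100000)"
    using F low S2 high W W1 W2 W3 V by linarith
  also have "\<dots> \<le> 310967 / 100000" by simp
  finally show ?thesis by (simp only: g_def)
qed

section \<open>Power sums modulo prime powers\<close>

definition power_sum :: "nat \<Rightarrow> nat \<Rightarrow> int" where
  "power_sum k n = (\<Sum>j<n. int j ^ k)"

lemma sum_lessThan_split: "(\<Sum>j<m + a. f j) = (\<Sum>j<m. f j) + (\<Sum>u<a. f (m + u))"
  for f :: "nat \<Rightarrow> int"
  by (induction a) (simp_all add: add.assoc)

lemma sum_lessThan_blocks: "(\<Sum>j<a * b. f j) = (\<Sum>v<b. \<Sum>u<a. f (a * v + u))" for f :: "nat \<Rightarrow> int"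
proof (induction b)
  case (Suc b)
  have "(\<Sum>j<a * Suc b. f j) = (\<Sum>j<a * b + a. f j)" by (simp add: add.commute)
  thus ?case using Suc by (simp add: sum_lessThan_split)
qed simp

text \<open>
  The binomial theorem truncated after the linear term.
\<close>

lemma power_add_cong_square:
  fixes x y :: int
  shows "[(y + x) ^ k = x ^ k + int k * x ^ (k - 1) * y] (mod y\<^sup>2)"
proof (induction k)
  case (Suc k)
  have "[(y + x) * (y + x) ^ k = (y + x) * (x ^ k + int k * x ^ (k - 1) * y)] (mod y\<^sup>2)"
    by (rule cong_mult[OF cong_refl Suc])
  also have "(y + x) * (x ^ k + int k * x ^ (k - 1) * y) =
      x ^ Suc k + int (Suc k) * x ^ k * y + y\<^sup>2 * (int k * x ^ (k - 1))"
    by (cases k) (simp_all add: algebra_simps power2_eq_square)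
  also have "[\<dots> = x ^ Suc k + int (Suc k) * x ^ k * y] (mod y\<^sup>2)"
    by (simp add: cong_def)
  finally show ?case by simp
qed simp

text \<open>
  Write j = n v + u. The linear terms contribute k n times the sum of v, and since k is even, the
  factor 2 needed to evaluate the sum of v is available, which yields the extra factor q even for q
  = 2.
\<close>

lemma power_sum_block:
  assumes "even k"
  shows "\<exists>c. [power_sum k (n * q) = int q * power_sum k n + int n * int q * c] (mod (int n)\<^sup>2)"
proof -
  obtain h where h: "k = 2 * h" using assms by (elim evenE)
  define T where "T = (\<Sum>u<n. int u ^ (k - 1))"
  have g: "2 * (\<Sum>v<r. int v) = int r * (int r - 1)" for r by (induction r) (simp_all add: algebra_simps)
  have "power_sum k (n * q) = (\<Sum>v<q. \<Sum>u<n. (int n * int v + int u) ^ k)"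
    unfolding power_sum_def sum_lessThan_blocks by simp
  also have "[\<dots> = (\<Sum>v<q. \<Sum>u<n. int u ^ k + int k * int u ^ (k - 1) * (int n * int v))] (mod (int n)\<^sup>2)"
  proof (intro cong_sum)
    fix v u
    have "[(int n * int v + int u) ^ k = int u ^ k + int k * int u ^ (k - 1) * (int n * int v)] (mod (int n * int v)\<^sup>2)"
      by (rule power_add_cong_square)
    thus "[(int n * int v + int u) ^ k = int u ^ k + int k * int u ^ (k - 1) * (int n * int v)] (mod (int n)\<^sup>2)"
      by (rule cong_dvd_modulus) (simp add: power_mult_distrib)
  qed
  also have "(\<Sum>v<q. \<Sum>u<n. int u ^ k + int k * int u ^ (k - 1) * (int n * int v)) =
      int q * power_sum k n + int n * int k * T * (\<Sum>v<q. int v)"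
  proof -
    have "(\<Sum>u<n. int k * int u ^ (k - 1) * (int n * int v)) = int n * int k * T * int v" for v
      unfolding T_def sum_distrib_left sum_distrib_right by (intro sum.cong refl) (simp only: mult_ac)
    thus ?thesis by (simp add: sum.distrib power_sum_def sum_distrib_left)
  qed
  also have "int n * int k * T * (\<Sum>v<q. int v) = int n * int h * T * (2 * (\<Sum>v<q. int v))"
    by (simp add: h)
  also have "\<dots> = int n * int q * (int h * T * (int q - 1))" unfolding g by (simp add: mult_ac)
  finally show ?thesis by blast
qed

text \<open>
  Descending one power of q at a time: the error n n q c of one step is divisible by the required
  power of q.
\<close>

lemma power_sum_prime_power_cong:
  assumes k: "even k" and q: "prime q" and "e \<ge> 1" "q ^ e dvd n"
  shows "[power_sum k n = int (n div q) * power_sum k q] (mod int q ^ e)"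
  using assms(3,4)
proof (induction e arbitrary: n rule: nat_induct_at_least)
  case base
  then obtain r where n: "n = q * r" by auto
  have "power_sum k n = (\<Sum>v<r. \<Sum>u<q. (int q * int v + int u) ^ k)"
    unfolding power_sum_def n sum_lessThan_blocks by simp
  also have "[\<dots> = (\<Sum>v<r. \<Sum>u<q. int u ^ k)] (mod int q)"
    by (intro cong_sum cong_pow) (simp add: cong_def)
  also have "(\<Sum>v<r. \<Sum>u<q. int u ^ k) = int (n div q) * power_sum k q"
    using q by (simp add: power_sum_def n prime_gt_0_nat)
  finally show ?case by simp
next
  case (Suc e)
  obtain n' where n: "n = n' * q" and d: "q ^ e dvd n'"
  proof -
    from Suc.prems obtain r where "n = q ^ Suc e * r" by (elim dvdE)
    thus ?thesis by (intro that[of "q ^ e * r"]) auto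
  qed
  have "q > 0" using q by (rule prime_gt_0_nat)
  obtain c where c: "[power_sum k n = int q * power_sum k n' + int n' * int q * c] (mod (int n')\<^sup>2)"
    using power_sum_block[OF k, of n' q] unfolding n by blast
  have d': "int q ^ e dvd int n'" using d by (metis of_nat_dvd_iff of_nat_power)
  have "int q ^ Suc e dvd (int q ^ e)\<^sup>2"
    unfolding power_mult[symmetric] using Suc.hyps by (intro le_imp_power_dvd) auto
  also have "\<dots> dvd (int n')\<^sup>2" using d' by (rule dvd_power_same)
  finally have "[power_sum k n = int q * power_sum k n' + int n' * int q * c] (mod int q ^ Suc e)"
    using c cong_dvd_modulus by blast
  also have "[int q * power_sum k n' + int n' * int q * c = int q * power_sum k n' + 0] (mod int q ^ Suc e)"
  proof (intro cong_add cong_refl)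
    have "int q ^ Suc e dvd int n' * int q * c"
      using d' by (metis dvd_mult2 mult.commute mult_dvd_mono dvd_refl power_Suc)
    thus "[int n' * int q * c = 0] (mod int q ^ Suc e)" by (simp add: cong_0_iff)
  qed
  also have "[int q * power_sum k n' + 0 = int q * (int (n' div q) * power_sum k q)] (mod int q ^ Suc e)"
    using Suc.IH[OF d] unfolding cong_iff_dvd_diff by (simp add: right_diff_distrib[symmetric] mult_dvd_mono)
  also have "int q * (int (n' div q) * power_sum k q) = int (n div q) * power_sum k q"
  proof -
    have "q dvd n'" using d Suc.hyps by (metis dvd_power dvd_trans less_le_trans zero_less_one)
    hence "q * (n' div q) = n div q" using \<open>q > 0\<close> by (simp add: n)
    thus ?thesis by (metis mult.assoc of_nat_mult)
  qed
  finally show ?case .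
qed

lemma power_sum_prime_cong_minus1:
  assumes q: "prime q" and d: "(q - 1) dvd k" and k: "k > 0"
  shows "[power_sum k q = -1] (mod int q)"
proof -
  have "q \<ge> 1" using prime_ge_1_nat[OF q] .
  have "power_sum k q = (\<Sum>j\<in>{1..<q}. int j ^ k)"
    unfolding power_sum_def using k by (intro sum.mono_neutral_right) auto
  also have "[\<dots> = (\<Sum>j\<in>{1..<q}. 1)] (mod int q)"
  proof (intro cong_sum)
    fix j assume j: "j \<in> {1..<q}"
    hence "\<not> q dvd j" by (auto dest: dvd_imp_le)
    hence "[j ^ (q - 1) = 1] (mod q)" using q by (intro fermat_theorem)
    moreover obtain r where "k = (q - 1) * r" using d by (elim dvdE)
    ultimately have "[j ^ k = 1] (mod q)" by (metis cong_pow power_mult power_one)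
    thus "[int j ^ k = 1] (mod int q)" by (metis cong_int_iff of_nat_1 of_nat_power)
  qed
  also have "(\<Sum>j\<in>{1..<q}. 1) = int q - 1" using \<open>q \<ge> 1\<close> by simp
  also have "[int q - 1 = -1] (mod int q)" by (simp add: cong_iff_dvd_diff)
  finally show ?thesis .
qed

text \<open>
  Multiplication by a primitive root g permutes the residues and multiplies the sum by g^k, which is
  not 1.
\<close>

lemma power_sum_prime_cong_0:
  assumes q: "prime q" and d: "\<not> (q - 1) dvd k"
  shows "[power_sum k q = 0] (mod int q)"
proof -
  obtain g where g: "residue_primroot q g" using prime_primitive_root_exists[of q] q prime_gt_1_nat[OF q] by blast
  hence cop: "coprime q g" and "ord q g = q - 1"
    using q by (auto simp: residue_primroot_def totient_prime)
  hence gk: "\<not> [g ^ k = 1] (mod q)" using d by (simp only: ord_divides \<open>ord q g = q - 1\<close> not_False_eq_True)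
  have inj: "inj_on (\<lambda>j. g * j mod q) {..<q}"
  proof (rule inj_onI)
    fix x y assume xy: "x \<in> {..<q}" "y \<in> {..<q}" "g * x mod q = g * y mod q"
    hence "[g * x = g * y] (mod q)" by (simp add: cong_def)
    hence "[x = y] (mod q)" using cop by (subst (asm) cong_mult_lcancel_nat) (auto simp: coprime_commute)
    thus "x = y" using xy by (simp add: cong_def)
  qed
  have "(\<lambda>j. g * j mod q) ` {..<q} = {..<q}"
    using inj prime_gt_0_nat[OF q] by (intro endo_inj_surj) auto
  hence bij: "bij_betw (\<lambda>j. g * j mod q) {..<q} {..<q}" using inj by (simp add: bij_betw_def)
  have "int g ^ k * power_sum k q = (\<Sum>j<q. int (g * j) ^ k)"
    by (simp add: power_sum_def sum_distrib_left power_mult_distrib)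
  also have "[\<dots> = (\<Sum>j<q. int (g * j mod q) ^ k)] (mod int q)"
    by (intro cong_sum cong_pow) (simp add: cong_def zmod_int)
  also have "(\<Sum>j<q. int (g * j mod q) ^ k) = power_sum k q"
    unfolding power_sum_def by (rule sum.reindex_bij_betw[OF bij])
  finally have "int q dvd (int g ^ k - 1) * power_sum k q"
    by (simp add: cong_iff_dvd_diff left_diff_distrib)
  moreover have "\<not> int q dvd int g ^ k - 1"
    using gk by (metis cong_iff_dvd_diff cong_int_iff of_nat_1 of_nat_power)
  moreover have "prime (int q)" using q by simp
  ultimately have "int q dvd power_sum k q" by (metis prime_dvd_mult_iff)
  thus ?thesis by (simp add: cong_0_iff)
qed

text \<open>
  The primes that occur in von Staudt's congruence for power sums of exponent k modulo n.
\<close>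

definition vs_primes :: "nat \<Rightarrow> nat \<Rightarrow> nat set" where
  "vs_primes k n = {q. prime q \<and> q dvd n \<and> (q - 1) dvd k}"

lemma finite_vs_primes: "n > 0 \<Longrightarrow> finite (vs_primes k n)"
  unfolding vs_primes_def by (rule finite_subset[of _ "{..n}"]) (auto dest: dvd_imp_le)

text \<open>
  Divisibility is tested at each prime power exactly dividing n: modulo q^e only the summand n/q
  survives, and it is cancelled by the power sum. The factor w allows for congruences that are only
  known after multiplication by a unit such as 2^k.
\<close>

lemma von_staudt_dvd:
  assumes k: "even k" "k > 0" and n: "n > 0"
    and cong: "[w * power_sum k n = int v] (mod int n)"
    and w: "\<And>q. q \<in> vs_primes k n \<Longrightarrow> [w = 1] (mod int q)"
  shows "n dvd (\<Sum>q\<in>vs_primes k n. n div q) + v"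
proof (cases "(\<Sum>q\<in>vs_primes k n. n div q) + v = 0")
  case False
  define N where "N = (\<Sum>q\<in>vs_primes k n. n div q) + v"
  have "multiplicity q n \<le> multiplicity q N" if q: "prime q" for q
  proof (cases "multiplicity q n = 0")
    case e: False
    define e where "e = multiplicity q n"
    have e1: "e \<ge> 1" using e by (simp add: e_def)
    have qe: "q ^ e dvd n" by (simp add: e_def multiplicity_dvd)
    have q0: "q > 0" using q by (rule prime_gt_0_nat)
    have qn: "q dvd n" using qe e1 by (metis dvd_power dvd_trans less_le_trans zero_less_one)
    have qe': "q ^ (e - 1) dvd n div q"
    proof -
      from qe obtain r where "n = q ^ e * r" by (elim dvdE)
      hence "n = q * (q ^ (e - 1) * r)" using e1 by (cases e) auto
      thus ?thesis using q0 by simp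
    qed
    have lift: "[int (n div q) * x = int (n div q) * y] (mod int q ^ e)" if "[x = y] (mod int q)" for x y
    proof -
      have "int q ^ (e - 1) * int q dvd int (n div q) * (x - y)"
        using qe' that by (intro mult_dvd_mono) (auto simp: cong_iff_dvd_diff of_nat_dvd_iff simp flip: of_nat_power)
      moreover have "int q ^ (e - 1) * int q = int q ^ e" using e1 by (cases e) auto
      ultimately show ?thesis by (simp add: cong_iff_dvd_diff right_diff_distrib)
    qed
    have "int q ^ e dvd int n" using qe by (metis of_nat_dvd_iff of_nat_power)
    hence v1: "[int v = w * power_sum k n] (mod int q ^ e)"
      using cong cong_dvd_modulus cong_sym by blast
    have v2: "[w * power_sum k n = w * (int (n div q) * power_sum k q)] (mod int q ^ e)"
      by (intro cong_mult cong_refl power_sum_prime_power_cong k q e1 qe)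
    have other: "q ^ e dvd n div r" if r: "r \<in> vs_primes k n" "r \<noteq> q" for r
    proof -
      have r': "prime r" "r dvd n" using r by (auto simp: vs_primes_def)
      have "coprime (q ^ e) r" using q r' r(2) by (simp add: primes_coprime)
      moreover have "q ^ e dvd r * (n div r)" using r' qe by simp
      ultimately show ?thesis by (simp add: coprime_dvd_mult_right_iff)
    qed
    have "int q ^ e dvd int N"
    proof (cases "q \<in> vs_primes k n")
      case True
      have "[w * (int (n div q) * power_sum k q) = int (n div q) * (w * power_sum k q)] (mod int q ^ e)"
        by (simp add: mult_ac)
      also have "[int (n div q) * (w * power_sum k q) = int (n div q) * (1 * -1)] (mod int q ^ e)"
        using True q k by (intro lift cong_mult w power_sum_prime_cong_minus1) (auto simp: vs_primes_def)
      finally have fin: "[w * (int (n div q) * power_sum k q) = int (n div q) * (1 * -1)] (mod int q ^ e)" .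
      from cong_trans[OF v1 cong_trans[OF v2 fin]] have "[int v = - int (n div q)] (mod int q ^ e)" by simp
      hence "int q ^ e dvd int v + int (n div q)" by (simp add: cong_iff_dvd_diff)
      hence "q ^ e dvd v + n div q" by (metis of_nat_add of_nat_dvd_iff of_nat_power)
      moreover have "q ^ e dvd (\<Sum>r\<in>vs_primes k n - {q}. n div r)" using other by (intro dvd_sum) auto
      moreover have "N = (\<Sum>r\<in>vs_primes k n - {q}. n div r) + (v + n div q)"
        unfolding N_def using sum.remove[OF finite_vs_primes[OF n] True, of "\<lambda>q. n div q"] by simp
      ultimately have "q ^ e dvd N" by simp
      thus ?thesis by (metis of_nat_dvd_iff of_nat_power)
    next
      case False
      hence nd: "\<not> (q - 1) dvd k" using q qn by (auto simp: vs_primes_def)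
      have fin: "[w * (int (n div q) * power_sum k q) = w * (int (n div q) * 0)] (mod int q ^ e)"
        using power_sum_prime_cong_0[OF q nd] by (intro cong_mult cong_refl lift)
      from cong_trans[OF v1 cong_trans[OF v2 fin]] have "[int v = 0] (mod int q ^ e)" by simp
      hence "q ^ e dvd v" by (metis cong_0_iff of_nat_dvd_iff of_nat_power)
      moreover have "q ^ e dvd (\<Sum>r\<in>vs_primes k n. n div r)" using other False by (intro dvd_sum) auto
      ultimately have "q ^ e dvd N" unfolding N_def by simp
      thus ?thesis by (metis of_nat_dvd_iff of_nat_power)
    qed
    hence "q ^ e dvd N" by (metis of_nat_dvd_iff of_nat_power)
    moreover have "N \<noteq> 0" using False by (simp only: N_def not_False_eq_True)
    ultimately show ?thesis unfolding e_def[symmetric] using q by (intro multiplicity_geI) auto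
  qed simp
  hence "n dvd N" using n by (intro multiplicity_le_imp_dvd) auto
  thus ?thesis by (simp only: N_def)
qed simp

text \<open>
  A positive multiple of n is at least n.
\<close>

lemma von_staudt_sum_ge:
  assumes k: "even k" "k > 0" and n: "n > 0" and v: "v > 0"
    and cong: "[w * power_sum k n = int v] (mod int n)"
    and w: "\<And>q. q \<in> vs_primes k n \<Longrightarrow> [w = 1] (mod int q)"
  shows "(\<Sum>q\<in>vs_primes k n. 1 / real q) \<ge> 1 - real v / real n"
proof -
  have "n \<le> (\<Sum>q\<in>vs_primes k n. n div q) + v"
    using von_staudt_dvd[OF k n cong w] v by (intro dvd_imp_le) auto
  hence "real n \<le> (\<Sum>q\<in>vs_primes k n. real (n div q)) + real v" by (metis of_nat_add of_nat_le_iff of_nat_sum)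
  also have "(\<Sum>q\<in>vs_primes k n. real (n div q)) = (\<Sum>q\<in>vs_primes k n. real n * (1 / real q))"
    by (intro sum.cong refl) (auto simp: vs_primes_def real_of_nat_div)
  also have "\<dots> = real n * (\<Sum>q\<in>vs_primes k n. 1 / real q)" by (simp add: sum_distrib_left)
  finally have "1 \<le> ((\<Sum>q\<in>vs_primes k n. 1 / real q) * real n + real v) / real n" using n by (simp add: mult.commute)
  also have "\<dots> = (\<Sum>q\<in>vs_primes k n. 1 / real q) + real v / real n" using n by (simp add: add_divide_distrib)
  finally show ?thesis by simp
qed

section \<open>Moser's four congruences\<close>

lemma power_sum_Suc: "power_sum k (Suc n) = power_sum k n + int n ^ k"
  by (simp add: power_sum_def)

text \<open>
  Bernoulli's inequality in the form (j+1)^(k+1) - j^(k+1) \<ge> (k+1) j^k, summed over j.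
\<close>

lemma power_sum_less:
  assumes "k > 0" "m > 0"
  shows "int (k + 1) * power_sum k m < int m ^ (k + 1)"
proof -
  have bern: "int j ^ Suc k + int (Suc k) * int j ^ k \<le> int (Suc j) ^ Suc k" for j
  proof (induction k)
    case (Suc k)
    have "int j ^ Suc (Suc k) + int (Suc (Suc k)) * int j ^ Suc k \<le>
        (int j ^ Suc k + int (Suc k) * int j ^ k) * int (Suc j)"
      by (simp add: algebra_simps)
    also have "\<dots> \<le> int (Suc j) ^ Suc k * int (Suc j)" using Suc by (intro mult_right_mono) auto
    finally show ?case by (simp add: mult_ac)
  qed simp
  have "m \<ge> 1" using assms by simp
  thus ?thesis
  proof (induction m rule: nat_induct_at_least)
    case base
    show ?case using assms by (simp add: power_sum_def zero_power)
  next
    case (Suc m)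
    have "int (k + 1) * power_sum k (Suc m) < int m ^ Suc k + int (Suc k) * int m ^ k"
      using Suc.IH by (simp add: power_sum_Suc distrib_left)
    also note bern[of m]
    finally show ?case by simp
  qed
qed

text \<open>
  Pair j with m - 1 - j; for odd k the two powers cancel modulo m - 1.
\<close>

lemma power_sum_odd_dvd:
  assumes "odd k" "m > 0"
  shows "int (m - 1) dvd 2 * power_sum k m"
proof -
  have "(\<Sum>j<m. int (m - Suc j) ^ k) = power_sum k m"
    unfolding power_sum_def by (rule sum.nat_diff_reindex)
  hence "2 * power_sum k m = (\<Sum>j<m. int j ^ k + int (m - Suc j) ^ k)"
    by (simp add: sum.distrib power_sum_def)
  also have "int (m - 1) dvd \<dots>"
  proof (intro dvd_sum)
    fix j assume "j \<in> {..<m}"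
    hence "int (m - Suc j) = int (m - 1) - int j" by auto
    hence "[int (m - Suc j) ^ k = (- int j) ^ k] (mod int (m - 1))"
      by (intro cong_pow) (simp add: cong_iff_dvd_diff)
    moreover have "(- int j) ^ k = - (int j ^ k)" using assms by simp
    ultimately show "int (m - 1) dvd int j ^ k + int (m - Suc j) ^ k"
      by (simp add: cong_iff_dvd_diff add.commute)
  qed
  finally show ?thesis .
qed

text \<open>
  Pair j with 2 M + 1 - j; for even k both have the same k-th power modulo 2 M + 1.
\<close>

lemma power_sum_reflect:
  assumes "even k" "k > 0"
  shows "[power_sum k (2 * M + 1) = 2 * power_sum k (M + 1)] (mod int (2 * M + 1))"
proof -
  have "2 * M + 1 = (M + 1) + M" by simp
  hence "power_sum k (2 * M + 1) = (\<Sum>j<(M + 1) + M. int j ^ k)" by (simp only: power_sum_def)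
  also have "\<dots> = power_sum k (M + 1) + (\<Sum>u<M. int (M + 1 + u) ^ k)"
    unfolding sum_lessThan_split by (simp add: power_sum_def)
  also have "[\<dots> = power_sum k (M + 1) + (\<Sum>u<M. int (Suc (M - Suc u)) ^ k)] (mod int (2 * M + 1))"
  proof (intro cong_add cong_refl cong_sum)
    fix u assume "u \<in> {..<M}"
    hence "int (M + 1 + u) - - int (Suc (M - Suc u)) = int (2 * M + 1)" by auto
    hence "[int (M + 1 + u) = - int (Suc (M - Suc u))] (mod int (2 * M + 1))"
      unfolding cong_iff_dvd_diff by (simp only: dvd_refl)
    hence "[int (M + 1 + u) ^ k = (- int (Suc (M - Suc u))) ^ k] (mod int (2 * M + 1))" by (rule cong_pow)
    thus "[int (M + 1 + u) ^ k = int (Suc (M - Suc u)) ^ k] (mod int (2 * M + 1))"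
      using assms(1) by (simp only: power_minus_even)
  qed
  also have "(\<Sum>u<M. int (Suc (M - Suc u)) ^ k) = (\<Sum>u<M. int (Suc u) ^ k)"
    by (rule sum.nat_diff_reindex[where g = "\<lambda>u. int (Suc u) ^ k"])
  also have "\<dots> = power_sum k (M + 1)"
    using assms(2) by (simp add: power_sum_def sum.lessThan_Suc_shift del: sum.lessThan_Suc)
  finally show ?thesis by (simp only: mult_2)
qed

locale erdos_moser =
  fixes a m k :: nat
  assumes a: "a \<ge> 1" and m: "m \<ge> 2" and k: "k \<ge> 2" and eq: "power_sum k m = int a * int m ^ k"
begin

lemma mult_less: "(k + 1) * a < m"
proof -
  have "int (k + 1) * (int a * int m ^ k) < int m * int m ^ k"
    using power_sum_less[of k m] k m eq by simp
  hence "int (k + 1) * int a < int m" using m by (simp flip: mult.assoc)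
  thus ?thesis by (metis of_nat_less_iff of_nat_mult)
qed

text \<open>
  For odd k the number m - 1 divides 2 a m^k and hence 2 a, but 4 a < m.
\<close>

lemma even_k: "even k"
proof (rule ccontr)
  assume odd: "odd k"
  hence "k \<ge> 3" using k by (cases "k = 2") auto
  have "int (m - 1) dvd 2 * (int a * int m ^ k)" using power_sum_odd_dvd[OF odd, of m] m eq by simp
  moreover have "[2 * (int a * int m ^ k) = 2 * (int a * 1 ^ k)] (mod int (m - 1))"
    using m by (intro cong_mult cong_refl cong_pow) (simp add: cong_iff_dvd_diff)
  ultimately have "int (m - 1) dvd int (2 * a)" by (simp add: cong_dvd_iff)
  hence "m - 1 dvd 2 * a" by (simp only: of_nat_dvd_iff)
  hence "m - 1 \<le> 2 * a" using a by (intro dvd_imp_le) auto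
  moreover have "4 * a \<le> (k + 1) * a" using \<open>k \<ge> 3\<close> by (intro mult_right_mono) auto
  ultimately show False using mult_less a by linarith
qed

lemma k_pos: "k > 0" using k by simp

text \<open>
  Moser's trick: for the four moduli m - 1, m + 1, 2 m - 1 and 2 m + 1 the power sum is a simple
  multiple of m^k, and m or 2 m is 1 or -1 modulo n. For the last two moduli the congruence is
  multiplied by 2^k, which is 1 modulo every odd prime q with q - 1 dividing k.
\<close>

lemma four_sums:
  "(\<Sum>q\<in>vs_primes k (m - 1). 1 / real q) \<ge> 1 - real a / real (m - 1)"
  "(\<Sum>q\<in>vs_primes k (m + 1). 1 / real q) \<ge> 1 - real (a + 1) / real (m + 1)"
  "(\<Sum>q\<in>vs_primes k (2 * m - 1). 1 / real q) \<ge> 1 - real (2 * a) / real (2 * m - 1)"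
  "(\<Sum>q\<in>vs_primes k (2 * m + 1). 1 / real q) \<ge> 1 - real (2 * (a + 1)) / real (2 * m + 1)"
proof -
  have P1: "power_sum k (m + 1) = int (a + 1) * int m ^ k"
    by (simp add: power_sum_Suc eq distrib_right)
  show "(\<Sum>q\<in>vs_primes k (m - 1). 1 / real q) \<ge> 1 - real a / real (m - 1)"
  proof (rule von_staudt_sum_ge[OF even_k k_pos, where w = 1])
    have "power_sum k m = power_sum k (m - 1) + int (m - 1) ^ k"
      using m power_sum_Suc[of k "m - 1"] by simp
    hence "1 * power_sum k (m - 1) = int a * int m ^ k - int (m - 1) ^ k" using eq by simp
    also have "[\<dots> = int a * 1 ^ k - 0 ^ k] (mod int (m - 1))"
      using m by (intro cong_diff cong_mult cong_refl cong_pow) (simp_all add: cong_iff_dvd_diff)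
    also have "int a * 1 ^ k - 0 ^ k = int a" using k by simp
    finally show "[1 * power_sum k (m - 1) = int a] (mod int (m - 1))" .
  qed (use m a in auto)
  show "(\<Sum>q\<in>vs_primes k (m + 1). 1 / real q) \<ge> 1 - real (a + 1) / real (m + 1)"
  proof (rule von_staudt_sum_ge[OF even_k k_pos, where w = 1])
    have "[int (a + 1) * int m ^ k = int (a + 1) * (-1) ^ k] (mod int (m + 1))"
      by (intro cong_mult cong_refl cong_pow) (simp add: cong_iff_dvd_diff add.commute)
    thus "[1 * power_sum k (m + 1) = int (a + 1)] (mod int (m + 1))"
      using even_k unfolding P1 by simp
  qed auto
  have w: "[2 ^ k = 1] (mod int q)" if q: "q \<in> vs_primes k n" and "odd n" for q n
  proof -
    have "prime q" "q dvd n" "(q - 1) dvd k" using q by (auto simp: vs_primes_def)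
    hence "odd q" using \<open>odd n\<close> by (meson dvd_trans)
    hence "q \<noteq> 2" "q > 0" by (auto simp: odd_pos)
    hence "\<not> q dvd 2" using \<open>prime q\<close> prime_ge_2_nat[of q] by (auto dest: dvd_imp_le)
    hence "[2 ^ (q - 1) = 1] (mod q)" using \<open>prime q\<close> by (intro fermat_theorem)
    moreover obtain r where "k = (q - 1) * r" using \<open>(q - 1) dvd k\<close> by (elim dvdE)
    ultimately have "[2 ^ k = 1] (mod q)" by (metis cong_pow power_mult power_one)
    thus ?thesis by (metis cong_int_iff of_nat_1 of_nat_numeral of_nat_power)
  qed
  show "(\<Sum>q\<in>vs_primes k (2 * m - 1). 1 / real q) \<ge> 1 - real (2 * a) / real (2 * m - 1)"
  proof (rule von_staudt_sum_ge[OF even_k k_pos, where w = "2 ^ k"])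
    have "2 * (m - 1) + 1 = 2 * m - 1" "m - 1 + 1 = m" using m by auto
    hence "[power_sum k (2 * m - 1) = 2 * power_sum k m] (mod int (2 * m - 1))"
      using power_sum_reflect[OF even_k k_pos, of "m - 1"] by simp
    hence "[2 ^ k * power_sum k (2 * m - 1) = 2 ^ k * (2 * power_sum k m)] (mod int (2 * m - 1))"
      by (rule cong_mult[OF cong_refl])
    also have "2 ^ k * (2 * power_sum k m) = 2 * int a * (2 * int m) ^ k"
      unfolding eq power_mult_distrib by (simp only: mult_ac)
    also have "[2 * int a * (2 * int m) ^ k = 2 * int a * 1 ^ k] (mod int (2 * m - 1))"
      using m by (intro cong_mult cong_refl cong_pow) (simp add: cong_iff_dvd_diff of_nat_diff)
    finally show "[2 ^ k * power_sum k (2 * m - 1) = int (2 * a)] (mod int (2 * m - 1))" by simp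
  qed (use m a w[of _ "2 * m - 1"] in auto)
  show "(\<Sum>q\<in>vs_primes k (2 * m + 1). 1 / real q) \<ge> 1 - real (2 * (a + 1)) / real (2 * m + 1)"
  proof (rule von_staudt_sum_ge[OF even_k k_pos, where w = "2 ^ k"])
    have "[2 ^ k * power_sum k (2 * m + 1) = 2 ^ k * (2 * power_sum k (m + 1))] (mod int (2 * m + 1))"
      by (rule cong_mult[OF cong_refl power_sum_reflect[OF even_k k_pos]])
    also have "2 ^ k * (2 * power_sum k (m + 1)) = 2 * int (a + 1) * (2 * int m) ^ k"
      unfolding P1 power_mult_distrib by (simp only: mult_ac)
    also have "[2 * int (a + 1) * (2 * int m) ^ k = 2 * int (a + 1) * (-1) ^ k] (mod int (2 * m + 1))"
      by (intro cong_mult cong_refl cong_pow) (simp add: cong_iff_dvd_diff add.commute)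
    also have "2 * int (a + 1) * (-1) ^ k = int (2 * (a + 1))" using even_k by simp
    finally show "[2 ^ k * power_sum k (2 * m + 1) = int (2 * (a + 1))] (mod int (2 * m + 1))" .
  qed (use w[of _ "2 * m + 1"] in auto)
qed

text \<open>
  The set of all primes produced by the four congruences, on which both lower bounds for m rest.
\<close>

definition U :: "nat set" where
  "U = vs_primes k (m - 1) \<union> vs_primes k (m + 1) \<union> vs_primes k (2 * m - 1) \<union> vs_primes k (2 * m + 1)"

lemma finite_U: "finite U" using m by (simp add: U_def finite_vs_primes)

lemma prime_U: "q \<in> U \<Longrightarrow> prime q" and U_dvd_k: "q \<in> U \<Longrightarrow> (q - 1) dvd k"
  by (auto simp: U_def vs_primes_def)

text \<open>
  Suitable differences of the four moduli are 1, 2 or 3, and 2 m - 1 and 2 m + 1 are odd.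
\<close>

lemma overlap:
  assumes q: "prime q"
  shows "\<not> (q dvd m - 1 \<and> q dvd 2 * m - 1)" "\<not> (q dvd m + 1 \<and> q dvd 2 * m + 1)"
    "\<not> (q dvd 2 * m - 1 \<and> q dvd 2 * m + 1)"
    "q dvd m - 1 \<Longrightarrow> q dvd m + 1 \<Longrightarrow> q = 2" 
    "q dvd m - 1 \<Longrightarrow> q dvd 2 * m + 1 \<Longrightarrow> q = 3"
    "q dvd m + 1 \<Longrightarrow> q dvd 2 * m - 1 \<Longrightarrow> q = 3"
proof -
  have p2: "q = 2" if "q dvd 2" using that q by (simp add: primes_dvd_imp_eq)
  have p3: "q = 3" if "q dvd 3" using that q by (simp add: primes_dvd_imp_eq)
  have not1: "\<not> q dvd 1" using q by auto
  have e1: "2 * m - 1 - 2 * (m - 1) = 1" using m by simp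
  have "q dvd 1" if "q dvd m - 1" "q dvd 2 * m - 1"
    using dvd_diff_nat[OF that(2) dvd_mult[OF that(1), of 2]] unfolding e1 .
  thus "\<not> (q dvd m - 1 \<and> q dvd 2 * m - 1)" using not1 by blast
  have e2: "2 * (m + 1) - (2 * m + 1) = 1" by simp
  have "q dvd 1" if "q dvd m + 1" "q dvd 2 * m + 1"
    using dvd_diff_nat[OF dvd_mult[OF that(1), of 2] that(2)] unfolding e2 .
  thus "\<not> (q dvd m + 1 \<and> q dvd 2 * m + 1)" using not1 by blast
  have d2: "q dvd (2 * m + 1) - (2 * m - 1)" if "q dvd 2 * m - 1" "q dvd 2 * m + 1" by (rule dvd_diff_nat[OF that(2) that(1)])
  have "(2 * m + 1) - (2 * m - 1) = 2" using m by simp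
  moreover have "\<not> 2 dvd 2 * m + 1" by simp
  ultimately show "\<not> (q dvd 2 * m - 1 \<and> q dvd 2 * m + 1)" using p2 d2 by metis
  have e3: "(m + 1) - (m - 1) = 2" using m by simp
  show "q = 2" if "q dvd m - 1" "q dvd m + 1"
    using dvd_diff_nat[OF that(2) that(1)] unfolding e3 by (rule p2)
  have e4: "(2 * m + 1) - 2 * (m - 1) = 3" using m by simp
  show "q = 3" if "q dvd m - 1" "q dvd 2 * m + 1"
    using dvd_diff_nat[OF that(2) dvd_mult[OF that(1), of 2]] unfolding e4 by (rule p3)
  have e5: "2 * (m + 1) - (2 * m - 1) = 3" using m by simp
  show "q = 3" if "q dvd m + 1" "q dvd 2 * m - 1"
    using dvd_diff_nat[OF dvd_mult[OF that(1), of 2] that(2)] unfolding e5 by (rule p3)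
qed

text \<open>
  Each of the four sums is almost 1 at least, and only the primes 2 and 3 can be counted twice. The
  loss 6/(k+1) comes from (k+1) a < m.
\<close>

lemma sum_U_ge: "(\<Sum>q\<in>U. 1 / real q) \<ge> 19 / 6 - 6 / real (k + 1)"
proof -
  define A1 A2 A3 A4 where "A1 = vs_primes k (m - 1)" and "A2 = vs_primes k (m + 1)"
    and "A3 = vs_primes k (2 * m - 1)" and "A4 = vs_primes k (2 * m + 1)"
  define f where "f = (\<lambda>q::nat. 1 / real q)"
  have U: "U = A1 \<union> A2 \<union> A3 \<union> A4" by (simp add: U_def A1_def A2_def A3_def A4_def)
  have ind: "sum f A = (\<Sum>q\<in>U. if q \<in> A then f q else 0)" if "A \<subseteq> U" for A
    using finite_U that by (simp add: sum.If_cases Int_absorb1)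
  have "sum f A1 + sum f A2 + sum f A3 + sum f A4 = (\<Sum>q\<in>U. (if q \<in> A1 then f q else 0) +
      (if q \<in> A2 then f q else 0) + (if q \<in> A3 then f q else 0) + (if q \<in> A4 then f q else 0))"
  proof -
    have "A1 \<subseteq> U" "A2 \<subseteq> U" "A3 \<subseteq> U" "A4 \<subseteq> U" unfolding U by blast+
    thus ?thesis unfolding sum.distrib by (simp only: ind[OF \<open>A1 \<subseteq> U\<close>] ind[OF \<open>A2 \<subseteq> U\<close>] ind[OF \<open>A3 \<subseteq> U\<close>] ind[OF \<open>A4 \<subseteq> U\<close>])
  qed
  also have "\<dots> \<le> (\<Sum>q\<in>U. f q + ((if q = 2 then f 2 else 0) + (if q = 3 then f 3 else 0)))"
  proof (rule sum_mono)
    fix q assume "q \<in> U"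
    hence q: "prime q" by (rule prime_U)
    note o = overlap[OF q]
    have d: "q \<in> A1 \<Longrightarrow> q dvd m - 1" "q \<in> A2 \<Longrightarrow> q dvd m + 1" "q \<in> A3 \<Longrightarrow> q dvd 2 * m - 1"
      "q \<in> A4 \<Longrightarrow> q dvd 2 * m + 1" by (simp_all add: A1_def A2_def A3_def A4_def vs_primes_def)
    have x: "\<not> (q \<in> A1 \<and> q \<in> A3)" "\<not> (q \<in> A2 \<and> q \<in> A4)" "\<not> (q \<in> A3 \<and> q \<in> A4)"
      "q \<in> A1 \<Longrightarrow> q \<in> A2 \<Longrightarrow> q = 2" "q \<in> A1 \<Longrightarrow> q \<in> A4 \<Longrightarrow> q = 3" "q \<in> A2 \<Longrightarrow> q \<in> A3 \<Longrightarrow> q = 3"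
      using o d by blast+
    have "f q \<ge> 0" "f 2 \<ge> 0" "f 3 \<ge> 0" by (auto simp: f_def)
    thus "(if q \<in> A1 then f q else 0) + (if q \<in> A2 then f q else 0) + (if q \<in> A3 then f q else 0) +
        (if q \<in> A4 then f q else 0) \<le> f q + ((if q = 2 then f 2 else 0) + (if q = 3 then f 3 else 0))"
      using x by (cases "q \<in> A1"; cases "q \<in> A2"; cases "q \<in> A3"; cases "q \<in> A4") auto
  qed
  also have "\<dots> = sum f U + ((\<Sum>q\<in>U. if q = 2 then f 2 else 0) + (\<Sum>q\<in>U. if q = 3 then f 3 else 0))"
    by (simp add: sum.distrib)
  also have "\<dots> \<le> sum f U + (1 / 2 + 1 / 3)"
    using finite_U by (intro add_left_mono add_mono) (simp_all add: sum.delta f_def)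
  finally have up: "sum f A1 + sum f A2 + sum f A3 + sum f A4 \<le> sum f U + (1 / 2 + 1 / 3)" .
  define t where "t = 1 / real (k + 1)"
  \<comment> \<open>each fraction v/n is at most c a/(m-1) with c = 1 or c = 2, and a/(m-1) is at most 1/(k+1)\<close>
  have ml: "real (k + 1) * real a \<le> real m - 1"
    using mult_less by (metis Suc_leI le_diff_eq of_nat_Suc of_nat_le_iff of_nat_mult Suc_eq_plus1 add.commute)
  have m1: "real m - 1 > 0" using m by simp
  have am: "real a / (real m - 1) \<le> t" unfolding t_def using ml m1 by (simp add: field_simps)
  have gen: "x / y \<le> c * t" if "x \<le> c * real a" "y \<ge> real m - 1" "c \<ge> 0" for x y c
  proof -
    have "x / y \<le> c * real a / y" using that m1 by (intro divide_right_mono) auto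
    also have "\<dots> \<le> c * real a / (real m - 1)" using that m1 by (intro divide_left_mono mult_pos_pos) auto
    also have "\<dots> = c * (real a / (real m - 1))" by simp
    also have "\<dots> \<le> c * t" using am that by (intro mult_left_mono)
    finally show ?thesis .
  qed
  have "real a / real (m - 1) \<le> 1 * t" using m by (intro gen) auto
  moreover have "real (a + 1) / real (m + 1) \<le> 2 * t" using m a by (intro gen) auto
  moreover have "real (2 * a) / real (2 * m - 1) \<le> 1 * t"
  proof -
    have "real (2 * a) / real (2 * m - 1) = real a / (real m - 1 / 2)" using m by (simp add: of_nat_diff field_simps)
    also have "\<dots> \<le> 1 * t" by (intro gen) auto
    finally show ?thesis .
  qed
  moreover have "real (2 * (a + 1)) / real (2 * m + 1) \<le> 2 * t"
  proof -
    have "real (2 * (a + 1)) / real (2 * m + 1) = real (a + 1) / (real m + 1 / 2)" using m by (simp add: field_simps)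
    also have "\<dots> \<le> 2 * t" using a by (intro gen) auto
    finally show ?thesis .
  qed
  moreover have "s1 + s2 + s3 + s4 \<ge> 4 - 6 * t" if "x1 \<le> 1 * t" "x2 \<le> 2 * t" "x3 \<le> 1 * t" "x4 \<le> 2 * t"
      "s1 \<ge> 1 - x1" "s2 \<ge> 1 - x2" "s3 \<ge> 1 - x3" "s4 \<ge> 1 - x4" for s1 s2 s3 s4 x1 x2 x3 x4 :: real
    using that by simp
  ultimately have "sum f A1 + sum f A2 + sum f A3 + sum f A4 \<ge> 4 - 6 * t"
    using four_sums unfolding A1_def A2_def A3_def A4_def f_def by blast
  with up have "sum f U \<ge> 19 / 6 - 6 * t" by linarith
  thus ?thesis by (simp add: t_def f_def)
qed

lemma sum_ln_U_le: "(\<Sum>q\<in>U. ln (real q)) \<le> ln 4 + 4 * ln (real m)"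
proof -
  define N where "N = (m - 1) * (m + 1) * (2 * m - 1) * (2 * m + 1)"
  have Npos: "N > 0" using m by (simp add: N_def)
  have dN: "q dvd N" if "q \<in> U" for q
  proof -
    have n: "x1 dvd x1 * x2 * x3 * x4" "x2 dvd x1 * x2 * x3 * x4" "x3 dvd x1 * x2 * x3 * x4" "x4 dvd x1 * x2 * x3 * x4"
      for x1 x2 x3 x4 :: nat by simp_all
    from that have "q dvd m - 1 \<or> q dvd m + 1 \<or> q dvd 2 * m - 1 \<or> q dvd 2 * m + 1"
      unfolding U_def vs_primes_def by blast
    thus ?thesis unfolding N_def using n dvd_trans by (elim disjE) blast+
  qed
  have "\<Prod>F dvd N" if "finite F" "F \<subseteq> U" for F
    using that
  proof (induction F)
    case (insert q F)
    have "coprime q (\<Prod>F)"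
    proof (intro prod_coprime_right)
      fix r assume "r \<in> F"
      hence "prime r" "prime q" "r \<noteq> q" using insert prime_U by auto
      thus "coprime q r" by (simp add: primes_coprime)
    qed
    thus ?case using insert dN by (simp add: divides_mult)
  qed simp
  hence "\<Prod>U dvd N" using finite_U by blast
  hence "real (\<Prod>U) \<le> real N" using Npos by (simp only: of_nat_le_iff dvd_imp_le)
  have pos: "q > 0" if "q \<in> U" for q using prime_U[OF that] by (rule prime_gt_0_nat)
  have "(\<Sum>q\<in>U. ln (real q)) = ln (\<Prod>q\<in>U. real q)" using pos finite_U by (subst ln_prod) auto
  also have "\<dots> = ln (real (\<Prod>U))" by simp
  also have "\<dots> \<le> ln (real N)"
    using \<open>real (\<Prod>U) \<le> real N\<close> Npos pos finite_U by (subst ln_le_cancel_iff) (auto intro!: prod_pos)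
  also have "\<dots> \<le> ln (4 * real m ^ 4)"
  proof (subst ln_le_cancel_iff)
    have "real N = (real m - 1) * (real m + 1) * (2 * real m - 1) * (2 * real m + 1)"
    proof -
      have "real (m - 1) = real m - 1" "real (2 * m - 1) = 2 * real m - 1" using m by (simp_all add: of_nat_diff)
      thus ?thesis unfolding N_def of_nat_mult of_nat_add by (simp only: of_nat_1 of_nat_numeral of_nat_mult)
    qed
    also have "\<dots> = 4 * real m ^ 4 - (5 * real m ^ 2 - 1)" by (simp add: algebra_simps power2_eq_square power4_eq_xxxx)
    moreover have "real m ^ 2 \<ge> 1" using m by (intro one_le_power) auto
    ultimately show "real N \<le> 4 * real m ^ 4" by linarith
  qed (use m Npos in auto)
  also have "\<dots> = ln 4 + 4 * ln (real m)" using m by (simp add: ln_mult ln_realpow)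
  finally show ?thesis .
qed

end

section \<open>A divisor sum of Rankin type\<close>

text \<open>
  For each prime p this bounds, for all e, the sum of p^(-i/2) over i \<le> e divided by p^(e/28).
  The decimals come from treating e = 1 and e \<ge> 2 separately and rounding up.
\<close>

definition rankin_factor :: "nat \<Rightarrow> real" where
  "rankin_factor p = (if p = 2 then 3251 / 1000
     else if p = 3 then 2188 / 1000
     else if p = 5 then 1614 / 1000
     else if p = 7 then 1400 / 1000
     else if p = 11 then 1207 / 1000
     else if p = 13 then 1166 / 1000
     else if p = 17 then 1124 / 1000
     else if p = 19 then 1107 / 1000
     else if p = 23 then 1081 / 1000
     else if p = 29 then 1052 / 1000
     else if p = 31 then 1044 / 1000
     else if p = 37 then 1024 / 1000
     else if p = 41 then 1013 / 1000
     else if p = 43 then 1008 / 1000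
     else 1)"

lemma rankin_factor_ge_1: "rankin_factor p \<ge> 1"
  by (simp add: rankin_factor_def)

text \<open>
  For e \<ge> 2 the full geometric series is compared with the second power of y; this is enough,
  since y^e only grows.
\<close>

lemma geometric_factor_bound:
  fixes x y A u r :: real
  assumes x: "0 \<le> x" "x \<le> u" "u < 1" and y: "1 \<le> r" "r \<le> y"
    and A: "1 \<le> A" "1 + u \<le> A * r" "1 \<le> A * r\<^sup>2 * (1 - u)"
  shows "(\<Sum>i\<le>e. x ^ i) \<le> A * y ^ e"
proof -
  consider "e = 0" | "e = 1" | "e \<ge> 2" by linarith
  thus ?thesis
  proof cases
    case 2
    have "A * r \<le> A * y" using A y by (intro mult_left_mono) auto
    hence "1 + x \<le> A * y" using x A by linarith
    thus ?thesis using 2 by simp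
  next
    case 3
    have "(1 - x) * (\<Sum>i\<le>e. x ^ i) = 1 - x ^ Suc e" by (rule sum_gp_basic)
    also have "\<dots> \<le> 1" using x by simp
    also have "1 \<le> A * r\<^sup>2 * (1 - u)" by fact
    also have "\<dots> \<le> A * y ^ e * (1 - x)"
    proof (intro mult_mono)
      have "r\<^sup>2 \<le> y\<^sup>2" using y by (intro power_mono) auto
      also have "\<dots> \<le> y ^ e" using y 3 by (intro power_increasing) auto
      finally show "r\<^sup>2 \<le> y ^ e" .
    qed (use x y A in auto)
    finally have "(1 - x) * (\<Sum>i\<le>e. x ^ i) \<le> (1 - x) * (A * y ^ e)" by (simp only: mult_ac)
    thus ?thesis using x by (simp add: mult_le_cancel_left)
  qed (use A in auto)
qed

text \<open>
  Here u is a rational upper bound for the inverse square root of p and r a rational lower bound for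
  its 28th root.
\<close>

lemma local_factor_aux:
  fixes p :: nat and u r :: real
  assumes "1 \<le> p * u\<^sup>2" "0 < u" "u < 1" "1 \<le> r" "r ^ 28 \<le> p"
    and "1 + u \<le> rankin_factor p * r" "1 \<le> rankin_factor p * r\<^sup>2 * (1 - u)"
  shows "(\<Sum>i\<le>e. (1 / sqrt p) ^ i) \<le> rankin_factor p * (p powr (1 / 28)) ^ e"
proof (rule geometric_factor_bound[where u = u and r = r])
  have p: "real p > 0" using assms(1) by (cases "p = 0") auto
  have "(1 / u)\<^sup>2 \<le> p" using assms(1,2) by (simp add: power_divide field_simps)
  hence "1 / u \<le> sqrt p" by (rule real_le_rsqrt)
  thus "1 / sqrt p \<le> u" using p assms(2) by (simp add: field_simps)
  have "r ^ 28 = r powr 28" using assms(4) powr_realpow[of r 28] by simp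
  hence "(r ^ 28) powr (1 / 28) = r powr (28 * (1 / 28))" by (simp only: powr_powr)
  also have "\<dots> = r" using assms(4) by simp
  finally have "r = (r ^ 28) powr (1 / 28)" ..
  also have "\<dots> \<le> p powr (1 / 28)" using assms(4,5) by (intro powr_mono2) auto
  finally show "r \<le> p powr (1 / 28)" .
qed (use assms rankin_factor_ge_1 in auto)

lemma local_factor:
  assumes "prime p"
  shows "(\<Sum>i\<le>e. (1 / sqrt p) ^ i) \<le> rankin_factor p * (p powr (1 / 28)) ^ e"
proof -
  have c2: ?thesis if "p = 2"
    unfolding that by (rule local_factor_aux[where u = "7072 / 10000" and r = "10250 / 10000"]) (simp_all add: rankin_factor_def power_divide)
  have c3: ?thesis if "p = 3"
    unfolding that by (rule local_factor_aux[where u = "5774 / 10000" and r = "10400 / 10000"]) (simp_all add: rankin_factor_def power_divide)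
  have c5: ?thesis if "p = 5"
    unfolding that by (rule local_factor_aux[where u = "4473 / 10000" and r = "10591 / 10000"]) (simp_all add: rankin_factor_def power_divide)
  have c7: ?thesis if "p = 7"
    unfolding that by (rule local_factor_aux[where u = "3780 / 10000" and r = "10719 / 10000"]) (simp_all add: rankin_factor_def power_divide)
  have c11: ?thesis if "p = 11"
    unfolding that by (rule local_factor_aux[where u = "3016 / 10000" and r = "10894 / 10000"]) (simp_all add: rankin_factor_def power_divide)
  have c13: ?thesis if "p = 13"
    unfolding that by (rule local_factor_aux[where u = "2774 / 10000" and r = "10959 / 10000"]) (simp_all add: rankin_factor_def power_divide)
  have c17: ?thesis if "p = 17"
    unfolding that by (rule local_factor_aux[where u = "2426 / 10000" and r = "11064 / 10000"]) (simp_all add: rankin_factor_def power_divide)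
  have c19: ?thesis if "p = 19"
    unfolding that by (rule local_factor_aux[where u = "2295 / 10000" and r = "11108 / 10000"]) (simp_all add: rankin_factor_def power_divide)
  have c23: ?thesis if "p = 23"
    unfolding that by (rule local_factor_aux[where u = "2086 / 10000" and r = "11184 / 10000"]) (simp_all add: rankin_factor_def power_divide)
  have c29: ?thesis if "p = 29"
    unfolding that by (rule local_factor_aux[where u = "1857 / 10000" and r = "11277 / 10000"]) (simp_all add: rankin_factor_def power_divide)
  have c31: ?thesis if "p = 31"
    unfolding that by (rule local_factor_aux[where u = "1797 / 10000" and r = "11304 / 10000"]) (simp_all add: rankin_factor_def power_divide)
  have c37: ?thesis if "p = 37"
    unfolding that by (rule local_factor_aux[where u = "1644 / 10000" and r = "11376 / 10000"]) (simp_all add: rankin_factor_def power_divide)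
  have c41: ?thesis if "p = 41"
    unfolding that by (rule local_factor_aux[where u = "1562 / 10000" and r = "11418 / 10000"]) (simp_all add: rankin_factor_def power_divide)
  have c43: ?thesis if "p = 43"
    unfolding that by (rule local_factor_aux[where u = "1525 / 10000" and r = "11437 / 10000"]) (simp_all add: rankin_factor_def power_divide)
  have big: ?thesis if "p \<ge> 47"
  proof (rule local_factor_aux[where u = "1459 / 10000" and r = "11473 / 10000"])
    have rf: "rankin_factor p = 1" using that by (simp add: rankin_factor_def)
    show "1 + 1459 / 10000 \<le> rankin_factor p * (11473 / 10000)"
      "1 \<le> rankin_factor p * (11473 / 10000)\<^sup>2 * (1 - 1459 / 10000)" unfolding rf by (simp_all add: power2_eq_square)
    have p: "real p \<ge> 47" using that by simp
    have "(11473 / 10000 :: real) ^ 28 \<le> 47" by (simp add: power_divide)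
    thus "(11473 / 10000 :: real) ^ 28 \<le> real p" using p by linarith
    have "47 * (1459 / 10000)\<^sup>2 \<le> real p * (1459 / 10000)\<^sup>2" using p by (intro mult_right_mono) auto
    thus "1 \<le> real p * (1459 / 10000)\<^sup>2" by (simp add: power2_eq_square)
  qed auto
  have "p = 2 \<or> p = 3 \<or> p = 5 \<or> p = 7 \<or> p = 11 \<or> p = 13 \<or> p = 17 \<or> p = 19 \<or> p = 23 \<or> p = 29 \<or> p = 31 \<or> p = 37 \<or> p = 41 \<or> p = 43" if "p < 47"
  proof -
    have "p = 0 \<or> p = 1 \<or> p = 2 \<or> p = 3 \<or> p = 5 \<or> p = 7 \<or> p = 11 \<or> p = 13 \<or> p = 17 \<or> p = 19 \<or> p = 23 \<or> p = 29 \<or> p = 31 \<or> p = 37 \<or> p = 41 \<or> p = 43 \<or> 2 dvd p \<or> 3 dvd p \<or> 5 dvd p" using that by presburger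
    moreover have "q = p" if "q dvd p" "prime q" for q using that assms by (simp add: primes_dvd_imp_eq)
    from this[of 2] this[of 3] this[of 5] have "2 dvd p \<Longrightarrow> p = 2" "3 dvd p \<Longrightarrow> p = 3" "5 dvd p \<Longrightarrow> p = 5" by auto
    moreover have "p \<noteq> 0" "p \<noteq> 1" using assms by auto
    ultimately show ?thesis by metis
  qed
  thus ?thesis using big c2 c3 c5 c7 c11 c13 c17 c19 c23 c29 c31 c37 c41 c43 by (meson linorder_not_less)
qed

text \<open>
  Rankin's method: the divisor sum is multiplicative, and each local factor is bounded by a constant
  times p^(e/28).
\<close>

lemma sum_divisors_inv_sqrt_le:
  assumes "k > (0::nat)"
  shows "(\<Sum>d | d dvd k. 1 / sqrt (real d)) \<le> (\<Prod>p\<in>prime_factors k. rankin_factor p) * k powr (1 / 28)"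
  using assms
proof (induction k rule: less_induct)
  case (less k)
  show ?case
  proof (cases "k = 1")
    case False
    then obtain p where p: "prime p" "p dvd k" using prime_factor_nat by blast
    define e where "e = multiplicity p k"
    obtain l where l: "k = p ^ e * l" "\<not> p dvd l"
      unfolding e_def by (rule multiplicity_decompose'[of k p]) (use less.prems p(1) in auto)
    have e: "e > 0" using p less.prems by (simp add: e_def prime_multiplicity_gt_zero_iff)
    have l0: "l > 0" using less.prems l by (cases "l = 0") auto
    have p1: "p > 1" using p(1) by (rule prime_gt_1_nat)
    have "l < k" unfolding l(1) using l0 one_less_power[OF p1 e] by simp
    define D where "D = {d. d dvd l}"
    have fD: "finite D" unfolding D_def using l0 by simp
    have sub: "{d. d dvd k} \<subseteq> (\<lambda>(i, d). p ^ i * d) ` ({..e} \<times> D)"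
    proof
      fix d assume "d \<in> {d. d dvd k}"
      hence "d dvd p ^ e * l" by (simp add: l(1))
      then obtain b c where bc: "d = b * c" "b dvd p ^ e" "c dvd l" using division_decomp by blast
      then obtain i where "i \<le> e" "b = p ^ i" using p(1) by (auto simp: divides_primepow_nat)
      thus "d \<in> (\<lambda>(i, d). p ^ i * d) ` ({..e} \<times> D)"
        using bc by (intro image_eqI[of _ _ "(i, c)"]) (auto simp: D_def)
    qed
    have "(\<Sum>d | d dvd k. 1 / sqrt (real d)) \<le> (\<Sum>d\<in>(\<lambda>(i, d). p ^ i * d) ` ({..e} \<times> D). 1 / sqrt (real d))"
      using sub fD by (intro sum_mono2) auto
    also have "\<dots> \<le> (\<Sum>x\<in>{..e} \<times> D. ((\<lambda>d. 1 / sqrt (real d)) \<circ> (\<lambda>(i, d). p ^ i * d)) x)"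
      using fD by (intro sum_image_le) auto
    also have "\<dots> = (\<Sum>i\<le>e. (1 / sqrt p) ^ i) * (\<Sum>d\<in>D. 1 / sqrt (real d))"
      unfolding sum_product sum.cartesian_product
      by (intro sum.cong refl) (auto simp: real_sqrt_mult real_sqrt_power power_divide)
    also have "\<dots> \<le> (rankin_factor p * (p powr (1 / 28)) ^ e) *
        ((\<Prod>p\<in>prime_factors l. rankin_factor p) * l powr (1 / 28))"
      using less.IH[OF \<open>l < k\<close> l0] local_factor[OF p(1)] rankin_factor_ge_1[of p] unfolding D_def
      by (intro mult_mono sum_nonneg mult_nonneg_nonneg) auto
    also have "\<dots> = (rankin_factor p * (\<Prod>p\<in>prime_factors l. rankin_factor p)) * ((p powr (1 / 28)) ^ e * l powr (1 / 28))"
      by (simp only: mult_ac)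
    also have "(p powr (1 / 28)) ^ e = (real (p ^ e)) powr (1 / 28)"
      using p1 by (simp add: powr_powr powr_power mult.commute flip: powr_realpow)
    also have "(real (p ^ e)) powr (1 / 28) * l powr (1 / 28) = k powr (1 / 28)"
      unfolding l(1) by (simp add: powr_mult)
    also have "rankin_factor p * (\<Prod>p\<in>prime_factors l. rankin_factor p) = (\<Prod>p\<in>prime_factors k. rankin_factor p)"
    proof -
      have "prime_factors k = insert p (prime_factors l)"
        unfolding l(1) using l0 p e p1 by (subst prime_factors_product) (auto simp: prime_factors_power prime_prime_factors)
      moreover have "p \<notin> prime_factors l" using l(2) by auto
      ultimately show ?thesis by simp
    qed
    finally show ?thesis .
  qed simp
qed

text \<open>
  The exponent 1/28 is chosen so that k^(1/28) is at most 10; the product of the factors is just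
  below 35.
\<close>

lemma sum_divisors_inv_sqrt_bound:
  assumes "k > (0::nat)" "k < 10 ^ 28"
  shows "(\<Sum>d | d dvd k. 1 / sqrt (real d)) \<le> 350"
proof -
  define L :: "nat set" where "L = {2, 3, 5, 7, 11, 13, 17, 19, 23, 29, 31, 37, 41, 43}"
  have "(\<Prod>p\<in>prime_factors k. rankin_factor p) \<le> (\<Prod>p\<in>prime_factors k \<union> L. rankin_factor p)"
    using rankin_factor_ge_1 by (intro prod_mono2) (auto simp: L_def intro: order_trans[of 0 1])
  also have "\<dots> = (\<Prod>p\<in>L. rankin_factor p)"
    by (rule prod.mono_neutral_right) (auto simp: L_def rankin_factor_def)
  also have "\<dots> \<le> 35" by (simp add: L_def rankin_factor_def)
  finally have P: "(\<Prod>p\<in>prime_factors k. rankin_factor p) \<le> 35" .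
  have "real k \<le> 10 powr 28"
  proof -
    have "real k \<le> real (10 ^ 28)" using assms(2) by (simp only: of_nat_le_iff less_imp_le)
    thus ?thesis by simp
  qed
  hence "real k powr (1 / 28) \<le> (10 powr 28) powr (1 / 28)" by (intro powr_mono2) auto
  also have "\<dots> = 10" unfolding powr_powr by simp
  finally have "(\<Prod>p\<in>prime_factors k. rankin_factor p) * real k powr (1 / 28) \<le> 35 * 10"
    using P by (intro mult_mono) auto
  thus ?thesis using sum_divisors_inv_sqrt_le[OF assms(1)] by linarith
qed

section \<open>The lower bounds for k and m\<close>

text \<open>
  Linear programming duality: replacing 1/q by 1/q - (ln q)/(x ln x) for q \<le> x and by 0 beyond,
  every set of primes contributes at most as much as the set of all primes up to x. The function h
  pays for the difference.
\<close>

lemma prime_set_recip_sum_le: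
  assumes U: "finite U" "\<And>q. q \<in> U \<Longrightarrow> prime q"
    and lo: "\<And>q. q \<in> U \<Longrightarrow> real q \<le> xtop \<Longrightarrow> ln (real q) * inv_mul_ln xtop \<le> h q"
    and hi: "\<And>q. q \<in> U \<Longrightarrow> real q > xtop \<Longrightarrow> 1 / real q \<le> h q"
  shows "(\<Sum>q\<in>U. 1 / real q) \<le> 310967 / 100000 + (\<Sum>q\<in>U. h q)"
proof -
  define w where "w = (\<lambda>q::nat. 1 / real q - ln (real q) * inv_mul_ln xtop)"
  have fin: "finite {p::nat. prime p \<and> real p \<le> xtop}"
    by (rule finite_subset[of _ "{..nat \<lfloor>xtop\<rfloor>}"]) (auto simp: le_nat_floor)
  have "(\<Sum>q\<in>U. 1 / real q) \<le> (\<Sum>q\<in>U. (if real q \<le> xtop then w q else 0) + h q)"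
    using lo hi by (intro sum_mono) (auto simp: w_def not_le)
  also have "\<dots> = (\<Sum>q\<in>{q\<in>U. real q \<le> xtop}. w q) + (\<Sum>q\<in>U. h q)"
    using U(1) by (simp add: sum.distrib sum.If_cases Int_def)
  also have "(\<Sum>q\<in>{q\<in>U. real q \<le> xtop}. w q) \<le> (\<Sum>p | prime p \<and> real p \<le> xtop. w p)"
  proof (rule sum_mono2[OF fin])
    fix q assume "q \<in> {p. prime p \<and> real p \<le> xtop} - {q \<in> U. real q \<le> xtop}"
    hence q: "prime q" "real q \<le> xtop" by auto
    have q1: "real q > 1" using prime_gt_1_nat[OF q(1)] by simp
    have "real q * ln (real q) \<le> xtop * ln xtop" using q q1 by (intro mult_mono) auto
    moreover have "xtop * ln xtop > 0" using q q1 by (simp add: ln_xtop)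
    ultimately have "ln (real q) * (1 / (xtop * ln xtop)) \<le> 1 / real q" using q1 by (simp add: field_simps)
    thus "w q \<ge> 0" by (simp add: w_def inv_mul_ln_def)
  qed (use U in auto)
  also have "\<dots> \<le> 310967 / 100000" unfolding w_def by (rule prime_recip_sum_bound)
  finally show ?thesis by simp
qed

context erdos_moser
begin

text \<open>
  The map sending q to q - 1 injects the primes into the divisors of k.
\<close>

lemma sum_sqrt_U_le: "(\<Sum>q\<in>U. 1 / sqrt q) \<le> (\<Sum>d | d dvd k. 1 / sqrt (real d))"
proof -
  have ge2: "q \<ge> 2" if "q \<in> U" for q using prime_U[OF that] by (rule prime_ge_2_nat)
  have inj: "inj_on (\<lambda>q. q - 1) U"
  proof (rule inj_onI)
    fix x y assume "x \<in> U" "y \<in> U" "x - 1 = y - 1"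
    thus "x = y" using ge2[of x] ge2[of y] by linarith
  qed
  have "(\<Sum>q\<in>U. 1 / sqrt q) \<le> (\<Sum>q\<in>U. 1 / sqrt (real (q - 1)))"
  proof (rule sum_mono)
    fix q assume "q \<in> U"
    show "1 / sqrt q \<le> 1 / sqrt (real (q - 1))"
      by (intro divide_left_mono mult_pos_pos) (use ge2[OF \<open>q \<in> U\<close>] in auto)
  qed
  also have "\<dots> = (\<Sum>d\<in>(\<lambda>q. q - 1) ` U. 1 / sqrt (real d))"
    unfolding sum.reindex[OF inj] comp_def ..
  also have "\<dots> \<le> (\<Sum>d | d dvd k. 1 / sqrt (real d))"
  proof (rule sum_mono2)
    show "finite {d. d dvd k}" using k_pos by simp
    show "(\<lambda>q. q - 1) ` U \<subseteq> {d. d dvd k}" using U_dvd_k by blast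
  qed simp
  finally show ?thesis .
qed

text \<open>
  For x = exp(18.2) both 1/q for q > x and (ln q)/(x ln x) for q \<le> x are at most 1/sqrt(q x). If
  k were below 10^28, the divisor sum would allow these terms to add up to at most 350/8954, which
  together with 3.10967 stays below 19/6 - 6/401. Small k are excluded separately, because then
  6/(k+1) is large; there all primes in question are at most k + 1.
\<close>

lemma k_ge: "k \<ge> 10 ^ 28"
proof (rule ccontr)
  assume "\<not> k \<ge> 10 ^ 28"
  hence k28: "k < 10 ^ 28" by linarith
  have q_le: "q \<le> k + 1" if "q \<in> U" for q
    using dvd_imp_le[OF U_dvd_k[OF that] k_pos] by linarith
  consider "k < 6" | "6 \<le> k" "k < 400" | "k \<ge> 400" by linarith
  thus False
  proof cases
    case 1
    hence "k \<le> 4" using even_k by (cases "k = 5") auto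
    have "U \<subseteq> {2, 3, 5}"
    proof
      fix q assume "q \<in> U"
      hence "prime q" "q \<le> 5" using q_le[of q] prime_U \<open>k \<le> 4\<close> by auto
      moreover have "q = 0 \<or> q = 1 \<or> q = 2 \<or> q = 3 \<or> q = 4 \<or> q = 5" using \<open>q \<le> 5\<close> by presburger
      ultimately show "q \<in> {2, 3, 5}" by (elim disjE) simp_all
    qed
    hence "(\<Sum>q\<in>U. 1 / real q) \<le> (\<Sum>q\<in>{2, 3, 5}. 1 / real q)" by (intro sum_mono2) auto
    also have "\<dots> = 31 / 30" by simp
    finally have "19 / 6 - 6 / real (k + 1) \<le> 31 / 30" using sum_U_ge by linarith
    moreover have "6 / real (k + 1) \<le> 6 / 3" using k by (intro divide_left_mono) auto
    ultimately show False by linarith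
  next
    case 2
    have "U \<subseteq> {p. prime p \<and> p \<le> 403}" using q_le prime_U 2 by force
    hence "(\<Sum>q\<in>U. 1 / real q) \<le> (\<Sum>p | prime p \<and> p \<le> 403. 1 / real_of_int (int p))"
      unfolding of_int_of_nat_eq by (intro sum_mono2) auto
    also have "\<dots> = (\<Sum>t\<leftarrow>log_table. 1 / real_of_int (fst t))" by (rule sum_small_primes)
    also have "\<dots> \<le> 206128 / 100000" using small_prime_recip_sum by simp
    finally have "19 / 6 - 6 / real (k + 1) \<le> 206128 / 100000" using sum_U_ge by linarith
    moreover have "6 / real (k + 1) \<le> 6 / 7" using 2 by (intro divide_left_mono) auto
    ultimately show False by linarith
  next
    case 3
    define s where "s = sqrt xtop"
    have x: "xtop > 0" using xtop_ge by linarith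
    have s: "s \<ge> 8954"
      unfolding s_def using xtop_ge by (intro real_le_rsqrt) simp
    have ss: "s * s = xtop" using x by (simp add: s_def)
    have "(\<Sum>q\<in>U. 1 / real q) \<le> 310967 / 100000 + (\<Sum>q\<in>U. 1 / s * (1 / sqrt q))"
    proof (rule prime_set_recip_sum_le[OF finite_U prime_U])
      fix q assume q: "q \<in> U" "real q \<le> xtop"
      have q1: "real q > 1" using prime_gt_1_nat[OF prime_U[OF q(1)]] by simp
      have "sqrt q \<le> s" using q by (simp add: s_def)
      have "ln (real q) / ln xtop \<le> 1" using q q1 by (simp add: ln_xtop flip: ln_xtop)
      hence "ln (real q) * inv_mul_ln xtop \<le> 1 / xtop"
        using x by (simp add: inv_mul_ln_def field_simps)
      also have "\<dots> = 1 / s * (1 / s)" using ss by simp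
      also have "\<dots> \<le> 1 / s * (1 / sqrt q)"
        using \<open>sqrt q \<le> s\<close> q1 s by (intro mult_left_mono divide_left_mono) auto
      finally show "ln (real q) * inv_mul_ln xtop \<le> 1 / s * (1 / sqrt q)" .
    next
      fix q assume q: "q \<in> U" "real q > xtop"
      have "s \<le> sqrt q" using q by (simp add: s_def)
      have "1 / real q = 1 / sqrt q * (1 / sqrt q)" by simp
      also have "\<dots> \<le> 1 / s * (1 / sqrt q)"
        using \<open>s \<le> sqrt q\<close> s q x by (intro mult_right_mono divide_left_mono mult_pos_pos) auto
      finally show "1 / real q \<le> 1 / s * (1 / sqrt q)" .
    qed
    also have "(\<Sum>q\<in>U. 1 / s * (1 / sqrt q)) = 1 / s * (\<Sum>q\<in>U. 1 / sqrt q)" by (simp only: sum_distrib_left)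
    also have "\<dots> \<le> 1 / 8954 * 350"
    proof (rule mult_mono)
      show "1 / s \<le> 1 / 8954" using s by (intro divide_left_mono) auto
      show "(\<Sum>q\<in>U. 1 / sqrt q) \<le> 350"
        using sum_sqrt_U_le sum_divisors_inv_sqrt_bound[OF k_pos k28] by linarith
    qed (auto intro: sum_nonneg)
    finally have "19 / 6 - 6 / real (k + 1) \<le> 310967 / 100000 + 1 / 8954 * 350" using sum_U_ge by linarith
    moreover have "6 / real (k + 1) \<le> 6 / 401" using 3 by (intro divide_left_mono) auto
    ultimately show False by linarith
  qed
qed

text \<open>
  Here h q = (ln q)/(x ln x). The logarithms of the primes in question add up to at most ln 4 + 4 ln
  m, and for m \<le> 10^(9000000) this would be less than 82893080.
\<close>

lemma ln_m_gt: "ln (real m) > 9000000 * ln 10"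
proof (rule ccontr)
  assume "\<not> ln (real m) > 9000000 * ln 10"
  hence m_le: "ln (real m) \<le> 9000000 * ln 10" by linarith
  define g where "g = inv_mul_ln xtop"
  have x: "xtop > 0" using xtop_ge by linarith
  have "(\<Sum>q\<in>U. 1 / real q) \<le> 310967 / 100000 + (\<Sum>q\<in>U. ln (real q) * g)"
  proof (rule prime_set_recip_sum_le[OF finite_U prime_U])
    fix q assume q: "q \<in> U" "real q > xtop"
    have q1: "real q > 1" using prime_gt_1_nat[OF prime_U[OF q(1)]] by simp
    have "xtop * ln xtop \<le> real q * ln (real q)" using q q1 xtop_ge by (intro mult_mono) auto
    moreover have "xtop * ln xtop > 0" using x by (simp add: ln_xtop)
    ultimately show "1 / real q \<le> ln (real q) * g" using q1 by (simp add: g_def inv_mul_ln_def field_simps)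
  qed (simp_all add: g_def)
  also have "(\<Sum>q\<in>U. ln (real q) * g) = (\<Sum>q\<in>U. ln (real q)) * g" by (simp only: sum_distrib_right)
  also have "\<dots> \<le> 82893080 * (1 / (80190000 * (182 / 10)))"
  proof (rule mult_mono)
    have "ln (4::real) = 2 * ln 2" using ln_realpow[of 2 2] by simp
    moreover have "ln (10::real) = ln 2 + ln 5" using ln_mult[of 2 "5::real"] by simp
    ultimately show "(\<Sum>q\<in>U. ln (real q)) \<le> 82893080"
      using sum_ln_U_le m_le ln_small_primes_bounds by linarith
    show "g \<le> 1 / (80190000 * (182 / 10))"
      unfolding g_def inv_mul_ln_def ln_xtop using xtop_ge by (intro divide_left_mono mult_right_mono mult_pos_pos) auto
    show "0 \<le> g" unfolding g_def inv_mul_ln_def ln_xtop using x by simp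
  qed simp
  finally have "19 / 6 - 6 / real (k + 1) \<le> 310967 / 100000 + 82893080 * (1 / (80190000 * (182 / 10)))"
    using sum_U_ge by linarith
  moreover have "6 / real (k + 1) \<le> 6 / 1000000"
  proof (intro divide_left_mono)
    have "(1000000::nat) \<le> 10 ^ 28" by simp
    hence "1000000 \<le> k + 1" using k_ge by linarith
    hence "real 1000000 \<le> real (k + 1)" by (simp only: of_nat_le_iff)
    thus "1000000 \<le> real (k + 1)" by simp
  qed auto
  ultimately show False by argo
qed

lemma m_bounds: "m \<ge> a * 10 ^ 28" "m \<ge> 10 ^ (9 * 10 ^ 6)"
proof -
  have "10 ^ 28 * a \<le> (k + 1) * a" using k_ge by (intro mult_right_mono) auto
  thus "m \<ge> a * 10 ^ 28" using mult_less by (simp only: mult.commute)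
  define N :: nat where "N = 9 * 10 ^ 6"
  have rN: "real N = 9000000" by (simp add: N_def)
  have "10 ^ N \<le> m"
  proof (rule ccontr)
    assume "\<not> 10 ^ N \<le> m"
    hence "real m \<le> 10 ^ N"
      by (metis linorder_not_le less_imp_le of_nat_le_iff of_nat_numeral of_nat_power)
    hence "ln (real m) \<le> ln (10 ^ N)" using m by (subst ln_le_cancel_iff) auto
    also have "\<dots> = real N * ln 10" by (simp add: ln_realpow)
    finally show False using ln_m_gt unfolding rN by linarith
  qed
  thus "m \<ge> 10 ^ (9 * 10 ^ 6)" unfolding N_def .
qed

end

lemma power_sum_int: "k > 0 \<Longrightarrow> (\<Sum>j = 1..int M - 1. j ^ k) = power_sum k M"
proof -
  assume k: "k > 0"
  have "(\<Sum>j = 1..int M - 1. j ^ k) = (\<Sum>j\<in>{1..<M}. int j ^ k)"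
    by (rule sum.reindex_bij_witness[of _ int nat]) auto
  also have "\<dots> = power_sum k M"
    unfolding power_sum_def using k by (intro sum.mono_neutral_left) auto
  finally show ?thesis .
qed

theorem theorem7:
  shows "\<not> (\<exists>(a::int) (m::int) (k::nat).
           a \<ge> 1 \<and> m \<ge> 2 \<and> k \<ge> 2 \<and>
           m < max (10 ^ (9 * 10 ^ 6)) (a * 10 ^ 28) \<and>
           (\<Sum>j = 1..m - 1. j ^ k) = a * m ^ k)"
proof (intro notI, elim exE conjE)
  fix a m :: int and k :: nat
  assume a: "a \<ge> 1" and m: "m \<ge> 2" and k: "k \<ge> 2"
    and less: "m < max (10 ^ (9 * 10 ^ 6)) (a * 10 ^ 28)" and eq: "(\<Sum>j = 1..m - 1. j ^ k) = a * m ^ k"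
  define A M where "A = nat a" and "M = nat m"
  have AM: "a = int A" "m = int M" using a m by (auto simp: A_def M_def)
  \<comment> \<open>the equation over the natural numbers\<close>
  interpret erdos_moser A M k
  proof
    show "power_sum k M = int A * int M ^ k" using eq power_sum_int[of k M] k unfolding AM by simp
  qed (use a m k in \<open>auto simp: AM\<close>)
  have "int (A * 10 ^ 28) \<le> int M" unfolding of_nat_le_iff by (rule m_bounds(1))
  hence 1: "a * 10 ^ 28 \<le> m" unfolding AM of_nat_mult of_nat_power of_nat_numeral .
  have "int (10 ^ (9 * 10 ^ 6)) \<le> int M" unfolding of_nat_le_iff by (rule m_bounds(2))
  hence 2: "10 ^ (9 * 10 ^ 6) \<le> m" unfolding AM of_nat_power of_nat_numeral .
  from less_max_iff_disj[THEN iffD1, OF less] show False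
    by (rule disjE) (erule notE[OF leD[OF 2]], erule notE[OF leD[OF 1]])
qed

end
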